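(* Let $d\ge1$, and fix $\lambda>0$ and $r>0$. Let $g$ be a continuous process in $\mathbb{R}^d$ with $g(0)=0$. (i) If $g$ is a deterministic continuous function, then for every $t\ge 0$ $$-\frac1\lambda\log\mathbf{P}[T_{\mathrm{det}}>t]=\mathbf{E}[\mathrm{vol}(W_g(t))].$$ (ii) If $g$ is random but independent of the nodes of $\Pi_0$ and their motions, then there is a positive constant $\beta_1$ such that, as $t\to\infty$, $$-\frac1\lambda\log\mathbf{P}[T_{\mathrm{det}}>t]\ \ge\ \begin{cases}V_0(t)&\text{for } d=1,\\ (1-o(1))V_0(t)&\text{for } d=2,\\ (1-o(1))\beta_1V_0(t)&\text{for } d\ge3.\end{cases}$$ (iii) If $g$ is a standard Brownian motion (independent of the nodes of $\Pi_0$ and their motions), then there is a positive constant $\beta_2$ such that, as $t\to\infty$, $$-\frac1\lambda\log\mathbf{P}[T_{\mathrm{det}}>t]\ \le\ \begin{cases}(1+o(1))V_0(t)&\text{for } d=1,2,\\ (1+o(1))\beta_2V_0(t)&\text{for } d\ge3.\end{cases}$$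
   Context: Mobile geometric graph model: $\Pi_0=\{X_i\}_i$ is a Poisson point process on $\mathbb{R}^d$ of intensity $\lambda$; each node $X_i$ moves as $X_i+\zeta_i(s)$, $s\ge 0$, where the $\zeta_i$ are independent standard $d$-dimensional Brownian motions started at $0$, independent of $\Pi_0$. $B(x,r)$ denotes the (closed) ball of radius $r$ centered at $x$, and $\mathrm{vol}$ is Lebesgue measure on $\mathbb{R}^d$. A target particle has position $g(s)$ at time $s$, starting at the origin. The detection time is $$T_{\mathrm{det}}=\inf\Big\{t\ge 0:\ g(t)\in\bigcup_i B(X_i+\zeta_i(t),r)\Big\}.$$ For a standard $d$-dimensional Brownian motion $\zeta$ started at $0$ and a continuous function $g$, the Wiener sausage with drift up to time $t$ is $W_g(t)=\bigcup_{s\le t}B(g(s)-\zeta(s),r)$; $W_0$ denotes the case $g\equiv0$, and $V_0(t)=\mathbf{E}[\mathrm{vol}(W_0(t))]$. *)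

theory Defs
  imports "HOL-Probability.Probability" "HOL-Library.Landau_Symbols"
begin

text \<open>The d-dimensional space is an arbitrary type of class \<open>euclidean_space\<close>, with
  d = \<open>DIM('a)\<close> (hence d \<open>\<ge>\<close> 1). Processes are functions of a real time
  parameter, of which only the values at nonnegative times matter.\<close>

text \<open>The sigma-algebra on the sample space generated by the variables \<open>Y i\<close>, \<open>i \<in> I\<close>.\<close>

definition sigma_gen :: "'w measure \<Rightarrow> 'i set \<Rightarrow> ('i \<Rightarrow> 'w \<Rightarrow> 'a::topological_space) \<Rightarrow> 'w set set" where
  "sigma_gen M I Y =
     sigma_sets (space M) (\<Union>i\<in>I. {Y i -` A \<inter> space M | A. A \<in> sets borel})"

text \<open>An increment over \<open>[s, t]\<close> is centred Gaussian with covariance \<open>(t - s)\<close> times the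
  identity, so its density is the product of the one-dimensional ones over the coordinates.
  Paths are continuous for every sample point; this makes the hitting events and the sausage
  volumes below measurable without completing the space.\<close>

locale standard_brownian_motion = prob_space M for M :: "'w measure" +
  fixes B :: "real \<Rightarrow> 'w \<Rightarrow> 'a::euclidean_space"
  assumes start: "\<And>\<omega>. \<omega> \<in> space M \<Longrightarrow> B 0 \<omega> = 0"
    and increments_gaussian: "\<And>s t. 0 \<le> s \<Longrightarrow> s < t \<Longrightarrow>
      distributed M lborel (\<lambda>\<omega>. B t \<omega> - B s \<omega>)
        (\<lambda>x. ennreal (\<Prod>b\<in>Basis. normal_density 0 (sqrt (t - s)) (x \<bullet> b)))"
    and increments_indep: "\<And>(n::nat) (\<tau>::nat \<Rightarrow> real). 0 \<le> \<tau> 0 \<Longrightarrow> strict_mono_on {..n} \<tau> \<Longrightarrow>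
      indep_vars (\<lambda>_. borel) (\<lambda>k \<omega>. B (\<tau> (Suc k)) \<omega> - B (\<tau> k) \<omega>) {..<n}"
    and continuous_paths: "\<And>\<omega>. \<omega> \<in> space M \<Longrightarrow> continuous_on {0..} (\<lambda>t. B t \<omega>)"

text \<open>The points are enumerated by the natural numbers, which is no restriction since a Poisson
  process of positive intensity on the whole space almost surely has infinitely many points.
  The finiteness conjunct in \<open>counts_poisson\<close> is needed because \<open>card\<close> of an infinite set is 0;
  summing over \<open>k\<close>, the condition entails that \<open>A\<close> almost surely contains finitely many points.\<close>

locale poisson_point_process = prob_space M for M :: "'w measure" +
  fixes lam :: real and X :: "nat \<Rightarrow> 'w \<Rightarrow> 'a::euclidean_space"
  assumes points_measurable: "\<And>i. random_variable borel (X i)"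
    and counts_poisson: "\<And>A k. A \<in> sets borel \<Longrightarrow> emeasure lborel A < \<infinity> \<Longrightarrow>
      prob {\<omega> \<in> space M. finite {i. X i \<omega> \<in> A} \<and> card {i. X i \<omega> \<in> A} = k}
        = (lam * measure lborel A) ^ k / fact k * exp (- (lam * measure lborel A))"
    and counts_indep: "\<And>(n::nat) (A::nat \<Rightarrow> 'a set).
      (\<And>j. j < n \<Longrightarrow> A j \<in> sets borel \<and> emeasure lborel (A j) < \<infinity>) \<Longrightarrow>
      disjoint_family_on A {..<n} \<Longrightarrow>
      indep_vars (\<lambda>_. count_space UNIV) (\<lambda>j \<omega>. card {i. X i \<omega> \<in> A j}) {..<n}"

locale mobile_nodes = poisson_point_process M lam X
  for M :: "'w measure" and lam :: real and X :: "nat \<Rightarrow> 'w \<Rightarrow> 'a::euclidean_space" +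
  fixes \<zeta> :: "nat \<Rightarrow> real \<Rightarrow> 'w \<Rightarrow> 'a"
  assumes motions_brownian: "\<And>i. standard_brownian_motion M (\<zeta> i)"
    and motions_indep: "indep_sets (\<lambda>i. sigma_gen M {0..} (\<zeta> i)) UNIV"
    and motions_indep_points:
      "indep_set (sigma_gen M UNIV X) (sigma_gen M (UNIV \<times> {0..}) (\<lambda>(i, s). \<zeta> i s))"

text \<open>A random target path, independent of the nodes and their motions jointly. Measurability of
  each \<open>g t\<close> is part of \<open>indep_set\<close>, which requires both arguments to consist of events.\<close>

locale independent_target = mobile_nodes M lam X \<zeta>
  for M :: "'w measure" and lam :: real and X :: "nat \<Rightarrow> 'w \<Rightarrow> 'a::euclidean_space"
    and \<zeta> :: "nat \<Rightarrow> real \<Rightarrow> 'w \<Rightarrow> 'a" +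
  fixes g :: "real \<Rightarrow> 'w \<Rightarrow> 'a"
  assumes target_start: "\<And>\<omega>. \<omega> \<in> space M \<Longrightarrow> g 0 \<omega> = 0"
    and target_continuous: "\<And>\<omega>. \<omega> \<in> space M \<Longrightarrow> continuous_on {0..} (\<lambda>t. g t \<omega>)"
    and target_indep: "indep_set (sigma_gen M {0..} g)
      (sigma_sets (space M)
        (sigma_gen M UNIV X \<union> sigma_gen M (UNIV \<times> {0..}) (\<lambda>(i, s). \<zeta> i s)))"

text \<open>Extended-real valued, so that the infimum of the empty set is \<open>\<infinity>\<close>.\<close>

definition detection_time ::
  "(nat \<Rightarrow> 'w \<Rightarrow> 'a::euclidean_space) \<Rightarrow> (nat \<Rightarrow> real \<Rightarrow> 'w \<Rightarrow> 'a) \<Rightarrow> real \<Rightarrow>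
   (real \<Rightarrow> 'w \<Rightarrow> 'a) \<Rightarrow> 'w \<Rightarrow> ereal" where
  "detection_time X \<zeta> r g \<omega> =
     Inf (ereal ` {t. 0 \<le> t \<and> g t \<omega> \<in> (\<Union>i. cball (X i \<omega> + \<zeta> i t \<omega>) r)})"

text \<open>The logarithm below is taken of a positive number for every model considered, the
  probability being the mean of \<open>exp (- lam * E (vol (W\<^sub>g t)))\<close> over the paths of \<open>g\<close>.\<close>

definition neg_log_undetected ::
  "'w measure \<Rightarrow> real \<Rightarrow> (nat \<Rightarrow> 'w \<Rightarrow> 'a::euclidean_space) \<Rightarrow> (nat \<Rightarrow> real \<Rightarrow> 'w \<Rightarrow> 'a) \<Rightarrow>
   real \<Rightarrow> (real \<Rightarrow> 'w \<Rightarrow> 'a) \<Rightarrow> real \<Rightarrow> real" where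
  "neg_log_undetected M lam X \<zeta> r g t =
     - (1 / lam) * ln (measure M {\<omega> \<in> space M. detection_time X \<zeta> r g \<omega> > ereal t})"

definition wiener_sausage ::
  "(real \<Rightarrow> 'v \<Rightarrow> 'a::euclidean_space) \<Rightarrow> real \<Rightarrow> (real \<Rightarrow> 'a) \<Rightarrow> real \<Rightarrow> 'v \<Rightarrow> 'a set" where
  "wiener_sausage \<xi> r g t \<omega> = (\<Union>s\<in>{0..t}. cball (g s - \<xi> s \<omega>) r)"

definition expected_sausage_volume ::
  "'v measure \<Rightarrow> (real \<Rightarrow> 'v \<Rightarrow> 'a::euclidean_space) \<Rightarrow> real \<Rightarrow> (real \<Rightarrow> 'a) \<Rightarrow> real \<Rightarrow> real" where
  "expected_sausage_volume N \<xi> r g t =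
     prob_space.expectation N (\<lambda>\<omega>. measure lebesgue (wiener_sausage \<xi> r g t \<omega>))"

abbreviation V0 :: "'v measure \<Rightarrow> (real \<Rightarrow> 'v \<Rightarrow> 'a::euclidean_space) \<Rightarrow> real \<Rightarrow> real \<Rightarrow> real" where
  "V0 N \<xi> r t \<equiv> expected_sausage_volume N \<xi> r (\<lambda>_. 0) t"

end

theory Submission
  imports Defs "HOL-Real_Asymp.Real_Asymp"
begin

text \<open>Given the target, the nodes that ever detect it form an independent thinning of the Poisson
  process, so the probability of no detection is the mean of \<open>exp (- lam * E (vol (W\<^sub>g t)))\<close> over the
  paths of \<open>g\<close>; for a deterministic path this is (i). For (ii), in dimension 1 the reflection
  symmetry of the motion gives \<open>V0 t \<le> E (vol (W\<^sub>g t))\<close>. In higher dimension, the expected number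
  of integer times at which the moving ball covers a point is at most the probability of covering it
  times the expected number of returns, and no drift makes returns more likely than the driftless
  motion at its most favourable position; integrated over space this bounds \<open>E (vol (W\<^sub>g t))\<close> from
  below. The same first-visit decomposition on fine dyadic grids, with returns bounded from below,
  gives the matching upper bounds for \<open>V0\<close>. For (iii), the target stays in a ball of radius
  \<open>R\<close> up to time \<open>t\<close> with probability at least \<open>exp (- c * t / R\<^sup>2)\<close>, and then its sausage lies in
  the driftless one of radius \<open>r + R\<close>; take \<open>R\<close> to be \<open>t powr (1/3)\<close>, \<open>ln t\<close> and \<open>1\<close> for
  d = 1, d = 2 and d \<open>\<ge>\<close> 3.\<close>

section \<open>Gaussian increments\<close>

text \<open>Both volume bounds compare two quantities. At a fixed time the set of points covered by
  the moving ball is a ball, so the expected number of covered grid times, integrated over space, is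
  a multiple of its volume \<open>V\<close> whatever the drift. A Gaussian ball probability is at
  most \<open>V\<close> times the peak density, uniformly in the centre, and this bounds the number
  of returns. For d = 2 the truncated sum of peak densities is about \<open>ln t / (2 * pi)\<close>;
  \<open>V\<close> then cancels and both bounds are asymptotic to \<open>2 * pi * t / ln t\<close>,
  independently of the radius. Hence the sharp constant, and a radius growing like
  \<open>ln t\<close> does no harm. For d \<ge> 3 the sum converges and the bounds agree only in
  order, whence the two constants. For d = 1 the sausage is an interval, which gives an exact
  comparison. The target, the nodes and the reference motion \<open>\<xi>\<close> meet only through
  their laws. Events are therefore expressed on countably many dyadic times, where a Brownian motion
  has a unique law and where continuous paths can be recovered.\<close>

definition gauss :: "real \<Rightarrow> 'a::euclidean_space measure" where
  "gauss s = density lborel (\<lambda>x. ennreal (\<Prod>b\<in>Basis. normal_density 0 (sqrt s) (x \<bullet> b)))"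

lemma sets_gauss [measurable_cong, simp]: "sets (gauss s) = sets borel"
  and space_gauss [simp]: "space (gauss s) = UNIV"
  by (simp_all add: gauss_def)

lemma gauss_density_eq:
  fixes x :: "'a::euclidean_space"
  assumes "0 < s"
  shows "(\<Prod>b\<in>Basis. normal_density 0 (sqrt s) (x \<bullet> b))
    = (2 * pi * s) powr (- real DIM('a) / 2) * exp (- (norm x)\<^sup>2 / (2 * s))"
proof -
  have "(\<Prod>b\<in>Basis. normal_density 0 (sqrt s) (x \<bullet> b))
      = (\<Prod>b\<in>(Basis::'a set). (2 * pi * s) powr (- (1/2)) * exp (- (x \<bullet> b)\<^sup>2 / (2 * s)))"
    using assms by (intro prod.cong refl)
      (simp add: normal_density_def powr_minus powr_half_sqrt field_simps)
  also have "\<dots> = ((2 * pi * s) powr (- (1/2))) ^ DIM('a) * exp (\<Sum>b\<in>Basis. - (x \<bullet> b)\<^sup>2 / (2 * s))"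
    by (simp add: prod.distrib exp_sum)
  also have "(\<Sum>b\<in>Basis. - (x \<bullet> b)\<^sup>2 / (2 * s)) = - (norm x)\<^sup>2 / (2 * s)"
    unfolding power2_norm_eq_inner euclidean_inner[of x x]
    by (simp add: power2_eq_square sum_negf flip: sum_divide_distrib)
  also have "((2 * pi * s) powr (- (1/2))) ^ DIM('a) = (2 * pi * s) powr (- real DIM('a) / 2)"
    using assms by (simp add: powr_realpow[symmetric] powr_powr)
  finally show ?thesis .
qed

text \<open>Independence of the coordinates: total mass and all moments of the vector are reduced
  through this to one-dimensional normal integrals.\<close>

lemma gauss_eq_distr_PiM:
  assumes "0 < s"
  shows "gauss s = distr (PiM (Basis::'a::euclidean_space set)
      (\<lambda>_. density lborel (normal_density 0 (sqrt s)))) borel (\<lambda>f. \<Sum>b\<in>Basis. f b *\<^sub>R b)"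
proof -
  have ps: "prob_space (density lborel (normal_density 0 (sqrt s)))"
    using assms by (simp add: prob_space_normal_density)
  interpret A: finite_product_sigma_finite "\<lambda>_. lborel" "Basis :: 'a set"
    by standard auto
  interpret C: product_sigma_finite "\<lambda>_::'a. density lborel (normal_density 0 (sqrt s))"
    by standard (use prob_space_imp_sigma_finite[OF ps] in \<open>auto simp: sigma_finite_measure_def\<close>)
  let ?P = "PiM (Basis::'a set) (\<lambda>_. lborel :: real measure)"
  let ?S = "\<lambda>f. \<Sum>b\<in>(Basis::'a set). f b *\<^sub>R b"
  have P: "PiM (Basis::'a set) (\<lambda>_. density lborel (normal_density 0 (sqrt s)))
      = density ?P (\<lambda>f. \<Prod>b\<in>Basis. ennreal (normal_density 0 (sqrt s) (f b)))"
  proof (rule C.PiM_eqI[symmetric])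
    show "sets (density ?P (\<lambda>f. \<Prod>b\<in>Basis. ennreal (normal_density 0 (sqrt s) (f b)))) =
        sets (PiM Basis (\<lambda>_. density lborel (normal_density 0 (sqrt s))))"
      by (auto intro!: sets_PiM_cong)
    fix E :: "'a \<Rightarrow> real set"
    assume "\<And>i. i \<in> Basis \<Longrightarrow> E i \<in> sets (density lborel (normal_density 0 (sqrt s)))"
    then have E: "\<And>i. i \<in> Basis \<Longrightarrow> E i \<in> sets borel" by simp
    have "emeasure (density ?P (\<lambda>f. \<Prod>b\<in>Basis. ennreal (normal_density 0 (sqrt s) (f b)))) (Pi\<^sub>E Basis E)
      = (\<integral>\<^sup>+f. (\<Prod>b\<in>Basis. ennreal (normal_density 0 (sqrt s) (f b))) * indicator (Pi\<^sub>E Basis E) f \<partial>?P)"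
      using E by (intro emeasure_density) auto
    also have "\<dots> = (\<integral>\<^sup>+f. (\<Prod>b\<in>Basis. ennreal (normal_density 0 (sqrt s) (f b)) * indicator (E b) (f b)) \<partial>?P)"
      by (intro nn_integral_cong)
        (auto simp: prod.distrib indicator_def space_PiM PiE_def Pi_def prod_zero_iff split: if_splits
          intro!: prod.neutral)
    also have "\<dots> = (\<Prod>b\<in>Basis. \<integral>\<^sup>+x. ennreal (normal_density 0 (sqrt s) x) * indicator (E b) x \<partial>lborel)"
      using E by (intro A.product_nn_integral_prod) auto
    also have "\<dots> = (\<Prod>b\<in>Basis. emeasure (density lborel (normal_density 0 (sqrt s))) (E b))"
      using E by (intro prod.cong refl) (simp add: emeasure_density)
    finally show "emeasure (density ?P (\<lambda>f. \<Prod>b\<in>Basis. ennreal (normal_density 0 (sqrt s) (f b)))) (Pi\<^sub>E Basis E)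
      = (\<Prod>b\<in>Basis. emeasure (density lborel (normal_density 0 (sqrt s))) (E b))" .
  qed auto
  \<comment> \<open>Lebesgue measure on a Euclidean space is itself defined as the image of the
    product measure under the basis expansion, so the density can be pulled back along that
    map.\<close>
  have "gauss s = density (distr ?P borel ?S) (\<lambda>x. ennreal (\<Prod>b\<in>Basis. normal_density 0 (sqrt s) (x \<bullet> b)))"
    unfolding gauss_def by (subst lborel_def) (simp add: lborel_eq_real)
  also have "\<dots> = distr (density ?P (\<lambda>f. ennreal (\<Prod>b\<in>Basis. normal_density 0 (sqrt s) (?S f \<bullet> b)))) borel ?S"
    by (intro density_distr) auto
  also have "density ?P (\<lambda>f. ennreal (\<Prod>b\<in>Basis. normal_density 0 (sqrt s) (?S f \<bullet> b)))
      = density ?P (\<lambda>f. \<Prod>b\<in>Basis. ennreal (normal_density 0 (sqrt s) (f b)))"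
    by (intro density_cong) (auto simp: prod_ennreal)
  finally show ?thesis using P by simp
qed

lemma prob_space_gauss:
  assumes "0 < s" shows "prob_space (gauss s :: 'a::euclidean_space measure)"
proof -
  have "prob_space (PiM (Basis::'a set) (\<lambda>_. density lborel (normal_density 0 (sqrt s))))"
    using assms by (intro prob_space_PiM prob_space_normal_density) simp
  then show ?thesis
    unfolding gauss_eq_distr_PiM[OF assms] by (intro prob_space.prob_space_distr) auto
qed

lemma distr_gauss_uminus:
  "distr (gauss s :: 'a::euclidean_space measure) borel uminus = gauss s"
proof -
  have lb: "distr lborel borel (uminus :: 'a \<Rightarrow> 'a) = lborel"
    using lborel_affine[of "-1::real" "0::'a"] by (simp add: density_1 fun_Compl_def)
  have "gauss s = density (distr lborel borel (uminus :: 'a \<Rightarrow> 'a))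
      (\<lambda>x. ennreal (\<Prod>b\<in>Basis. normal_density 0 (sqrt s) (x \<bullet> b)))"
    by (simp add: lb gauss_def)
  also have "\<dots> = distr (density lborel (\<lambda>x::'a. ennreal (\<Prod>b\<in>Basis. normal_density 0 (sqrt s) (- x \<bullet> b)))) borel uminus"
    by (subst density_distr) auto
  also have "\<dots> = distr (gauss s) borel uminus"
    by (simp add: gauss_def normal_density_def)
  finally show ?thesis ..
qed

lemma measure_gauss_eq:
  fixes A :: "'a::euclidean_space set"
  assumes "0 < s" "A \<in> sets borel"
  shows "emeasure (gauss s) A = (\<integral>\<^sup>+x. ennreal ((2 * pi * s) powr (- real DIM('a) / 2)
      * exp (- (norm x)\<^sup>2 / (2 * s))) * indicator A x \<partial>lborel)"
  using assms by (simp add: gauss_def emeasure_density gauss_density_eq)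

text \<open>The density is replaced by its peak value. The bound does not depend on the centre
  \<open>y\<close>; this uniformity is what makes an arbitrary drift harmless.\<close>

lemma gauss_cball_le:
  fixes y :: "'a::euclidean_space"
  assumes "0 < s" "0 \<le> R"
  shows "measure (gauss s) (cball y R)
    \<le> (2 * pi * s) powr (- real DIM('a) / 2) * measure lborel (cball (0::'a) R)"
proof -
  interpret prob_space "gauss s :: 'a measure" using prob_space_gauss[OF assms(1)] .
  have "emeasure (gauss s) (cball y R) \<le> (\<integral>\<^sup>+x. ennreal ((2 * pi * s) powr (- real DIM('a) / 2)) * indicator (cball y R) x \<partial>lborel)"
    unfolding measure_gauss_eq[OF assms(1) borel_closed[OF closed_cball]]
    using assms by (intro nn_integral_mono) (auto simp: indicator_def intro!: ennreal_leI mult_left_le)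
  also have "\<dots> = ennreal ((2 * pi * s) powr (- real DIM('a) / 2) * measure lborel (cball y R))"
    by (simp add: nn_integral_cmult_indicator ennreal_mult' emeasure_cball content_cball assms)
  also have "measure lborel (cball y R) = measure lborel (cball (0::'a) R)"
    using assms by (simp add: content_cball)
  finally show ?thesis
    by (simp add: emeasure_eq_measure)
qed

text \<open>The density is at least its value at distance \<open>\<rho>\<close>. When
  \<open>s\<close> is large compared with \<open>\<rho>\<^sup>2\<close> the exponential is near 1
  and the bound matches that of \<open>gauss_cball_le\<close>.\<close>

lemma gauss_cball_ge:
  fixes y :: "'a::euclidean_space"
  assumes "0 < s" "0 \<le> R" "cball y R \<subseteq> cball 0 \<rho>"
  shows "measure (gauss s) (cball y R)
    \<ge> (2 * pi * s) powr (- real DIM('a) / 2) * exp (- \<rho>\<^sup>2 / (2 * s)) * measure lborel (cball (0::'a) R)"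
proof -
  interpret prob_space "gauss s :: 'a measure" using prob_space_gauss[OF assms(1)] .
  have n: "norm x ^ 2 \<le> \<rho>\<^sup>2" if "x \<in> cball y R" for x
    using that assms(3) by (intro power_mono) auto
  have "(\<integral>\<^sup>+x. ennreal ((2 * pi * s) powr (- real DIM('a) / 2) * exp (- \<rho>\<^sup>2 / (2 * s))) * indicator (cball y R) x \<partial>lborel)
      \<le> emeasure (gauss s) (cball y R)"
    unfolding measure_gauss_eq[OF assms(1) borel_closed[OF closed_cball]]
    using assms n by (intro nn_integral_mono)
      (auto simp: indicator_def divide_right_mono intro!: ennreal_leI mult_left_mono)
  also have "(\<integral>\<^sup>+x. ennreal ((2 * pi * s) powr (- real DIM('a) / 2) * exp (- \<rho>\<^sup>2 / (2 * s))) * indicator (cball y R) x \<partial>lborel)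
      = ennreal ((2 * pi * s) powr (- real DIM('a) / 2) * exp (- \<rho>\<^sup>2 / (2 * s)) * measure lborel (cball y R))"
    by (simp add: nn_integral_cmult_indicator ennreal_mult' emeasure_cball content_cball assms)
  also have "measure lborel (cball y R) = measure lborel (cball (0::'a) R)"
    using assms by (simp add: content_cball)
  finally show ?thesis
    by (simp add: emeasure_eq_measure)
qed

text \<open>The model states independence for families of events. This turns it into a product law
  for two variables whose preimages lie in those families, so that Fubini becomes available.\<close>

lemma (in prob_space) distr_pair_indep_set:
  assumes X[measurable]: "random_variable S X" and Y[measurable]: "random_variable T Y"
    and indep: "indep_set F G"
    and F: "\<And>A. A \<in> sets S \<Longrightarrow> X -` A \<inter> space M \<in> F"
    and G: "\<And>A. A \<in> sets T \<Longrightarrow> Y -` A \<inter> space M \<in> G"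
  shows "distr M (S \<Otimes>\<^sub>M T) (\<lambda>\<omega>. (X \<omega>, Y \<omega>)) = distr M S X \<Otimes>\<^sub>M distr M T Y"
proof (rule pair_measure_eqI[symmetric])
  interpret X: prob_space "distr M S X" by (rule prob_space_distr) fact
  interpret Y: prob_space "distr M T Y" by (rule prob_space_distr) fact
  show "sigma_finite_measure (distr M S X)" "sigma_finite_measure (distr M T Y)" ..
  show "sets (distr M S X \<Otimes>\<^sub>M distr M T Y) = sets (distr M (S \<Otimes>\<^sub>M T) (\<lambda>\<omega>. (X \<omega>, Y \<omega>)))"
    by (simp cong: sets_pair_measure_cong)
  fix A B assume "A \<in> sets (distr M S X)" "B \<in> sets (distr M T Y)"
  then have AB[measurable]: "A \<in> sets S" "B \<in> sets T" by auto
  have "prob ((X -` A \<inter> space M) \<inter> (Y -` B \<inter> space M)) = prob (X -` A \<inter> space M) * prob (Y -` B \<inter> space M)"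
    using AB by (intro indep_setD[OF indep] F G)
  moreover have "(\<lambda>\<omega>. (X \<omega>, Y \<omega>)) -` (A \<times> B) \<inter> space M = (X -` A \<inter> space M) \<inter> (Y -` B \<inter> space M)"
    by auto
  ultimately show "emeasure (distr M S X) A * emeasure (distr M T Y) B
      = emeasure (distr M (S \<Otimes>\<^sub>M T) (\<lambda>\<omega>. (X \<omega>, Y \<omega>))) (A \<times> B)"
    by (simp add: emeasure_distr emeasure_eq_measure ennreal_mult)
qed

section \<open>Markov property and laws on equidistant time grids\<close>

context standard_brownian_motion
begin

lemma measurable_at: "0 \<le> t \<Longrightarrow> B t \<in> borel_measurable M"
proof (cases "t = 0")
  case True
  then show ?thesis using start by (subst measurable_cong[where g="\<lambda>_. 0"]) auto
next
  case False
  assume "0 \<le> t"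
  with False have "(\<lambda>\<omega>. B t \<omega> - B 0 \<omega>) \<in> borel_measurable M"
    using increments_gaussian[of 0 t] by (auto dest: distributed_measurable)
  then show ?thesis using start by (subst measurable_cong[where g="\<lambda>\<omega>. B t \<omega> - B 0 \<omega>"]) auto
qed

lemma distr_increment:
  assumes "0 \<le> s" "s < t"
  shows "distr M borel (\<lambda>\<omega>. B t \<omega> - B s \<omega>) = gauss (t - s)"
  using increments_gaussian[OF assms] unfolding distributed_def gauss_def
  by (metis distr_cong sets_lborel)

text \<open>Markov property at the grid time \<open>k * \<delta>\<close>: the past positions are
  partial sums of the first \<open>k\<close> increments, and these are independent of the increment
  that follows.\<close>

lemma distr_past_increment:
  fixes k :: nat
  assumes "0 < \<delta>" "real k * \<delta> < s"
  shows "distr M (PiM {..k} (\<lambda>_. borel) \<Otimes>\<^sub>M borel)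
      (\<lambda>\<omega>. (\<lambda>i\<in>{..k}. B (real i * \<delta>) \<omega>, B s \<omega> - B (real k * \<delta>) \<omega>))
    = distr M (PiM {..k} (\<lambda>_. borel)) (\<lambda>\<omega>. \<lambda>i\<in>{..k}. B (real i * \<delta>) \<omega>) \<Otimes>\<^sub>M gauss (s - real k * \<delta>)"
proof -
  define \<tau> where "\<tau> i = (if i \<le> k then real i * \<delta> else s)" for i :: nat
  let ?I1 = "\<lambda>\<omega>. \<lambda>i\<in>{..<k}. B (\<tau> (Suc i)) \<omega> - B (\<tau> i) \<omega>"
  let ?I2 = "\<lambda>\<omega>. \<lambda>i\<in>{k}. B (\<tau> (Suc i)) \<omega> - B (\<tau> i) \<omega>"
  let ?S = "(\<lambda>f. \<lambda>i\<in>{..k}. \<Sum>j<i. f j) :: (nat \<Rightarrow> 'a) \<Rightarrow> nat \<Rightarrow> 'a"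
  have s: "0 \<le> real k * \<delta>" using assms by simp
  have sm: "strict_mono_on {..Suc k} \<tau>"
    using assms by (auto simp: strict_mono_on_def \<tau>_def intro: le_less_trans[rotated])
  have "indep_vars (\<lambda>_. borel) (\<lambda>i \<omega>. B (\<tau> (Suc i)) \<omega> - B (\<tau> i) \<omega>) {..<Suc k}"
    using increments_indep[OF _ sm] by (simp add: \<tau>_def)
  then have "indep_var (PiM {..<k} (\<lambda>_. borel)) ?I1 (PiM {k} (\<lambda>_. borel)) ?I2"
    by (rule indep_var_restrict) auto
  then have I: "indep_set (sigma_sets (space M) {?I1 -` A \<inter> space M |A. A \<in> sets (PiM {..<k} (\<lambda>_. borel))})
      (sigma_sets (space M) {?I2 -` A \<inter> space M |A. A \<in> sets (PiM {k} (\<lambda>_. borel))})"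
    by (simp add: indep_var_eq)
  have S: "?S \<in> measurable (PiM {..<k} (\<lambda>_. borel)) (PiM {..k} (\<lambda>_. borel))"
    by (auto intro!: measurable_restrict borel_measurable_sum measurable_component_singleton)
  have pos: "?S (?I1 \<omega>) = (\<lambda>i\<in>{..k}. B (real i * \<delta>) \<omega>)" if "\<omega> \<in> space M" for \<omega>
  proof (rule restrict_ext)
    fix i assume i: "i \<in> {..k}"
    have "(\<Sum>j<i. ?I1 \<omega> j) = (\<Sum>j<i. B (\<tau> (Suc j)) \<omega> - B (\<tau> j) \<omega>)"
      using i by (intro sum.cong) auto
    also have "\<dots> = B (\<tau> i) \<omega> - B (\<tau> 0) \<omega>"
      by (rule sum_lessThan_telescope)
    finally show "(\<Sum>j<i. ?I1 \<omega> j) = B (real i * \<delta>) \<omega>"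
      using i start[OF that] by (simp add: \<tau>_def)
  qed
  have inc: "?I2 \<omega> k = B s \<omega> - B (real k * \<delta>) \<omega>" for \<omega> by (simp add: \<tau>_def)
  show ?thesis
    unfolding distr_increment[OF s assms(2), symmetric]
  proof (rule distr_pair_indep_set[OF _ _ I])
    show "(\<lambda>\<omega>. \<lambda>i\<in>{..k}. B (real i * \<delta>) \<omega>) \<in> measurable M (PiM {..k} (\<lambda>_. borel))"
      using assms by (intro measurable_restrict measurable_at) auto
    show "(\<lambda>\<omega>. B s \<omega> - B (real k * \<delta>) \<omega>) \<in> borel_measurable M"
      using less_imp_le[OF le_less_trans[OF s assms(2)]] s by (intro borel_measurable_diff measurable_at)
  next
    fix A assume A: "A \<in> sets (PiM {..k} (\<lambda>_. borel :: 'a measure))"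
    have eq: "(\<lambda>\<omega>. \<lambda>i\<in>{..k}. B (real i * \<delta>) \<omega>) -` A \<inter> space M
        = ?I1 -` (?S -` A \<inter> space (PiM {..<k} (\<lambda>_. borel))) \<inter> space M"
      using pos by (auto simp: space_PiM)
    show "(\<lambda>\<omega>. \<lambda>i\<in>{..k}. B (real i * \<delta>) \<omega>) -` A \<inter> space M
        \<in> sigma_sets (space M) {?I1 -` A \<inter> space M |A. A \<in> sets (PiM {..<k} (\<lambda>_. borel))}"
      unfolding eq by (rule sigma_sets.Basic) (use measurable_sets[OF S A] in blast)
  next
    fix A :: "'a set" assume A: "A \<in> sets borel"
    have m: "(\<lambda>f. f k) \<in> measurable (PiM {k} (\<lambda>_. borel)) (borel :: 'a measure)"
      by (intro measurable_component_singleton) auto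
    have eq: "(\<lambda>\<omega>. B s \<omega> - B (real k * \<delta>) \<omega>) -` A \<inter> space M
        = ?I2 -` ((\<lambda>f. f k) -` A \<inter> space (PiM {k} (\<lambda>_. borel))) \<inter> space M"
      by (auto simp: space_PiM inc[simplified])
    show "(\<lambda>\<omega>. B s \<omega> - B (real k * \<delta>) \<omega>) -` A \<inter> space M
        \<in> sigma_sets (space M) {?I2 -` A \<inter> space M |A. A \<in> sets (PiM {k} (\<lambda>_. borel))}"
      unfolding eq by (rule sigma_sets.Basic) (use measurable_sets[OF m A] in blast)
  qed
qed

text \<open>The form in which the Markov property is applied: the past is frozen and a fresh
  Gaussian increment is integrated out first.\<close>

lemma nn_integral_past_increment:
  fixes k :: nat
  assumes "0 < \<delta>" "real k * \<delta> < s"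
    and [measurable]: "f \<in> borel_measurable (PiM {..k} (\<lambda>_. borel) \<Otimes>\<^sub>M borel)"
  shows "(\<integral>\<^sup>+\<omega>. f (\<lambda>i\<in>{..k}. B (real i * \<delta>) \<omega>, B s \<omega> - B (real k * \<delta>) \<omega>) \<partial>M)
    = (\<integral>\<^sup>+\<omega>. (\<integral>\<^sup>+y. f (\<lambda>i\<in>{..k}. B (real i * \<delta>) \<omega>, y) \<partial>gauss (s - real k * \<delta>)) \<partial>M)"
proof -
  let ?U = "\<lambda>\<omega>. \<lambda>i\<in>{..k}. B (real i * \<delta>) \<omega>" and ?V = "\<lambda>\<omega>. B s \<omega> - B (real k * \<delta>) \<omega>"
  let ?P = "PiM {..k} (\<lambda>_. borel)"
  have s: "0 \<le> real k * \<delta>" using assms by simp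
  have U[measurable]: "?U \<in> measurable M ?P"
    using assms by (intro measurable_restrict measurable_at) auto
  have V[measurable]: "?V \<in> borel_measurable M"
    using less_imp_le[OF le_less_trans[OF s assms(2)]] s by (intro borel_measurable_diff measurable_at)
  interpret G: prob_space "gauss (s - real k * \<delta>)" using assms by (intro prob_space_gauss) simp
  have eq: "distr M (?P \<Otimes>\<^sub>M borel) (\<lambda>\<omega>. (?U \<omega>, ?V \<omega>)) = distr M ?P ?U \<Otimes>\<^sub>M gauss (s - real k * \<delta>)"
    by (rule distr_past_increment[OF assms(1,2)])
  have "(\<integral>\<^sup>+\<omega>. f (?U \<omega>, ?V \<omega>) \<partial>M) = (\<integral>\<^sup>+z. f z \<partial>distr M (?P \<Otimes>\<^sub>M borel) (\<lambda>\<omega>. (?U \<omega>, ?V \<omega>)))"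
    by (subst nn_integral_distr) auto
  also have "\<dots> = (\<integral>\<^sup>+u. \<integral>\<^sup>+y. f (u, y) \<partial>gauss (s - real k * \<delta>) \<partial>distr M ?P ?U)"
    unfolding eq by (subst G.nn_integral_fst[symmetric]) auto
  also have "\<dots> = (\<integral>\<^sup>+\<omega>. \<integral>\<^sup>+y. f (?U \<omega>, y) \<partial>gauss (s - real k * \<delta>) \<partial>M)"
    by (subst nn_integral_distr) auto
  finally show ?thesis .
qed

text \<open>The right-hand side mentions neither \<open>M\<close> nor \<open>B\<close>, so any two
  Brownian motions, on whatever spaces, have the same law on every grid.\<close>

lemma distr_grid:
  assumes "0 < \<delta>" "0 < k"
  shows "distr M (PiM {..k} (\<lambda>_. borel)) (\<lambda>\<omega>. \<lambda>i\<in>{..k}. B (real i * \<delta>) \<omega>)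
    = distr (PiM {..<k} (\<lambda>_. gauss \<delta>)) (PiM {..k} (\<lambda>_. borel)) (\<lambda>f. \<lambda>i\<in>{..k}. \<Sum>j<i. f j)"
proof -
  let ?I = "\<lambda>\<omega>. \<lambda>i\<in>{..<k}. B (real (Suc i) * \<delta>) \<omega> - B (real i * \<delta>) \<omega>"
  let ?S = "(\<lambda>f. \<lambda>i\<in>{..k}. \<Sum>j<i. f j) :: (nat \<Rightarrow> 'a) \<Rightarrow> nat \<Rightarrow> 'a"
  have m: "(\<lambda>\<omega>. B (real (Suc i) * \<delta>) \<omega> - B (real i * \<delta>) \<omega>) \<in> borel_measurable M" for i
    using assms by (intro borel_measurable_diff measurable_at) auto
  have mI: "?I \<in> measurable M (PiM {..<k} (\<lambda>_. borel))"
    by (intro measurable_restrict m)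
  have S: "?S \<in> measurable (PiM {..<k} (\<lambda>_. borel)) (PiM {..k} (\<lambda>_. borel))"
    by (auto intro!: measurable_restrict borel_measurable_sum measurable_component_singleton)
  have "indep_vars (\<lambda>_. borel) (\<lambda>i \<omega>. B (real (Suc i) * \<delta>) \<omega> - B (real i * \<delta>) \<omega>) {..<k}"
    using increments_indep[of "\<lambda>i. real i * \<delta>" k] assms
    by (auto simp: strict_mono_on_def)
  then have I: "distr M (PiM {..<k} (\<lambda>_. borel)) ?I = PiM {..<k} (\<lambda>_. gauss \<delta>)"
    using assms m distr_increment[of "real i * \<delta>" "real (Suc i) * \<delta>" for i]
    by (subst (asm) indep_vars_iff_distr_eq_PiM') (auto simp: algebra_simps)
  have "distr M (PiM {..k} (\<lambda>_. borel)) (\<lambda>\<omega>. \<lambda>i\<in>{..k}. B (real i * \<delta>) \<omega>)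
    = distr M (PiM {..k} (\<lambda>_. borel)) (\<lambda>\<omega>. ?S (?I \<omega>))"
  proof (intro distr_cong refl restrict_ext)
    fix \<omega> i assume w: "\<omega> \<in> space M" and i: "i \<in> {..k}"
    have "(\<Sum>j<i. ?I \<omega> j) = (\<Sum>j<i. B (real (Suc j) * \<delta>) \<omega> - B (real j * \<delta>) \<omega>)"
      using i by (intro sum.cong) auto
    also have "\<dots> = B (real i * \<delta>) \<omega> - B (real 0 * \<delta>) \<omega>"
      by (rule sum_lessThan_telescope)
    finally show "B (real i * \<delta>) \<omega> = (\<Sum>j<i. ?I \<omega> j)" using start[OF w] by simp
  qed
  also have "\<dots> = distr (distr M (PiM {..<k} (\<lambda>_. borel)) ?I) (PiM {..k} (\<lambda>_. borel)) ?S"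
    using distr_distr[OF S mI] by (simp add: comp_def del: of_nat_Suc)
  finally show ?thesis unfolding I .
qed

end

text \<open>Centred Gaussians are symmetric. In dimension 1 this lets the drift be compared with the
  motion and with its reflection.\<close>

lemma standard_brownian_motion_uminus:
  assumes "standard_brownian_motion M B"
  shows "standard_brownian_motion M (\<lambda>t \<omega>. - B t \<omega>)"
proof -
  interpret standard_brownian_motion M B by fact
  show ?thesis
  proof (unfold_locales)
    show "- B 0 \<omega> = 0" if "\<omega> \<in> space M" for \<omega> using start[OF that] by simp
    show "continuous_on {0..} (\<lambda>t. - B t \<omega>)" if "\<omega> \<in> space M" for \<omega>
      using continuous_paths[OF that] by (intro continuous_intros)
  next
    fix s t :: real assume st: "0 \<le> s" "s < t"
    have m: "(\<lambda>\<omega>. B t \<omega> - B s \<omega>) \<in> borel_measurable M"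
      using st by (intro borel_measurable_diff measurable_at) auto
    have "distr M borel (\<lambda>\<omega>. - (B t \<omega> - B s \<omega>)) = distr (distr M borel (\<lambda>\<omega>. B t \<omega> - B s \<omega>)) borel uminus"
      using m by (subst distr_distr) (auto simp: comp_def)
    also have "\<dots> = gauss (t - s)"
      by (simp add: distr_increment[OF st] distr_gauss_uminus)
    finally have "distr M lborel (\<lambda>\<omega>. - B t \<omega> - - B s \<omega>) = gauss (t - s)"
      by (simp add: cong: distr_cong)
    then show "distributed M lborel (\<lambda>\<omega>. - B t \<omega> - - B s \<omega>)
        (\<lambda>x. ennreal (\<Prod>b\<in>Basis. normal_density 0 (sqrt (t - s)) (x \<bullet> b)))"
      using borel_measurable_uminus[OF m] unfolding distributed_def gauss_def by simp
  next
    fix n :: nat and \<tau> :: "nat \<Rightarrow> real" assume a: "0 \<le> \<tau> 0" "strict_mono_on {..n} \<tau>"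
    show "indep_vars (\<lambda>_. borel) (\<lambda>k \<omega>. - B (\<tau> (Suc k)) \<omega> - - B (\<tau> k) \<omega>) {..<n}"
      using indep_vars_compose2[OF increments_indep[OF a], of "\<lambda>_ x. - x" "\<lambda>_. borel"]
      by (simp add: algebra_simps)
  qed
qed

section \<open>Hitting along dyadic times\<close>

text \<open>Dyadic because the grids of mesh \<open>1 / 2 ^ m\<close> are nested: finitely many
  times always lie on one of them, and events observed on the grids are monotone in
  \<open>m\<close>.\<close>

definition dyadic_times :: "real set" where
  "dyadic_times = {real k / 2 ^ m | k m. True}"

abbreviation path_space :: "(real \<Rightarrow> 'a::euclidean_space) measure" where
  "path_space \<equiv> PiM dyadic_times (\<lambda>_. borel)"

lemma countable_dyadic_times [simp, intro]: "countable dyadic_times"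
proof -
  have "dyadic_times = (\<lambda>(k, m). real k / 2 ^ m) ` (UNIV :: (nat \<times> nat) set)"
    by (auto simp: dyadic_times_def)
  then show ?thesis by (metis countable_image countableI_type)
qed

lemma dyadic_times_nonneg: "q \<in> dyadic_times \<Longrightarrow> 0 \<le> q"
  by (auto simp: dyadic_times_def)

lemma zero_in_dyadic_times: "0 \<in> dyadic_times"
  unfolding dyadic_times_def by (auto intro!: exI[of _ "0::nat"])

lemma dyadic_times_dense:
  assumes "0 \<le> a" "a < b"
  obtains q where "q \<in> dyadic_times" "a < q" "q < b"
proof -
  obtain m where m: "(1/2::real) ^ m < b - a"
    using real_arch_pow_inv[of "b - a" "1/2"] assms by auto
  define k where "k = nat (\<lfloor>a * 2 ^ m\<rfloor> + 1)"
  have "real k = real_of_int \<lfloor>a * 2 ^ m\<rfloor> + 1" using assms by (simp add: k_def)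
  then have k: "a * 2 ^ m < real k" "real k \<le> a * 2 ^ m + 1" by linarith+
  have "a < real k / 2 ^ m" using k by (simp add: field_simps)
  moreover have "real k / 2 ^ m \<le> a + (1/2) ^ m" using k by (simp add: field_simps power_divide)
  ultimately show thesis using m by (intro that[of "real k / 2 ^ m"]) (auto simp: dyadic_times_def)
qed

text \<open>Finitely many dyadic fractions have a common denominator. The condition
  \<open>0 < K\<close> is the one under which \<open>distr_grid\<close> is stated.\<close>

lemma finite_dyadic_times_grid:
  assumes "finite J" "J \<subseteq> dyadic_times"
  obtains m K where "0 < K" "J \<subseteq> (\<lambda>k. real k * (1 / 2 ^ m)) ` {..K}"
proof -
  have "\<exists>m K. 0 < K \<and> J \<subseteq> (\<lambda>k. real k * (1 / 2 ^ m)) ` {..K}"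
    using assms
  proof (induction J rule: finite_induct)
    case empty
    then show ?case by auto
  next
    case (insert q J)
    then obtain m K where mK: "0 < K" "J \<subseteq> (\<lambda>k. real k * (1 / 2 ^ m)) ` {..K}" by auto
    obtain k n where q: "q = real k / 2 ^ n" using insert by (auto simp: dyadic_times_def)
    have "q = real (k * 2 ^ m) * (1 / 2 ^ (m + n))" by (simp add: q power_add)
    moreover have "real i * (1 / 2 ^ m) = real (i * 2 ^ n) * (1 / 2 ^ (m + n))" for i
      by (simp add: power_add)
    ultimately have "insert q J \<subseteq> (\<lambda>k. real k * (1 / 2 ^ (m + n))) ` {..max (k * 2 ^ m) (K * 2 ^ n)}"
    proof (intro insert_subsetI subsetI)
      fix x assume "x \<in> J"
      then obtain i where "i \<le> K" "x = real i * (1 / 2 ^ m)" using mK(2) by auto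
      then show "x \<in> (\<lambda>k. real k * (1 / 2 ^ (m + n))) ` {..max (k * 2 ^ m) (K * 2 ^ n)}"
        by (intro image_eqI[of _ _ "i * 2 ^ n"]) (auto simp: power_add le_max_iff_disj)
    qed (metis atMost_iff image_eqI max.cobounded1)
    moreover have "0 < max (k * 2 ^ m) (K * 2 ^ n)" using mK by (simp add: less_max_iff_disj)
    ultimately show ?case by blast
  qed
  then show thesis using that by blast
qed

lemma measurable_dyadic_path:
  assumes "\<And>t. 0 \<le> t \<Longrightarrow> B t \<in> borel_measurable M"
  shows "(\<lambda>\<omega>. \<lambda>t\<in>dyadic_times. B t \<omega>) \<in> measurable M path_space"
  using assms by (intro measurable_restrict) (auto dest: dyadic_times_nonneg)

text \<open>Cylinder sets determine a finite measure on the product space, each of them lives on a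
  single grid, and the grid law depends on the mesh alone.\<close>

lemma distr_dyadic_path_unique:
  assumes "standard_brownian_motion M B" "standard_brownian_motion N C"
  shows "distr M path_space (\<lambda>\<omega>. \<lambda>t\<in>dyadic_times. B t \<omega>) = distr N path_space (\<lambda>\<omega>. \<lambda>t\<in>dyadic_times. C t \<omega>)"
proof (rule measure_eqI_PiM_infinite)
  interpret M: standard_brownian_motion M B by fact
  interpret N: standard_brownian_motion N C by fact
  have mB[measurable]: "(\<lambda>\<omega>. \<lambda>t\<in>dyadic_times. B t \<omega>) \<in> measurable M path_space"
    by (rule measurable_dyadic_path) (rule M.measurable_at)
  have mC[measurable]: "(\<lambda>\<omega>. \<lambda>t\<in>dyadic_times. C t \<omega>) \<in> measurable N path_space"
    by (rule measurable_dyadic_path) (rule N.measurable_at)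
  show "finite_measure (distr M path_space (\<lambda>\<omega>. \<lambda>t\<in>dyadic_times. B t \<omega>))"
    by (rule M.finite_measure_distr) simp
  fix A :: "real \<Rightarrow> 'b set" and J :: "real set"
  assume J: "finite J" "J \<subseteq> dyadic_times" and A: "\<And>i. i \<in> J \<Longrightarrow> A i \<in> sets borel"
  obtain m K where mK: "0 < K" "J \<subseteq> (\<lambda>k. real k * (1 / 2 ^ m)) ` {..K}"
    using finite_dyadic_times_grid[OF J] .
  define \<delta> :: real where "\<delta> = 1 / 2 ^ m"
  have \<delta>: "0 < \<delta>" by (simp add: \<delta>_def)
  have "\<forall>t\<in>J. \<exists>k\<le>K. t = real k * \<delta>" using mK(2) by (auto simp: \<delta>_def)
  then obtain idx where idx: "\<And>t. t \<in> J \<Longrightarrow> idx t \<le> K" "\<And>t. t \<in> J \<Longrightarrow> real (idx t) * \<delta> = t"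
    by metis
  define F where "F = {f \<in> space (PiM {..K} (\<lambda>_. borel :: 'b measure)). \<forall>t\<in>J. f (idx t) \<in> A t}"
  have F[measurable]: "F \<in> sets (PiM {..K} (\<lambda>_. borel))"
    unfolding F_def using J(1) idx(1) A
    by (intro sets.sets_Collect_finite_All sets_Collect_single') auto
  have key: "emeasure (distr Q path_space (\<lambda>\<omega>. \<lambda>t\<in>dyadic_times. E t \<omega>)) (prod_emb dyadic_times (\<lambda>_. borel) J (Pi\<^sub>E J A))
      = emeasure (distr (PiM {..<K} (\<lambda>_. gauss \<delta>)) (PiM {..K} (\<lambda>_. borel)) (\<lambda>f. \<lambda>i\<in>{..K}. \<Sum>j<i. f j)) F"
    if "standard_brownian_motion Q E" for Q :: "'z measure" and E :: "real \<Rightarrow> 'z \<Rightarrow> 'b"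
  proof -
    interpret Q: standard_brownian_motion Q E by fact
    have [measurable]: "(\<lambda>\<omega>. \<lambda>t\<in>dyadic_times. E t \<omega>) \<in> measurable Q path_space"
      by (rule measurable_dyadic_path) (rule Q.measurable_at)
    have [measurable]: "(\<lambda>\<omega>. \<lambda>i\<in>{..K}. E (real i * \<delta>) \<omega>) \<in> measurable Q (PiM {..K} (\<lambda>_. borel))"
      using \<delta> by (intro measurable_restrict Q.measurable_at) auto
    have "emeasure (distr Q path_space (\<lambda>\<omega>. \<lambda>t\<in>dyadic_times. E t \<omega>)) (prod_emb dyadic_times (\<lambda>_. borel) J (Pi\<^sub>E J A))
        = emeasure Q ((\<lambda>\<omega>. \<lambda>t\<in>dyadic_times. E t \<omega>) -` (prod_emb dyadic_times (\<lambda>_. borel) J (Pi\<^sub>E J A)) \<inter> space Q)"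
      using J A by (intro emeasure_distr sets_PiM_I) auto
    also have "(\<lambda>\<omega>. \<lambda>t\<in>dyadic_times. E t \<omega>) -` (prod_emb dyadic_times (\<lambda>_. borel) J (Pi\<^sub>E J A)) \<inter> space Q
        = (\<lambda>\<omega>. \<lambda>i\<in>{..K}. E (real i * \<delta>) \<omega>) -` F \<inter> space Q"
      using J(2) idx by (auto simp: prod_emb_def F_def space_PiM PiE_iff restrict_def subset_iff extensional_def)
    also have "emeasure Q \<dots> = emeasure (distr Q (PiM {..K} (\<lambda>_. borel)) (\<lambda>\<omega>. \<lambda>i\<in>{..K}. E (real i * \<delta>) \<omega>)) F"
      by (intro emeasure_distr[symmetric]) auto
    finally show ?thesis unfolding Q.distr_grid[OF \<delta> mK(1)] .
  qed
  show "emeasure (distr M path_space (\<lambda>\<omega>. \<lambda>t\<in>dyadic_times. B t \<omega>)) (prod_emb dyadic_times (\<lambda>_. borel) J (Pi\<^sub>E J A))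
      = emeasure (distr N path_space (\<lambda>\<omega>. \<lambda>t\<in>dyadic_times. C t \<omega>)) (prod_emb dyadic_times (\<lambda>_. borel) J (Pi\<^sub>E J A))"
    using key[OF assms(1)] key[OF assms(2)] by simp
qed auto

text \<open>Only dyadic times enter, so that hitting is an event of the countable product space; the
  slack \<open>1 / Suc n\<close> compensates for the times that are missing.\<close>

definition hits :: "real \<Rightarrow> real \<Rightarrow> (real \<Rightarrow> 'a::euclidean_space) \<Rightarrow> 'a \<Rightarrow> (real \<Rightarrow> 'a) \<Rightarrow> bool" where
  "hits r T w x z \<longleftrightarrow> (\<forall>n. \<exists>q\<in>dyadic_times \<inter> {0..T}. norm (w q - z q - x) < r + 1 / real (Suc n))"

lemma hits_restrict [simp]:
  "hits r T (restrict w dyadic_times) x z = hits r T w x z"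
  "hits r T w x (restrict z dyadic_times) = hits r T w x z"
  by (simp_all add: hits_def)

text \<open>The distance attains its minimum on the compact interval, and a minimum below every
  \<open>r + 1 / Suc n\<close> is at most \<open>r\<close>. Conversely a dyadic time close enough to
  a hitting time uses up only part of the slack.\<close>

lemma hits_iff:
  assumes T: "0 \<le> T" and w: "continuous_on {0..} w" and z: "continuous_on {0..} z"
  shows "hits r T w x z \<longleftrightarrow> (\<exists>s\<in>{0..T}. norm (w s - z s - x) \<le> r)"
proof
  define f where "f s = norm (w s - z s - x)" for s
  have f: "continuous_on {0..T} f"
    unfolding f_def by (intro continuous_intros continuous_on_subset[OF w] continuous_on_subset[OF z]) auto
  {
    assume h: "hits r T w x z"
    obtain s where s: "s \<in> {0..T}" "\<And>q. q \<in> {0..T} \<Longrightarrow> f s \<le> f q"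
      using continuous_attains_inf[OF _ _ f] T by auto
    have "f s < r + 1 / real (Suc n)" for n
      using h s(2) unfolding hits_def f_def by (meson IntD2 le_less_trans)
    then have "f s \<le> r"
      using reals_Archimedean[of "f s - r"]
      by (metis add.commute diff_gt_0_iff_gt inverse_eq_divide less_diff_eq not_less_iff_gr_or_eq linorder_not_le)
    with s(1) show "\<exists>s\<in>{0..T}. norm (w s - z s - x) \<le> r" by (auto simp: f_def)
  next
    assume "\<exists>s\<in>{0..T}. norm (w s - z s - x) \<le> r"
    then obtain s where s: "s \<in> {0..T}" "f s \<le> r" by (auto simp: f_def)
    have "\<exists>q\<in>dyadic_times \<inter> {0..T}. f q < r + 1 / real (Suc n)" for n
    proof (cases "T = 0")
      \<comment> \<open>A one-point interval leaves no room for approximation, but its only time, 0,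
        is itself dyadic.\<close>
      case True
      with s show ?thesis by (intro bexI[of _ 0]) (auto simp: zero_in_dyadic_times intro: le_less_trans)
    next
      case False
      obtain d where d: "0 < d" "\<And>q. q \<in> {0..T} \<Longrightarrow> dist q s < d \<Longrightarrow> dist (f q) (f s) < 1 / real (Suc n)"
        using f s(1) unfolding continuous_on_iff by (metis of_nat_0_less_iff zero_less_Suc zero_less_divide_1_iff)
      have "max 0 (s - d) < min T (s + d)" using d(1) False T s(1) by auto
      then obtain q where q: "q \<in> dyadic_times" "max 0 (s - d) < q" "q < min T (s + d)"
        using dyadic_times_dense[of "max 0 (s - d)" "min T (s + d)"] by auto
      then have "dist (f q) (f s) < 1 / real (Suc n)" by (intro d(2)) (auto simp: dist_real_def)
      then have "f q < r + 1 / real (Suc n)" using s(2) unfolding dist_real_def by linarith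
      with q show ?thesis by (intro bexI[of _ q]) auto
    qed
    then show "hits r T w x z" by (simp add: hits_def f_def)
  }
qed

text \<open>Joint measurability in target path, node position and motion: all three are random in
  the end and are integrated out one after the other.\<close>

lemma measurable_hits [measurable]:
  "Measurable.pred (path_space \<Otimes>\<^sub>M (borel \<Otimes>\<^sub>M path_space)) (\<lambda>(w, x, z). hits r T w x z)"
proof -
  have *: "(\<lambda>a. norm (fst a q - snd (snd a) q - fst (snd a)))
      \<in> borel_measurable (path_space \<Otimes>\<^sub>M (borel \<Otimes>\<^sub>M path_space))" if "q \<in> dyadic_times" for q
  proof -
    have c: "(\<lambda>w. w q) \<in> measurable path_space borel"
      using that by (intro measurable_component_singleton)
    note [measurable] = measurable_compose[OF measurable_fst c]
      measurable_compose[OF measurable_compose[OF measurable_snd measurable_snd] c]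
    show ?thesis by measurable
  qed
  have "Measurable.pred (path_space \<Otimes>\<^sub>M (borel \<Otimes>\<^sub>M path_space))
      (\<lambda>a. \<forall>n. \<exists>q\<in>dyadic_times \<inter> {0..T}. norm (fst a q - snd (snd a) q - fst (snd a)) < r + 1 / real (Suc n))"
    by (intro pred_intros_countable pred_intros_countable_bounded pred_intros_logic
        borel_measurable_pred_less measurable_const)
      (auto intro!: * countable_subset[OF _ countable_dyadic_times])
  then show ?thesis by (simp add: hits_def split_beta)
qed

text \<open>For a fixed target path \<open>w\<close> this is the chance that a node started at
  \<open>x\<close> detects it by time \<open>T\<close>. As a function of \<open>x\<close> it is also
  the chance that \<open>x\<close> belongs to the sausage, which is the link between thinning and
  volume.\<close>

definition hit_prob :: "'v measure \<Rightarrow> (real \<Rightarrow> 'v \<Rightarrow> 'a::euclidean_space) \<Rightarrow> real \<Rightarrow> real \<Rightarrow> (real \<Rightarrow> 'a) \<Rightarrow> 'a \<Rightarrow> real" where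
  "hit_prob N \<xi> r T w x = measure N {\<omega> \<in> space N. hits r T w x (\<lambda>s. \<xi> s \<omega>)}"

lemma hit_prob_nonneg [simp]: "0 \<le> hit_prob N \<xi> r T w x"
  by (simp add: hit_prob_def)

lemma measurable_hits_path:
  assumes [measurable]: "f \<in> measurable N path_space" "g \<in> borel_measurable N" "h \<in> measurable N path_space"
  shows "Measurable.pred N (\<lambda>\<omega>. hits r T (f \<omega>) (g \<omega>) (h \<omega>))"
proof -
  have "Measurable.pred N (\<lambda>\<omega>. (\<lambda>(w, x, z). hits r T w x z) (f \<omega>, g \<omega>, h \<omega>))"
    by (rule measurable_compose[OF _ measurable_hits]) measurable
  then show ?thesis by simp
qed

lemma restrict_path_in_space: "restrict w dyadic_times \<in> space path_space"
  by (simp add: space_PiM)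

section \<open>Hitting probabilities and the expected sausage volume\<close>

context standard_brownian_motion
begin

lemma measurable_path [measurable]:
  "(\<lambda>\<omega>. \<lambda>t\<in>dyadic_times. B t \<omega>) \<in> measurable M path_space"
  by (rule measurable_dyadic_path) (rule measurable_at)

lemma measurable_hits_at:
  "Measurable.pred (borel \<Otimes>\<^sub>M M) (\<lambda>(x, \<omega>). hits r T w x (\<lambda>s. B s \<omega>))"
proof -
  have "Measurable.pred (borel \<Otimes>\<^sub>M M) (\<lambda>a. hits r T (restrict w dyadic_times) (fst a) ((\<lambda>\<omega>. \<lambda>t\<in>dyadic_times. B t \<omega>) (snd a)))"
    by (intro measurable_hits_path measurable_const restrict_path_in_space
        measurable_compose[OF measurable_snd measurable_path]) auto
  then show ?thesis by (simp add: split_beta)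
qed

lemma hit_event [measurable]: "{\<omega> \<in> space M. hits r T w x (\<lambda>s. B s \<omega>)} \<in> events"
  using measurable_compose[OF measurable_Pair1'[of x borel M] measurable_hits_at[of r T w]] by simp

lemma hit_prob_eq_distr:
  "hit_prob M B r T w x
    = measure (distr M path_space (\<lambda>\<omega>. \<lambda>t\<in>dyadic_times. B t \<omega>)) {z \<in> space path_space. hits r T w x z}"
proof -
  have m: "Measurable.pred path_space (\<lambda>z. hits r T (restrict w dyadic_times) x z)"
    by (intro measurable_hits_path measurable_const restrict_path_in_space) auto
  show ?thesis
    unfolding hit_prob_def using m
    by (subst measure_distr) (auto intro!: arg_cong[where f="measure M"] simp: space_PiM pred_def)
qed

lemma measurable_hits_indicator:
  "(\<lambda>a. indicator {a. hits r T w (fst a) (\<lambda>s. B s (snd a))} a :: ennreal) \<in> borel_measurable (borel \<Otimes>\<^sub>M M)"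
  using measurable_hits_at[of r T w] by (intro borel_measurable_indicator') (simp add: split_beta)

lemma hit_prob_nn_integral:
  "ennreal (hit_prob M B r T w x)
    = (\<integral>\<^sup>+\<omega>. indicator {a. hits r T w (fst a) (\<lambda>s. B s (snd a))} (x, \<omega>) \<partial>M)"
proof -
  have "ennreal (hit_prob M B r T w x) = (\<integral>\<^sup>+\<omega>. indicator {\<omega> \<in> space M. hits r T w x (\<lambda>s. B s \<omega>)} \<omega> \<partial>M)"
    by (simp add: hit_prob_def emeasure_eq_measure)
  also have "\<dots> = (\<integral>\<^sup>+\<omega>. indicator {a. hits r T w (fst a) (\<lambda>s. B s (snd a))} (x, \<omega>) \<partial>M)"
    by (intro nn_integral_cong) (auto simp: indicator_def)
  finally show ?thesis .
qed

lemma hit_prob_measurable [measurable]: "hit_prob M B r T w \<in> borel_measurable borel"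
proof -
  have "(\<lambda>x. \<integral>\<^sup>+\<omega>. indicator {a. hits r T w (fst a) (\<lambda>s. B s (snd a))} (x, \<omega>) \<partial>M) \<in> borel_measurable borel"
    by (rule borel_measurable_nn_integral_fst[OF measurable_hits_indicator])
  then have "(\<lambda>x. enn2real (ennreal (hit_prob M B r T w x))) \<in> borel_measurable borel"
    unfolding hit_prob_nn_integral[symmetric] by (rule measurable_compose) simp
  then show ?thesis by (simp add: hit_prob_def[abs_def])
qed

text \<open>Fubini: the volume of a random set is the integral of its indicator, so its mean is the
  integral over \<open>x\<close> of the probability of containing \<open>x\<close>.\<close>

lemma
  assumes w: "continuous_on {0..} w" and T: "0 \<le> T"
  shows nn_integral_sausage_volume: "(\<integral>\<^sup>+\<omega>. ennreal (measure lebesgue (wiener_sausage B r w T \<omega>)) \<partial>M)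
      = (\<integral>\<^sup>+x. ennreal (hit_prob M B r T w x) \<partial>lborel)" (is ?vol)
    and sausage_volume_measurable: "(\<lambda>\<omega>. measure lebesgue (wiener_sausage B r w T \<omega>)) \<in> borel_measurable M" (is ?meas)
proof -
  note [measurable] = measurable_hits_at
  have W: "wiener_sausage B r w T \<omega> = {x. hits r T w x (\<lambda>s. B s \<omega>)}" if "\<omega> \<in> space M" for \<omega>
    unfolding hits_iff[OF T w continuous_paths[OF that]] wiener_sausage_def
    by (auto simp: dist_norm)
  have Wm[measurable]: "{x. hits r T w x (\<lambda>s. B s \<omega>)} \<in> sets borel" if "\<omega> \<in> space M" for \<omega>
    using measurable_compose[OF measurable_Pair2'[OF that, of borel] measurable_hits_at[of r T w]] by simp
  \<comment> \<open>\<open>measure\<close> sends sets of infinite size to 0, so boundedness of the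
    sausage has to be known before real volumes can be replaced by extended ones.\<close>
  have Wf: "emeasure lborel {x. hits r T w x (\<lambda>s. B s \<omega>)} < \<infinity>" if "\<omega> \<in> space M" for \<omega>
  proof -
    have "compact ((\<lambda>s. w s - B s \<omega>) ` {0..T})"
      using w continuous_paths[OF that]
      by (intro compact_continuous_image continuous_intros) (auto intro: continuous_on_subset)
    then have "bounded ((\<lambda>s. w s - B s \<omega>) ` {0..T})" by (rule compact_imp_bounded)
    then obtain b where b: "\<And>s. s \<in> {0..T} \<Longrightarrow> norm (w s - B s \<omega>) \<le> b"
      unfolding bounded_iff by blast
    have "{x. hits r T w x (\<lambda>s. B s \<omega>)} \<subseteq> cball 0 (b + r)"
      unfolding hits_iff[OF T w continuous_paths[OF that]]
    proof
      fix x assume "x \<in> {x. \<exists>s\<in>{0..T}. norm (w s - B s \<omega> - x) \<le> r}"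
      then obtain s where "s \<in> {0..T}" "norm (w s - B s \<omega> - x) \<le> r" by auto
      then show "x \<in> cball 0 (b + r)"
        using b[of s] norm_triangle_ineq2[of x "w s - B s \<omega>"] by (simp add: norm_minus_commute)
    qed
    then show ?thesis
      by (rule le_less_trans[OF emeasure_mono emeasure_lborel_cball_finite]) simp
  qed
  have vol: "ennreal (measure lebesgue (wiener_sausage B r w T \<omega>))
      = (\<integral>\<^sup>+x. indicator {a. hits r T w (fst a) (\<lambda>s. B s (snd a))} (x, \<omega>) \<partial>lborel)" if "\<omega> \<in> space M" for \<omega>
  proof -
    have "ennreal (measure lebesgue (wiener_sausage B r w T \<omega>)) = emeasure lborel {x. hits r T w x (\<lambda>s. B s \<omega>)}"
      using W[OF that] Wm[OF that] Wf[OF that] by (simp add: emeasure_eq_ennreal_measure)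
    also have "\<dots> = (\<integral>\<^sup>+x. indicator {x. hits r T w x (\<lambda>s. B s \<omega>)} x \<partial>lborel)"
      using Wm[OF that] by simp
    finally show ?thesis by (simp add: indicator_def)
  qed
  interpret P: pair_sigma_finite lborel M ..
  have "(\<integral>\<^sup>+\<omega>. ennreal (measure lebesgue (wiener_sausage B r w T \<omega>)) \<partial>M)
      = (\<integral>\<^sup>+\<omega>. \<integral>\<^sup>+x. indicator {a. hits r T w (fst a) (\<lambda>s. B s (snd a))} (x, \<omega>) \<partial>lborel \<partial>M)"
    using vol by (intro nn_integral_cong) auto
  also have "\<dots> = (\<integral>\<^sup>+x. \<integral>\<^sup>+\<omega>. indicator {a. hits r T w (fst a) (\<lambda>s. B s (snd a))} (x, \<omega>) \<partial>M \<partial>lborel)"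
    using measurable_hits_indicator[of r T w] by (intro P.Fubini') (simp add: split_beta')
  also have "\<dots> = (\<integral>\<^sup>+x. ennreal (hit_prob M B r T w x) \<partial>lborel)"
    by (simp only: hit_prob_nn_integral)
  finally show ?vol .
  have "(\<lambda>\<omega>. \<integral>\<^sup>+x. indicator {a. hits r T w (fst a) (\<lambda>s. B s (snd a))} (x, \<omega>) \<partial>lborel) \<in> borel_measurable M"
    using lborel.borel_measurable_nn_integral[of
        "\<lambda>\<omega> x. indicator {a. hits r T w (fst a) (\<lambda>s. B s (snd a))} (x, \<omega>)" M]
      measurable_pair_swap[OF measurable_hits_indicator[of r T w]] by (simp add: split_beta')
  then have "(\<lambda>\<omega>. ennreal (measure lebesgue (wiener_sausage B r w T \<omega>))) \<in> borel_measurable M"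
    by (subst measurable_cong[OF vol])
  then have "(\<lambda>\<omega>. enn2real (ennreal (measure lebesgue (wiener_sausage B r w T \<omega>)))) \<in> borel_measurable M"
    by (rule measurable_compose) simp
  then show ?meas by simp
qed

lemma expected_sausage_volume_eq:
  assumes w: "continuous_on {0..} w" and T: "0 \<le> T"
  shows "expected_sausage_volume M B r w T = enn2real (\<integral>\<^sup>+x. ennreal (hit_prob M B r T w x) \<partial>lborel)"
  unfolding expected_sausage_volume_def
  using sausage_volume_measurable[OF assms] nn_integral_sausage_volume[OF assms]
  by (subst integral_eq_nn_integral) auto

end

text \<open>Hitting is read off the law on dyadic times. Probabilities for different motions,
  possibly on different sample spaces, can thus be exchanged.\<close>

lemma hit_prob_unique:
  assumes "standard_brownian_motion M B" "standard_brownian_motion N C"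
  shows "hit_prob M B r T w x = hit_prob N C r T w x"
  using standard_brownian_motion.hit_prob_eq_distr[OF assms(1)]
    standard_brownian_motion.hit_prob_eq_distr[OF assms(2)] distr_dyadic_path_unique[OF assms]
  by simp

section \<open>The Laplace functional of a Poisson process\<close>

lemma prod_decseq:
  fixes f :: "nat \<Rightarrow> real"
  assumes "\<And>i. 0 \<le> f i" "\<And>i. f i \<le> 1"
  shows "decseq (\<lambda>m. \<Prod>i<m. f i)"
  using assms by (intro decseq_SucI) (auto intro!: mult_left_le prod_nonneg)

context poisson_point_process
begin

lemma card_measurable:
  assumes "A \<in> sets borel" "emeasure lborel A < \<infinity>"
  shows "(\<lambda>\<omega>. card {i. X i \<omega> \<in> A}) \<in> measurable M (count_space UNIV)"
  \<comment> \<open>\<open>indep_vars\<close> includes measurability of its members; a family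
    consisting of the single set \<open>A\<close> extracts it.\<close>
  using counts_indep[of "Suc 0" "\<lambda>_. A"] assms
  by (auto simp: indep_vars_def disjoint_family_on_def)

lemma finitely_many_points_measurable:
  assumes [measurable]: "A \<in> sets borel"
  shows "{\<omega> \<in> space M. finite {i. X i \<omega> \<in> A}} \<in> events"
proof -
  note [measurable] = points_measurable
  have "{\<omega> \<in> space M. finite {i. X i \<omega> \<in> A}} = {\<omega> \<in> space M. \<exists>m. \<forall>i\<ge>m. X i \<omega> \<notin> A}"
    unfolding finite_nat_set_iff_bounded by (auto simp: not_le[symmetric])
  also have "\<dots> \<in> events" by measurable
  finally show ?thesis .
qed

text \<open>The Poisson weights sum to 1, so the events of having exactly \<open>k\<close> points,
  finiteness included, exhaust the space up to a null set. Weighting them by \<open>c ^ k\<close>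
  gives another exponential series, the generating function.\<close>

lemma
  assumes A: "A \<in> sets borel" "emeasure lborel A < \<infinity>" and c: "0 \<le> c" "c \<le> 1"
  shows AE_finitely_many_points: "AE \<omega> in M. finite {i. X i \<omega> \<in> A}" (is ?fin)
    and expectation_power_card:
      "expectation (\<lambda>\<omega>. c ^ card {i. X i \<omega> \<in> A}) = exp (- (lam * measure lborel A * (1 - c)))" (is ?pgf)
proof -
  define \<mu> where "\<mu> = lam * measure lborel A"
  define E where "E k = {\<omega> \<in> space M. finite {i. X i \<omega> \<in> A} \<and> card {i. X i \<omega> \<in> A} = k}" for k
  note [measurable] = card_measurable[OF A] finitely_many_points_measurable[OF A(1)]
  have E[measurable]: "E k \<in> events" for k
  proof -
    have "E k = {\<omega> \<in> space M. finite {i. X i \<omega> \<in> A}} \<inter> {\<omega> \<in> space M. card {i. X i \<omega> \<in> A} = k}"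
      by (auto simp: E_def)
    also have "\<dots> \<in> events" by measurable
    finally show ?thesis .
  qed
  have PE: "prob (E k) = \<mu> ^ k / fact k * exp (- \<mu>)" for k
    using counts_poisson[OF A, of k] by (simp add: E_def \<mu>_def)
  have exps: "(\<lambda>k. x ^ k / fact k) sums exp x" for x :: real
    using exp_converges[of x] by (simp add: field_simps)
  have "(\<lambda>k. prob (E k)) sums prob (\<Union>k. E k)"
    by (intro finite_measure_UNION) (auto simp: disjoint_family_on_def E_def[abs_def] intro: E[unfolded E_def])
  moreover have "(\<lambda>k. prob (E k)) sums (exp \<mu> * exp (- \<mu>))"
    unfolding PE by (intro sums_mult2 exps)
  ultimately have "prob (\<Union>k. E k) = 1"
    by (simp add: sums_iff flip: exp_add)
  then have AE: "AE \<omega> in M. \<omega> \<in> (\<Union>k. E k)"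
    by (subst (asm) prob_eq_1) auto
  then show ?fin by (rule AE_mp) (auto simp: E_def)
  have "(\<lambda>n. expectation (\<lambda>\<omega>. \<Sum>k<n. c ^ k * indicator (E k) \<omega>))
      \<longlonglongrightarrow> expectation (\<lambda>\<omega>. c ^ card {i. X i \<omega> \<in> A})"
  proof (rule integral_dominated_convergence[where w="\<lambda>_. 1"])
    have *: "(\<Sum>k<n. c ^ k * indicator (E k) \<omega>)
        = (if card {i. X i \<omega> \<in> A} < n then c ^ card {i. X i \<omega> \<in> A} else 0)"
      if "\<omega> \<in> (\<Union>k. E k)" for n \<omega>
    proof -
      have "(\<Sum>k<n. c ^ k * indicator (E k) \<omega>)
        = (\<Sum>k<n. if k = card {i. X i \<omega> \<in> A} then c ^ k else 0)"
        using that by (intro sum.cong) (auto simp: E_def indicator_def)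
      then show ?thesis by (simp add: sum.delta)
    qed
    show "AE \<omega> in M. (\<lambda>n. \<Sum>k<n. c ^ k * indicator (E k) \<omega>) \<longlonglongrightarrow> c ^ card {i. X i \<omega> \<in> A}"
      using AE
    proof (rule AE_mp, intro AE_I2 impI)
      fix \<omega> assume w: "\<omega> \<in> (\<Union>k. E k)"
      show "(\<lambda>n. \<Sum>k<n. c ^ k * indicator (E k) \<omega>) \<longlonglongrightarrow> c ^ card {i. X i \<omega> \<in> A}"
        unfolding *[OF w]
        by (intro tendsto_eventually eventually_mono[OF eventually_gt_at_top]) auto
    qed
    show "AE \<omega> in M. norm (\<Sum>k<n. c ^ k * indicator (E k) \<omega>) \<le> 1" for n
      using AE
    proof (rule AE_mp, intro AE_I2 impI)
      fix \<omega> assume w: "\<omega> \<in> (\<Union>k. E k)"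
      show "norm (\<Sum>k<n. c ^ k * indicator (E k) \<omega>) \<le> 1"
        unfolding *[OF w] using c by (auto simp: power_le_one)
    qed
    show "(\<lambda>\<omega>. \<Sum>k<n. c ^ k * indicator (E k) \<omega>) \<in> borel_measurable M" for n by measurable
    show "(\<lambda>\<omega>. c ^ card {i. X i \<omega> \<in> A}) \<in> borel_measurable M"
      by (rule measurable_compose[OF card_measurable[OF A]]) simp
  qed simp
  also have "(\<lambda>n. expectation (\<lambda>\<omega>. \<Sum>k<n. c ^ k * indicator (E k) \<omega>))
      = (\<lambda>n. \<Sum>k<n. (c * \<mu>) ^ k / fact k * exp (- \<mu>))"
  proof
    fix n
    have "expectation (\<lambda>\<omega>. \<Sum>k<n. c ^ k * indicator (E k) \<omega>) = (\<Sum>k<n. c ^ k * prob (E k))"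
      by (subst Bochner_Integration.integral_sum)
        (auto simp: less_top[symmetric] intro!: integrable_mult_right integrable_real_indicator)
    then show "expectation (\<lambda>\<omega>. \<Sum>k<n. c ^ k * indicator (E k) \<omega>) = (\<Sum>k<n. (c * \<mu>) ^ k / fact k * exp (- \<mu>))"
      by (simp add: PE power_mult_distrib mult.assoc)
  qed
  finally have 1: "(\<lambda>k. (c * \<mu>) ^ k / fact k * exp (- \<mu>)) sums expectation (\<lambda>\<omega>. c ^ card {i. X i \<omega> \<in> A})"
    by (simp add: sums_def)
  have 2: "(\<lambda>k. (c * \<mu>) ^ k / fact k * exp (- \<mu>)) sums (exp (c * \<mu>) * exp (- \<mu>))"
    by (intro sums_mult2 exps)
  show ?pgf using sums_unique2[OF 1 2] by (simp add: \<mu>_def algebra_simps flip: exp_add)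
qed

text \<open>A product over points that is constant on each of finitely many disjoint sets is a
  product of powers of their counts, which are independent. Almost surely each set holds finitely
  many points, so the products over the first \<open>m\<close> points are eventually
  constant.\<close>

lemma laplace_simple:
  fixes A :: "nat \<Rightarrow> 'a set" and n :: nat
  assumes A: "\<And>j. j < n \<Longrightarrow> A j \<in> sets borel" "\<And>j. j < n \<Longrightarrow> emeasure lborel (A j) < \<infinity>"
    and disj: "disjoint_family_on A {..<n}"
    and c: "\<And>j. j < n \<Longrightarrow> 0 \<le> c j" "\<And>j. j < n \<Longrightarrow> c j \<le> 1"
  shows "(\<lambda>m. expectation (\<lambda>\<omega>. \<Prod>i<m. \<Prod>j<n. if X i \<omega> \<in> A j then c j else 1))
    \<longlonglongrightarrow> exp (- (lam * (\<Sum>j<n. measure lborel (A j) * (1 - c j))))"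
proof -
  note [measurable] = points_measurable A(1)
  have fin: "AE \<omega> in M. \<forall>j<n. finite {i. X i \<omega> \<in> A j}"
    using AE_finitely_many_points[OF A, of _ 0] by (simp add: AE_all_countable)
  have "(\<lambda>m. expectation (\<lambda>\<omega>. \<Prod>i<m. \<Prod>j<n. if X i \<omega> \<in> A j then c j else 1))
      \<longlonglongrightarrow> expectation (\<lambda>\<omega>. \<Prod>j<n. c j ^ card {i. X i \<omega> \<in> A j})"
  proof (rule integral_dominated_convergence[where w="\<lambda>_. 1"])
    show "(\<lambda>\<omega>. \<Prod>j<n. c j ^ card {i. X i \<omega> \<in> A j}) \<in> borel_measurable M"
    proof (intro borel_measurable_prod)
      fix j assume "j \<in> {..<n}"
      then show "(\<lambda>\<omega>. c j ^ card {i. X i \<omega> \<in> A j}) \<in> borel_measurable M"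
        by (intro measurable_compose[OF card_measurable]) (simp_all add: A[simplified])
    qed
    show "(\<lambda>\<omega>. \<Prod>i<m. \<Prod>j<n. if X i \<omega> \<in> A j then c j else 1) \<in> borel_measurable M" for m
    proof (intro borel_measurable_prod)
      fix i j assume "j \<in> {..<n}"
      then have [measurable]: "A j \<in> sets borel" by (simp add: A)
      show "(\<lambda>\<omega>. if X i \<omega> \<in> A j then c j else 1) \<in> borel_measurable M" by measurable
    qed
    show "AE \<omega> in M. norm (\<Prod>i<m. \<Prod>j<n. if X i \<omega> \<in> A j then c j else 1) \<le> 1" for m
    proof (intro AE_I2)
      fix \<omega>
      have fb: "0 \<le> (\<Prod>j<n. if X i \<omega> \<in> A j then c j else 1)"
          "(\<Prod>j<n. if X i \<omega> \<in> A j then c j else 1) \<le> 1" for i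
        using c by (auto intro!: prod_nonneg prod_le_1)
      show "norm (\<Prod>i<m. \<Prod>j<n. if X i \<omega> \<in> A j then c j else 1) \<le> 1"
        unfolding real_norm_def using fb c by (subst abs_of_nonneg) (auto intro!: prod_nonneg prod_le_1)
    qed
    show "AE \<omega> in M. (\<lambda>m. \<Prod>i<m. \<Prod>j<n. if X i \<omega> \<in> A j then c j else 1)
        \<longlonglongrightarrow> (\<Prod>j<n. c j ^ card {i. X i \<omega> \<in> A j})"
      using fin
    proof (rule AE_mp, intro AE_I2 impI)
      fix \<omega> assume f: "\<forall>j<n. finite {i. X i \<omega> \<in> A j}"
      have "(\<lambda>m. \<Prod>j<n. \<Prod>i<m. if X i \<omega> \<in> A j then c j else 1)
          \<longlonglongrightarrow> (\<Prod>j<n. c j ^ card {i. X i \<omega> \<in> A j})"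
      proof (intro tendsto_prod)
        fix j assume "j \<in> {..<n}"
        with f have f: "finite {i. X i \<omega> \<in> A j}" by auto
        then obtain m0 where m0: "\<And>i. X i \<omega> \<in> A j \<Longrightarrow> i < m0"
          by (auto simp: finite_nat_set_iff_bounded)
        have "(\<Prod>i<m. if X i \<omega> \<in> A j then c j else 1) = c j ^ card {i. X i \<omega> \<in> A j}" if "m0 \<le> m" for m
        proof -
          have "(\<Prod>i<m. if X i \<omega> \<in> A j then c j else 1) = (\<Prod>i\<in>{i. X i \<omega> \<in> A j}. c j)"
            using f m0 that by (intro prod.mono_neutral_cong_right) (auto intro: less_le_trans)
          then show ?thesis by simp
        qed
        then show "(\<lambda>m. \<Prod>i<m. if X i \<omega> \<in> A j then c j else 1) \<longlonglongrightarrow> c j ^ card {i. X i \<omega> \<in> A j}"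
          by (intro tendsto_eventually) (auto simp: eventually_at_top_linorder)
      qed
      then show "(\<lambda>m. \<Prod>i<m. \<Prod>j<n. if X i \<omega> \<in> A j then c j else 1)
        \<longlonglongrightarrow> (\<Prod>j<n. c j ^ card {i. X i \<omega> \<in> A j})"
        by (subst prod.swap)
    qed
  qed simp
  also have "expectation (\<lambda>\<omega>. \<Prod>j<n. c j ^ card {i. X i \<omega> \<in> A j})
      = (\<Prod>j<n. expectation (\<lambda>\<omega>. c j ^ card {i. X i \<omega> \<in> A j}))"
  proof (rule indep_vars_lebesgue_integral)
    show "indep_vars (\<lambda>_. borel) (\<lambda>j \<omega>. c j ^ card {i. X i \<omega> \<in> A j}) {..<n}"
      by (rule indep_vars_compose2[OF counts_indep[OF _ disj], of "\<lambda>j k. c j ^ k"]) (use A in auto)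
    show "integrable M (\<lambda>\<omega>. c j ^ card {i. X i \<omega> \<in> A j})" if "j \<in> {..<n}" for j
    proof (rule integrable_const_bound[where B=1])
      show "(\<lambda>\<omega>. c j ^ card {i. X i \<omega> \<in> A j}) \<in> borel_measurable M"
        using that A by (intro measurable_compose[OF card_measurable]) auto
    qed (use that c in \<open>auto simp: power_le_one\<close>)
  qed simp
  also have "\<dots> = (\<Prod>j<n. exp (- (lam * measure lborel (A j) * (1 - c j))))"
    using A c by (intro prod.cong refl expectation_power_card) auto
  also have "\<dots> = exp (- (lam * (\<Sum>j<n. measure lborel (A j) * (1 - c j))))"
    by (simp add: sum_distrib_left sum_negf mult.assoc flip: exp_sum)
  finally show ?thesis .
qed

text \<open>The limit in the number of points and the approximation by simple functions are never
  interchanged; \<open>a m\<close> is squeezed. Simple functions below \<open>p\<close> give larger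
  products, hence the upper bound. Products over points decrease in their number, hence the lower
  bound already at each fixed \<open>m\<close>.\<close>

lemma laplace_functional:
  fixes p :: "'a \<Rightarrow> real"
  assumes lam: "0 \<le> lam" and p: "\<And>x. 0 \<le> p x" "\<And>x. p x \<le> 1" "integrable lborel p"
  shows "(\<lambda>m. expectation (\<lambda>\<omega>. \<Prod>i<m. 1 - p (X i \<omega>))) \<longlonglongrightarrow> exp (- (lam * (\<integral>x. p x \<partial>lborel)))"
proof -
  have [measurable]: "p \<in> borel_measurable borel" using p(3) by auto
  note [measurable] = points_measurable
  \<comment> \<open>Level sets of \<open>p\<close> rounded down to multiples of
    \<open>1 / 2 ^ n\<close>. The cut-off at radius \<open>n\<close> makes them of finite volume,
    and \<open>p \<le> 1\<close> limits the levels to \<open>0..2 ^ n\<close>.\<close>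
  define A where "A n j = {x. norm x \<le> real n \<and> nat \<lfloor>2 ^ n * p x\<rfloor> = j}" for n j :: nat
  define q where "q n x = (if norm x \<le> real n then real_of_int \<lfloor>2 ^ n * p x\<rfloor> / 2 ^ n else 0)" for n :: nat and x
  have [measurable]: "q n \<in> borel_measurable borel" for n
    unfolding q_def[abs_def] by measurable
  have Am[measurable]: "A n j \<in> sets borel" for n j
    unfolding A_def by measurable
  have Af: "emeasure lborel (A n j) < \<infinity>" for n j
    by (rule le_less_trans[OF emeasure_mono emeasure_lborel_cball_finite[of 0 "real n"]]) (auto simp: A_def)
  have rng: "nat \<lfloor>2 ^ n * p x\<rfloor> < Suc (2 ^ n)" for n x
  proof -
    have "\<lfloor>2 ^ n * p x\<rfloor> \<le> \<lfloor>2 ^ n :: real\<rfloor>"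
      using p by (intro floor_mono) (auto intro: mult_left_le)
    then show ?thesis by (simp add: nat_le_iff less_Suc_eq_le)
  qed
  have fl: "real (nat \<lfloor>2 ^ n * p x\<rfloor>) = real_of_int \<lfloor>2 ^ n * p x\<rfloor>" for n x
    using p by simp
  have q0: "0 \<le> q n x" for n x using p by (auto simp: q_def)
  have qp: "q n x \<le> p x" for n x
    using p by (auto simp: q_def field_simps)
  have qsum: "q n x = (\<Sum>j<Suc (2 ^ n). (real j / 2 ^ n) * indicator (A n j) x)" for n x
  proof (cases "norm x \<le> real n")
    case True
    have "(\<Sum>j<Suc (2 ^ n). (real j / 2 ^ n) * indicator (A n j) x)
        = (\<Sum>j<Suc (2 ^ n). if j = nat \<lfloor>2 ^ n * p x\<rfloor> then real j / 2 ^ n else 0)"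
      using True by (intro sum.cong) (auto simp: A_def indicator_def)
    also have "\<dots> = real (nat \<lfloor>2 ^ n * p x\<rfloor>) / 2 ^ n"
      using rng[of n x] by (subst sum.delta) auto
    finally show ?thesis using True by (simp add: q_def fl)
  qed (auto simp: A_def q_def)
  have qprod: "1 - q n x = (\<Prod>j<Suc (2 ^ n). if x \<in> A n j then 1 - real j / 2 ^ n else 1)" for n x
  proof (cases "norm x \<le> real n")
    case True
    have "(\<Prod>j<Suc (2 ^ n). if x \<in> A n j then 1 - real j / 2 ^ n else 1)
        = (\<Prod>j<Suc (2 ^ n). if j = nat \<lfloor>2 ^ n * p x\<rfloor> then 1 - real j / 2 ^ n else 1)"
      using True by (intro prod.cong) (auto simp: A_def)
    also have "\<dots> = 1 - real (nat \<lfloor>2 ^ n * p x\<rfloor>) / 2 ^ n"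
      using rng[of n x] by (subst prod.delta) auto
    finally show ?thesis using True by (simp add: q_def fl)
  qed (auto simp: A_def q_def)
  have qint: "(\<integral>x. q n x \<partial>lborel) = (\<Sum>j<Suc (2 ^ n). measure lborel (A n j) * (1 - (1 - real j / 2 ^ n)))" for n
    unfolding qsum using Af by (subst Bochner_Integration.integral_sum) (auto simp: mult.commute)
  have lim_q: "(\<lambda>m. expectation (\<lambda>\<omega>. \<Prod>i<m. 1 - q n (X i \<omega>))) \<longlonglongrightarrow> exp (- (lam * (\<integral>x. q n x \<partial>lborel)))" for n
    unfolding qprod qint
  proof (rule laplace_simple[OF Am Af])
    show "disjoint_family_on (A n) {..<Suc (2 ^ n)}" by (auto simp: disjoint_family_on_def A_def)
    fix j assume "j < Suc (2 ^ n)"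
    then have "real j \<le> real (2 ^ n)" unfolding of_nat_le_iff by simp
    then show "0 \<le> 1 - real j / 2 ^ n" "1 - real j / 2 ^ n \<le> 1" by (auto simp: divide_le_eq)
  qed
  have tq: "(\<lambda>n. q n x) \<longlonglongrightarrow> p x" for x
  proof (rule tendsto_sandwich[of "\<lambda>n. p x - (1/2) ^ n" _ _ "\<lambda>_. p x"])
    obtain n0 :: nat where n0: "norm x \<le> real n0" using real_arch_simple by blast
    have "p x - (1/2) ^ n \<le> q n x" if "n0 \<le> n" for n
    proof -
      have "norm x \<le> real n" using n0 that by linarith
      moreover have "p x - (1/2) ^ n = (2 ^ n * p x - 1) / 2 ^ n"
        by (simp add: field_simps power_divide)
      moreover have "\<dots> \<le> real_of_int \<lfloor>2 ^ n * p x\<rfloor> / 2 ^ n"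
        using floor_correct[of "2 ^ n * p x"] by (intro divide_right_mono, linarith) simp
      ultimately show ?thesis by (simp add: q_def)
    qed
    then show "\<forall>\<^sub>F n in sequentially. p x - (1/2) ^ n \<le> q n x"
      by (auto simp: eventually_at_top_linorder)
    show "(\<lambda>n. p x - (1/2) ^ n) \<longlonglongrightarrow> p x"
      by (rule tendsto_eq_intros LIMSEQ_power_zero refl | simp)+
  qed (auto simp: qp)
  have int_q: "(\<lambda>n. \<integral>x. q n x \<partial>lborel) \<longlonglongrightarrow> (\<integral>x. p x \<partial>lborel)"
    using tq q0 qp p by (intro integral_dominated_convergence[where w=p]) auto
  define a where "a m = expectation (\<lambda>\<omega>. \<Prod>i<m. 1 - p (X i \<omega>))" for m
  have int: "integrable M (\<lambda>\<omega>. \<Prod>i<m. 1 - f (X i \<omega>))"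
    if "f \<in> borel_measurable borel" "\<And>x. 0 \<le> f x" "\<And>x. f x \<le> 1" for f :: "'a \<Rightarrow> real" and m :: nat
  proof (rule integrable_const_bound[where B=1])
    note [measurable] = that(1)
    show "(\<lambda>\<omega>. \<Prod>i<m. 1 - f (X i \<omega>)) \<in> borel_measurable M" by measurable
  qed (use that in \<open>auto simp: prod_nonneg intro!: prod_le_1\<close>)
  have q1: "q n x \<le> 1" for n x using qp p order_trans by blast
  have up: "a m \<le> expectation (\<lambda>\<omega>. \<Prod>i<m. 1 - q n (X i \<omega>))" for m n
    unfolding a_def using p q0 q1 qp
    by (intro integral_mono int prod_mono) (auto simp: q1)
  \<comment> \<open>Here \<open>m\<close> is fixed and \<open>n\<close> tends to infinity. The
    expectation for \<open>q n\<close> at \<open>m\<close> dominates its own limit in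
    \<open>m\<close>, which is at least the target value since \<open>q n\<close> lies below
    \<open>p\<close>.\<close>
  have low: "exp (- (lam * (\<integral>x. p x \<partial>lborel))) \<le> a m" for m
  proof -
    have "(\<lambda>n. expectation (\<lambda>\<omega>. \<Prod>i<m. 1 - q n (X i \<omega>))) \<longlonglongrightarrow> a m"
      unfolding a_def using p q0 q1 tq
      by (intro integral_dominated_convergence[where w="\<lambda>_. 1"])
        (auto simp: prod_nonneg intro!: tendsto_intros prod_le_1)
    moreover have "exp (- (lam * (\<integral>x. p x \<partial>lborel))) \<le> expectation (\<lambda>\<omega>. \<Prod>i<m. 1 - q n (X i \<omega>))" for n
    proof -
      have "exp (- (lam * (\<integral>x. p x \<partial>lborel))) \<le> exp (- (lam * (\<integral>x. q n x \<partial>lborel)))"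
        using lam p q0 qp by (auto intro!: mult_left_mono integral_mono
            Bochner_Integration.integrable_bound[OF p(3)])
      also have "\<dots> \<le> expectation (\<lambda>\<omega>. \<Prod>i<m. 1 - q n (X i \<omega>))"
      proof (rule LIMSEQ_le_const2[OF lim_q], intro exI allI impI)
        fix k assume "m \<le> k"
        then show "expectation (\<lambda>\<omega>. \<Prod>i<k. 1 - q n (X i \<omega>)) \<le> expectation (\<lambda>\<omega>. \<Prod>i<m. 1 - q n (X i \<omega>))"
          using q0 q1 decseqD[OF prod_decseq, of "\<lambda>i. 1 - q n (X i _)" m k]
          by (intro integral_mono int) auto
      qed
      finally show ?thesis .
    qed
    ultimately show ?thesis by (intro LIMSEQ_le_const) auto
  qed
  show ?thesis
    unfolding a_def[symmetric]
  proof (rule order_tendstoI)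
    fix y assume "y < exp (- (lam * (\<integral>x. p x \<partial>lborel)))"
    then show "\<forall>\<^sub>F m in sequentially. y < a m" by (intro always_eventually allI less_le_trans[OF _ low])
  next
    fix y assume y: "exp (- (lam * (\<integral>x. p x \<partial>lborel))) < y"
    have "(\<lambda>n. exp (- (lam * (\<integral>x. q n x \<partial>lborel)))) \<longlonglongrightarrow> exp (- (lam * (\<integral>x. p x \<partial>lborel)))"
      by (intro tendsto_intros int_q)
    from order_tendstoD(2)[OF this y] obtain n where "exp (- (lam * (\<integral>x. q n x \<partial>lborel))) < y"
      by (auto simp: eventually_at_top_linorder)
    from order_tendstoD(2)[OF lim_q this] show "\<forall>\<^sub>F m in sequentially. a m < y"
      by (rule eventually_mono) (rule le_less_trans[OF up])
  qed
qed

end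

section \<open>First visits on a time grid\<close>

context standard_brownian_motion
begin

definition near :: "(real \<Rightarrow> 'a) \<Rightarrow> real \<Rightarrow> real \<Rightarrow> nat \<Rightarrow> 'a \<Rightarrow> 'w set" where
  "near g \<delta> R k x = {\<omega> \<in> space M. norm (g (real k * \<delta>) - B (real k * \<delta>) \<omega> - x) \<le> R}"

definition first_near :: "(real \<Rightarrow> 'a) \<Rightarrow> real \<Rightarrow> real \<Rightarrow> nat \<Rightarrow> 'a \<Rightarrow> 'w set" where
  "first_near g \<delta> R k x = near g \<delta> R k x - (\<Union>l<k. near g \<delta> R l x)"

lemma near_measurable [measurable]:
  assumes "0 < \<delta>" shows "near g \<delta> R k x \<in> events"
proof -
  have [measurable]: "B (real k * \<delta>) \<in> borel_measurable M"
    using assms by (intro measurable_at) simp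
  show ?thesis unfolding near_def by measurable
qed

lemma first_near_measurable [measurable]:
  assumes "0 < \<delta>" shows "first_near g \<delta> R k x \<in> events"
  using assms unfolding first_near_def by (intro sets.Diff sets.finite_UN near_measurable) auto

lemma disjoint_first_near: "disjoint_family_on (\<lambda>i. first_near g \<delta> R i x) I"
  unfolding disjoint_family_on_def first_near_def
  by (auto dest: linorder_neqE_nat)

lemma UN_first_near: "(\<Union>i\<le>n. first_near g \<delta> R i x) = (\<Union>i\<le>n. near g \<delta> R i x)"
proof (intro equalityI subsetI)
  fix \<omega> assume "\<omega> \<in> (\<Union>i\<le>n. near g \<delta> R i x)"
  then obtain i where i: "i \<le> n" "\<omega> \<in> near g \<delta> R i x" by auto
  define k where "k = (LEAST k. \<omega> \<in> near g \<delta> R k x)"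
  have "\<omega> \<in> near g \<delta> R k x" unfolding k_def using i(2) by (rule LeastI)
  moreover have "k \<le> i" unfolding k_def using i(2) by (rule Least_le)
  moreover have "\<omega> \<notin> near g \<delta> R l x" if "l < k" for l
    using not_less_Least[of l "\<lambda>k. \<omega> \<in> near g \<delta> R k x"] that by (simp add: k_def)
  ultimately show "\<omega> \<in> (\<Union>i\<le>n. first_near g \<delta> R i x)"
    using i(1) by (auto simp: first_near_def intro!: bexI[of _ k])
qed (auto simp: first_near_def)

lemma prob_UN_near:
  assumes "0 < \<delta>"
  shows "prob (\<Union>i\<le>n. near g \<delta> R i x) = (\<Sum>i\<le>n. prob (first_near g \<delta> R i x))"
  unfolding UN_first_near[symmetric]
  using assms by (intro finite_measure_finite_Union disjoint_first_near) (auto intro: first_near_measurable)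

lemma prob_near_split:
  assumes "0 < \<delta>" "k \<le> n"
  shows "(\<Sum>i\<le>n. prob (first_near g \<delta> R i x \<inter> near g \<delta> R k x)) = prob (near g \<delta> R k x)"
proof -
  have "(\<Union>i\<le>n. first_near g \<delta> R i x \<inter> near g \<delta> R k x) = near g \<delta> R k x"
    using UN_first_near[of g \<delta> R x n] assms(2) by auto
  moreover have "prob (\<Union>i\<le>n. first_near g \<delta> R i x \<inter> near g \<delta> R k x)
      = (\<Sum>i\<le>n. prob (first_near g \<delta> R i x \<inter> near g \<delta> R k x))"
    using assms disjoint_first_near[of g \<delta> R x "{..n}"]
    by (intro finite_measure_finite_Union)
      (auto simp: disjoint_family_on_def intro!: sets.Int first_near_measurable near_measurable)
  ultimately show ?thesis by simp
qed

text \<open>Strong Markov property at a discrete time. The first visit at step \<open>i\<close> is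
  decided by the positions up to \<open>i\<close>; a visit at step \<open>k\<close> then means that
  an independent Gaussian increment lands in a ball of radius \<open>R\<close>. Its centre is within
  \<open>R\<close> of the displacement of the drift between the two steps, hence has norm at most
  \<open>R + G\<close>.\<close>

lemma prob_first_near_Int_near:
  assumes \<delta>: "0 < \<delta>" and k: "i < k"
    and G: "norm (g (real k * \<delta>) - g (real i * \<delta>)) \<le> G"
    and lo: "\<And>c::'a. norm c \<le> R + G \<Longrightarrow> lo \<le> measure (gauss (real (k - i) * \<delta>)) (cball c R)"
    and up: "\<And>c::'a. norm c \<le> R + G \<Longrightarrow> measure (gauss (real (k - i) * \<delta>)) (cball c R) \<le> up"
    and lo0: "0 \<le> lo" and up0: "0 \<le> up"
  shows "lo * prob (first_near g \<delta> R i x) \<le> prob (first_near g \<delta> R i x \<inter> near g \<delta> R k x)"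
    and "prob (first_near g \<delta> R i x \<inter> near g \<delta> R k x) \<le> up * prob (first_near g \<delta> R i x)"
proof -
  define s where "s = real (k - i) * \<delta>"
  have s: "0 < s" "real k * \<delta> - real i * \<delta> = s" "real i * \<delta> < real k * \<delta>"
    using \<delta> k by (auto simp: s_def of_nat_diff left_diff_distrib)
  interpret G: prob_space "gauss s :: 'a measure" using s by (intro prob_space_gauss)
  \<comment> \<open>The first visit at step \<open>i\<close>, written as a condition on the vector
    of grid positions, so that \<open>nn_integral_past_increment\<close> applies.\<close>
  define P where "P u \<longleftrightarrow> norm (g (real i * \<delta>) - u i - x) \<le> R \<and> (\<forall>l<i. \<not> norm (g (real l * \<delta>) - u l - x) \<le> R)"
    for u :: "nat \<Rightarrow> 'a"
  define f where "f z = (indicator {z. P (fst z) \<and> norm (g (real k * \<delta>) - (fst z i + snd z) - x) \<le> R} z :: ennreal)" for z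
  let ?U = "\<lambda>\<omega>. \<lambda>l\<in>{..i}. B (real l * \<delta>) \<omega>"
  have comp: "(\<lambda>z. fst z l) \<in> borel_measurable (PiM {..i} (\<lambda>_. borel :: 'a measure) \<Otimes>\<^sub>M (borel :: 'a measure))" if "l \<le> i" for l
    using that by (intro measurable_compose[OF measurable_fst] measurable_component_singleton) auto
  have le: "Measurable.pred Q (\<lambda>x. h x \<le> R)" if [measurable]: "h \<in> borel_measurable Q"
    for h :: "(nat \<Rightarrow> 'a) \<times> 'a \<Rightarrow> real" and Q by measurable
  have fm: "f \<in> borel_measurable (PiM {..i} (\<lambda>_. borel) \<Otimes>\<^sub>M borel)"
    unfolding f_def[abs_def] P_def
    by (intro borel_measurable_indicator' pred_intros_logic pred_intros_countable
        le borel_measurable_norm borel_measurable_diff borel_measurable_add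
        comp measurable_const measurable_snd) (auto intro: less_imp_le)
  have Ui: "?U \<omega> i = B (real i * \<delta>) \<omega>" for \<omega> by simp
  have eq: "P (?U \<omega>) \<longleftrightarrow> \<omega> \<in> first_near g \<delta> R i x" if "\<omega> \<in> space M" for \<omega>
    using that by (auto simp: P_def first_near_def near_def)
  have "emeasure M (first_near g \<delta> R i x \<inter> near g \<delta> R k x)
      = (\<integral>\<^sup>+\<omega>. indicator (first_near g \<delta> R i x \<inter> near g \<delta> R k x) \<omega> \<partial>M)"
    using \<delta> by (intro nn_integral_indicator[symmetric] sets.Int first_near_measurable near_measurable)
  also have "\<dots> = (\<integral>\<^sup>+\<omega>. f (?U \<omega>, B (real k * \<delta>) \<omega> - B (real i * \<delta>) \<omega>) \<partial>M)"
    by (intro nn_integral_cong) (auto simp: f_def eq Ui indicator_def near_def[of _ _ _ k] simp del: restrict_apply)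
  also have "\<dots> = (\<integral>\<^sup>+\<omega>. (\<integral>\<^sup>+y. f (?U \<omega>, y) \<partial>gauss s) \<partial>M)"
    using nn_integral_past_increment[OF \<delta> s(3) fm] unfolding s(2) .
  also have "\<dots> = (\<integral>\<^sup>+\<omega>. ennreal (measure (gauss s) (cball (g (real k * \<delta>) - B (real i * \<delta>) \<omega> - x) R))
      * indicator (first_near g \<delta> R i x) \<omega> \<partial>M)"
  proof (intro nn_integral_cong)
    fix \<omega> assume w: "\<omega> \<in> space M"
    have "(\<integral>\<^sup>+y. f (?U \<omega>, y) \<partial>gauss s)
        = (\<integral>\<^sup>+y. indicator (first_near g \<delta> R i x) \<omega> * indicator (cball (g (real k * \<delta>) - B (real i * \<delta>) \<omega> - x) R) y \<partial>gauss s)"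
      using eq[OF w] by (intro nn_integral_cong)
        (auto simp: f_def indicator_def dist_norm algebra_simps)
    also have "\<dots> = indicator (first_near g \<delta> R i x) \<omega> * emeasure (gauss s) (cball (g (real k * \<delta>) - B (real i * \<delta>) \<omega> - x) R)"
      by (subst nn_integral_cmult_indicator) auto
    finally show "(\<integral>\<^sup>+y. f (?U \<omega>, y) \<partial>gauss s) = ennreal (measure (gauss s) (cball (g (real k * \<delta>) - B (real i * \<delta>) \<omega> - x) R))
      * indicator (first_near g \<delta> R i x) \<omega>"
      by (simp add: G.emeasure_eq_measure mult.commute)
  qed
  finally have E: "ennreal (prob (first_near g \<delta> R i x \<inter> near g \<delta> R k x))
    = (\<integral>\<^sup>+\<omega>. ennreal (measure (gauss s) (cball (g (real k * \<delta>) - B (real i * \<delta>) \<omega> - x) R))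
      * indicator (first_near g \<delta> R i x) \<omega> \<partial>M)"
    by (simp add: emeasure_eq_measure)
  have nc: "norm (g (real k * \<delta>) - B (real i * \<delta>) \<omega> - x) \<le> R + G" if "\<omega> \<in> first_near g \<delta> R i x" for \<omega>
  proof -
    have "norm (g (real i * \<delta>) - B (real i * \<delta>) \<omega> - x) \<le> R" using that by (auto simp: first_near_def near_def)
    then show ?thesis
      using G norm_triangle_ineq[of "g (real i * \<delta>) - B (real i * \<delta>) \<omega> - x" "g (real k * \<delta>) - g (real i * \<delta>)"]
      by (simp add: algebra_simps)
  qed
  have "ennreal (lo * prob (first_near g \<delta> R i x)) = (\<integral>\<^sup>+\<omega>. ennreal lo * indicator (first_near g \<delta> R i x) \<omega> \<partial>M)"
    using lo0 \<delta> by (subst nn_integral_cmult_indicator) (auto simp: ennreal_mult emeasure_eq_measure first_near_measurable)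
  also have "\<dots> \<le> ennreal (prob (first_near g \<delta> R i x \<inter> near g \<delta> R k x))"
    unfolding E using lo nc by (intro nn_integral_mono) (auto simp: indicator_def s_def intro!: ennreal_leI)
  finally show "lo * prob (first_near g \<delta> R i x) \<le> prob (first_near g \<delta> R i x \<inter> near g \<delta> R k x)"
    by simp
  have "ennreal (prob (first_near g \<delta> R i x \<inter> near g \<delta> R k x)) \<le> (\<integral>\<^sup>+\<omega>. ennreal up * indicator (first_near g \<delta> R i x) \<omega> \<partial>M)"
    unfolding E using up nc by (intro nn_integral_mono) (auto simp: indicator_def s_def intro!: ennreal_leI)
  also have "\<dots> = ennreal (up * prob (first_near g \<delta> R i x))"
    using up0 \<delta> by (subst nn_integral_cmult_indicator) (auto simp: ennreal_mult emeasure_eq_measure first_near_measurable)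
  finally show "prob (first_near g \<delta> R i x \<inter> near g \<delta> R k x) \<le> up * prob (first_near g \<delta> R i x)"
    using up0 by (subst (asm) ennreal_le_iff) auto
qed

text \<open>Visits are counted from the first one: given that there is any, the expected number of
  visits is at most 1 plus the sum of the best possible return probabilities. The bounds
  \<open>q\<close> hold for every centre, so \<open>g\<close> is unrestricted.\<close>

lemma sum_prob_near_le:
  assumes \<delta>: "0 < \<delta>" and q: "\<And>j (c::'a). 1 \<le> j \<Longrightarrow> j \<le> n \<Longrightarrow> measure (gauss (real j * \<delta>)) (cball c R) \<le> q j"
    and q0: "\<And>j. 0 \<le> q j"
  shows "(\<Sum>k\<le>n. prob (near g \<delta> R k x)) \<le> (1 + (\<Sum>j=1..n. q j)) * prob (\<Union>i\<le>n. near g \<delta> R i x)"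
proof -
  \<comment> \<open>Lag 0 is the first visit itself, which contributes the 1 in the factor.\<close>
  define q' where "q' j = (if j = 0 then 1 else q j)" for j
  have q'0: "0 \<le> q' j" for j using q0 by (simp add: q'_def)
  have 1: "prob (first_near g \<delta> R i x \<inter> near g \<delta> R k x) \<le> q' (k - i) * prob (first_near g \<delta> R i x)"
    if "i \<le> k" "k \<le> n" for i k
  proof (cases "i = k")
    case True
    then show ?thesis using \<delta> by (auto simp: q'_def intro!: finite_measure_mono first_near_measurable)
  next
    case False
    then show ?thesis
      using that q0 by (intro prob_first_near_Int_near(2)[OF \<delta> _ order_refl, of _ _ _ _ 0])
        (auto simp: q'_def of_nat_diff[symmetric] simp del: of_nat_diff intro!: q)
  qed
  have "(\<Sum>k\<le>n. prob (near g \<delta> R k x)) = (\<Sum>k\<le>n. \<Sum>i\<le>k. prob (first_near g \<delta> R i x \<inter> near g \<delta> R k x))"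
    using prob_near_split[OF \<delta>] by (intro sum.cong refl) simp
  also have "\<dots> \<le> (\<Sum>k\<le>n. \<Sum>i\<le>k. q' (k - i) * prob (first_near g \<delta> R i x))"
    by (intro sum_mono 1) auto
  also have "\<dots> = (\<Sum>i\<le>n. \<Sum>k\<in>{i..n}. q' (k - i) * prob (first_near g \<delta> R i x))"
  proof -
    have "{i \<in> {..n}. i \<le> k} = {..k}" if "k \<in> {..n}" for k using that by auto
    moreover have "{k \<in> {..n}. i \<le> k} = {i..n}" for i by auto
    ultimately show ?thesis
      using sum.swap_restrict[of "{..n}" "{..n}" "\<lambda>k i. q' (k - i) * prob (first_near g \<delta> R i x)" "\<lambda>k i. i \<le> k"]
      by simp
  qed
  also have "\<dots> \<le> (\<Sum>i\<le>n. (\<Sum>j\<le>n. q' j) * prob (first_near g \<delta> R i x))"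
  proof (intro sum_mono)
    fix i assume "i \<in> {..n}"
    then have "(\<Sum>k\<in>{i..n}. q' (k - i)) = (\<Sum>j\<in>(\<lambda>k. k - i) ` {i..n}. q' j)"
      by (subst sum.reindex) (auto simp: inj_on_def)
    also have "\<dots> \<le> (\<Sum>j\<le>n. q' j)"
      using q'0 by (intro sum_mono2) auto
    finally show "(\<Sum>k\<in>{i..n}. q' (k - i) * prob (first_near g \<delta> R i x)) \<le> (\<Sum>j\<le>n. q' j) * prob (first_near g \<delta> R i x)"
      unfolding sum_distrib_right[symmetric] by (intro mult_right_mono) auto
  qed
  also have "\<dots> = (\<Sum>j\<le>n. q' j) * prob (\<Union>i\<le>n. near g \<delta> R i x)"
    by (simp add: prob_UN_near[OF \<delta>] sum_distrib_left)
  also have "(\<Sum>j\<le>n. q' j) = 1 + (\<Sum>j=1..n. q j)"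
    unfolding atMost_atLeast0 by (subst sum.atLeast_Suc_atMost) (auto simp: q'_def)
  finally show ?thesis .
qed

text \<open>Converse count. Visits are observed up to \<open>n + h\<close>, so that a first visit as
  late as \<open>n\<close> still has all its return lags in \<open>J\<close>. Restricting the lags
  to \<open>J\<close> later discards short ones, for which the Gaussian lower bound is poor.\<close>

lemma prob_UN_near_le:
  assumes \<delta>: "0 < \<delta>" and J: "J \<subseteq> {1..h}"
    and G: "\<And>i j. i \<le> n \<Longrightarrow> j \<in> J \<Longrightarrow> norm (g (real (i + j) * \<delta>) - g (real i * \<delta>)) \<le> G"
    and l: "\<And>j (c::'a). j \<in> J \<Longrightarrow> norm c \<le> R + G \<Longrightarrow> l j \<le> measure (gauss (real j * \<delta>)) (cball c R)"
    and l0: "\<And>j. 0 \<le> l j"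
  shows "(\<Sum>j\<in>J. l j) * prob (\<Union>i\<le>n. near g \<delta> R i x) \<le> (\<Sum>k\<le>n+h. prob (near g \<delta> R k x))"
proof -
  have "(\<Sum>j\<in>J. l j) * prob (\<Union>i\<le>n. near g \<delta> R i x) = (\<Sum>i\<le>n. \<Sum>j\<in>J. l j * prob (first_near g \<delta> R i x))"
    by (simp add: prob_UN_near[OF \<delta>] sum_distrib_left sum_distrib_right)
  also have "\<dots> \<le> (\<Sum>i\<le>n. \<Sum>k\<le>n+h. prob (first_near g \<delta> R i x \<inter> near g \<delta> R k x))"
  proof (rule sum_mono)
    fix i assume i: "i \<in> {..n}"
    have "(\<Sum>j\<in>J. l j * prob (first_near g \<delta> R i x)) \<le> (\<Sum>j\<in>J. prob (first_near g \<delta> R i x \<inter> near g \<delta> R (i + j) x))"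
    proof (rule sum_mono)
      fix j assume j: "j \<in> J"
      have "0 < j" using j J by auto
      moreover have "measure (gauss (real j * \<delta>)) (cball c R) \<le> 1" for c :: 'a
        using \<delta> \<open>0 < j\<close> by (intro prob_space.prob_le_1 prob_space_gauss mult_pos_pos) simp_all
      ultimately show "l j * prob (first_near g \<delta> R i x) \<le> prob (first_near g \<delta> R i x \<inter> near g \<delta> R (i + j) x)"
        using i j l l0 by (intro prob_first_near_Int_near(1)[OF \<delta> _ G, where up = 1]) auto
    qed
    also have "\<dots> = (\<Sum>k\<in>(\<lambda>j. i + j) ` J. prob (first_near g \<delta> R i x \<inter> near g \<delta> R k x))"
      by (subst sum.reindex) (auto simp: inj_on_def)
    also have "\<dots> \<le> (\<Sum>k\<le>n+h. prob (first_near g \<delta> R i x \<inter> near g \<delta> R k x))"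
      using i J by (intro sum_mono2) (force simp: subset_iff)+
    finally show "(\<Sum>j\<in>J. l j * prob (first_near g \<delta> R i x)) \<le> (\<Sum>k\<le>n+h. prob (first_near g \<delta> R i x \<inter> near g \<delta> R k x))" .
  qed
  also have "\<dots> = (\<Sum>k\<le>n+h. \<Sum>i\<le>n. prob (first_near g \<delta> R i x \<inter> near g \<delta> R k x))"
    by (rule sum.swap)
  also have "\<dots> \<le> (\<Sum>k\<le>n+h. prob (near g \<delta> R k x))"
  proof (rule sum_mono)
    fix k assume k: "k \<in> {..n+h}"
    have "(\<Sum>i\<le>n. prob (first_near g \<delta> R i x \<inter> near g \<delta> R k x)) \<le> (\<Sum>i\<le>n+h. prob (first_near g \<delta> R i x \<inter> near g \<delta> R k x))"
      by (intro sum_mono2) auto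
    then show "(\<Sum>i\<le>n. prob (first_near g \<delta> R i x \<inter> near g \<delta> R k x)) \<le> prob (near g \<delta> R k x)"
      using prob_near_split[OF \<delta>, of k "n + h"] k by simp
  qed
  finally show ?thesis .
qed

lemma near_pair_measurable:
  assumes "0 < \<delta>"
  shows "Measurable.pred (borel \<Otimes>\<^sub>M M) (\<lambda>a. norm (g (real k * \<delta>) - B (real k * \<delta>) (snd a) - fst a) \<le> R)"
proof -
  have [measurable]: "B (real k * \<delta>) \<in> borel_measurable M"
    using assms by (intro measurable_at) simp
  show ?thesis by measurable
qed

lemma prob_near_measurable:
  assumes "0 < \<delta>" and K: "countable K"
  shows "(\<lambda>x. prob (\<Union>i\<in>K. near g \<delta> R i x)) \<in> borel_measurable borel"
proof -
  have m: "(\<lambda>a. indicator {a. \<exists>i\<in>K. norm (g (real i * \<delta>) - B (real i * \<delta>) (snd a) - fst a) \<le> R} a :: ennreal)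
      \<in> borel_measurable (borel \<Otimes>\<^sub>M M)"
  proof (rule borel_measurable_indicator')
    have "Measurable.pred (borel \<Otimes>\<^sub>M M) (\<lambda>a. \<exists>i\<in>K. norm (g (real i * \<delta>) - B (real i * \<delta>) (snd a) - fst a) \<le> R)"
      by (intro pred_intros_countable_bounded K near_pair_measurable assms(1))
    then show "{a \<in> space (borel \<Otimes>\<^sub>M M). a \<in> {a. \<exists>i\<in>K. norm (g (real i * \<delta>) - B (real i * \<delta>) (snd a) - fst a) \<le> R}}
        \<in> sets (borel \<Otimes>\<^sub>M M)"
      unfolding pred_def mem_Collect_eq .
  qed
  have e: "ennreal (prob (\<Union>i\<in>K. near g \<delta> R i x))
      = (\<integral>\<^sup>+\<omega>. indicator {a. \<exists>i\<in>K. norm (g (real i * \<delta>) - B (real i * \<delta>) (snd a) - fst a) \<le> R} (x, \<omega>) \<partial>M)" for x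
  proof -
    have "ennreal (prob (\<Union>i\<in>K. near g \<delta> R i x)) = (\<integral>\<^sup>+\<omega>. indicator (\<Union>i\<in>K. near g \<delta> R i x) \<omega> \<partial>M)"
      using assms by (subst nn_integral_indicator) (auto simp: emeasure_eq_measure intro!: sets.countable_UN' near_measurable)
    also have "\<dots> = (\<integral>\<^sup>+\<omega>. indicator {a. \<exists>i\<in>K. norm (g (real i * \<delta>) - B (real i * \<delta>) (snd a) - fst a) \<le> R} (x, \<omega>) \<partial>M)"
      by (intro nn_integral_cong) (auto simp: indicator_def near_def)
    finally show ?thesis .
  qed
  have "(\<lambda>x. enn2real (ennreal (prob (\<Union>i\<in>K. near g \<delta> R i x)))) \<in> borel_measurable borel"
    unfolding e by (rule measurable_compose[OF borel_measurable_nn_integral_fst[OF m]]) simp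
  then show ?thesis by simp
qed

text \<open>At a fixed time and sample point the covered \<open>x\<close> form a ball around a
  random centre. After Fubini neither the drift nor the motion is left.\<close>

lemma nn_integral_prob_near:
  assumes \<delta>: "0 < \<delta>" and R: "0 \<le> R"
  shows "(\<integral>\<^sup>+x. ennreal (prob (near g \<delta> R k x)) \<partial>lborel) = ennreal (measure lborel (cball (0::'a) R))"
proof -
  interpret P: pair_sigma_finite lborel M ..
  let ?S = "{a. norm (g (real k * \<delta>) - B (real k * \<delta>) (snd a) - fst a) \<le> R}"
  have m: "(\<lambda>a. indicator ?S a :: ennreal) \<in> borel_measurable (borel \<Otimes>\<^sub>M M)"
    by (rule borel_measurable_indicator') (use near_pair_measurable[OF \<delta>, of g k R] in \<open>unfold pred_def mem_Collect_eq\<close>)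
  have "(\<integral>\<^sup>+x. ennreal (prob (near g \<delta> R k x)) \<partial>lborel) = (\<integral>\<^sup>+x. \<integral>\<^sup>+\<omega>. indicator ?S (x, \<omega>) \<partial>M \<partial>lborel)"
  proof (intro nn_integral_cong)
    fix x
    have "ennreal (prob (near g \<delta> R k x)) = (\<integral>\<^sup>+\<omega>. indicator (near g \<delta> R k x) \<omega> \<partial>M)"
      using \<delta> by (subst nn_integral_indicator) (auto simp: emeasure_eq_measure near_measurable)
    also have "\<dots> = (\<integral>\<^sup>+\<omega>. indicator ?S (x, \<omega>) \<partial>M)"
      by (intro nn_integral_cong) (auto simp: indicator_def near_def)
    finally show "ennreal (prob (near g \<delta> R k x)) = (\<integral>\<^sup>+\<omega>. indicator ?S (x, \<omega>) \<partial>M)" .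
  qed
  also have "\<dots> = (\<integral>\<^sup>+\<omega>. \<integral>\<^sup>+x. indicator ?S (x, \<omega>) \<partial>lborel \<partial>M)"
    using m by (intro P.Fubini'[symmetric]) (simp add: split_beta')
  also have "\<dots> = (\<integral>\<^sup>+\<omega>. ennreal (measure lborel (cball (0::'a) R)) \<partial>M)"
  proof (intro nn_integral_cong)
    fix \<omega>
    have "(\<integral>\<^sup>+x. indicator ?S (x, \<omega>) \<partial>lborel) = (\<integral>\<^sup>+x. indicator (cball (g (real k * \<delta>) - B (real k * \<delta>) \<omega>) R) x \<partial>lborel)"
      by (intro nn_integral_cong) (auto simp: indicator_def dist_norm)
    then show "(\<integral>\<^sup>+x. indicator ?S (x, \<omega>) \<partial>lborel) = ennreal (measure lborel (cball (0::'a) R))"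
      using R by (simp add: emeasure_cball content_cball)
  qed
  finally show ?thesis by (simp add: emeasure_space_1)
qed

end

section \<open>Bounds on the expected volume\<close>

context standard_brownian_motion
begin

text \<open>Integrated over \<open>x\<close>, the expected number of visits at the
  \<open>Suc n\<close> grid times is \<open>Suc n\<close> times the ball volume for every drift;
  dividing by the bound on the visits per visited point leaves the volume of the set of visited
  points, a part of the sausage.\<close>

lemma nn_integral_hit_prob_ge:
  assumes \<delta>: "0 < \<delta>" and R: "0 \<le> R" and g: "continuous_on {0..} g" and n: "real n * \<delta> \<le> T"
    and q: "\<And>j (c::'a). 1 \<le> j \<Longrightarrow> j \<le> n \<Longrightarrow> measure (gauss (real j * \<delta>)) (cball c R) \<le> q j"
    and q0: "\<And>j. 0 \<le> q j"
  shows "ennreal (real (Suc n) * measure lborel (cball (0::'a) R))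
    \<le> ennreal (1 + (\<Sum>j=1..n. q j)) * (\<integral>\<^sup>+x. ennreal (hit_prob M B R T g x) \<partial>lborel)"
proof -
  have T: "0 \<le> T" using n \<delta> by (meson less_imp_le mult_nonneg_nonneg of_nat_0_le_iff order_trans)
  have hit: "prob (\<Union>i\<le>n. near g \<delta> R i x) \<le> hit_prob M B R T g x" for x
    unfolding hit_prob_def
  proof (intro finite_measure_mono hit_event subsetI)
    fix \<omega> assume "\<omega> \<in> (\<Union>i\<le>n. near g \<delta> R i x)"
    then obtain i where i: "i \<le> n" "\<omega> \<in> space M" "norm (g (real i * \<delta>) - B (real i * \<delta>) \<omega> - x) \<le> R"
      by (auto simp: near_def)
    have "real i * \<delta> \<le> real n * \<delta>" using i \<delta> by (intro mult_right_mono) auto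
    then have "real i * \<delta> \<le> T" using n by linarith
    then have "real i * \<delta> \<in> {0..T}" using \<delta> by simp
    with i show "\<omega> \<in> {\<omega> \<in> space M. hits R T g x (\<lambda>s. B s \<omega>)}"
      using hits_iff[OF T g continuous_paths[OF i(2)]] by auto
  qed
  have Q: "0 \<le> 1 + (\<Sum>j=1..n. q j)" using q0 by (intro add_nonneg_nonneg sum_nonneg) auto
  have "ennreal (real (Suc n) * measure lborel (cball (0::'a) R))
      = (\<Sum>k\<le>n. ennreal (measure lborel (cball (0::'a) R)))"
    by (simp add: ennreal_mult' ennreal_of_nat_eq_real_of_nat[symmetric])
  also have "\<dots> = (\<Sum>k\<le>n. \<integral>\<^sup>+x. ennreal (prob (near g \<delta> R k x)) \<partial>lborel)"
    using nn_integral_prob_near[OF \<delta> R] by simp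
  also have "\<dots> = (\<integral>\<^sup>+x. (\<Sum>k\<le>n. ennreal (prob (near g \<delta> R k x))) \<partial>lborel)"
    using prob_near_measurable[OF \<delta>, of "{k}" for k] by (intro nn_integral_sum[symmetric]) simp
  also have "\<dots> \<le> (\<integral>\<^sup>+x. ennreal (1 + (\<Sum>j=1..n. q j)) * ennreal (hit_prob M B R T g x) \<partial>lborel)"
  proof (intro nn_integral_mono)
    fix x
    have "(\<Sum>k\<le>n. prob (near g \<delta> R k x)) \<le> (1 + (\<Sum>j=1..n. q j)) * hit_prob M B R T g x"
      using sum_prob_near_le[OF \<delta> q q0] mult_left_mono[OF hit Q] by (rule order_trans)
    then show "(\<Sum>k\<le>n. ennreal (prob (near g \<delta> R k x))) \<le> ennreal (1 + (\<Sum>j=1..n. q j)) * ennreal (hit_prob M B R T g x)"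
      using Q by (subst ennreal_mult[symmetric]) (auto simp: hit_prob_def sum_ennreal intro: ennreal_leI)
  qed
  also have "\<dots> = ennreal (1 + (\<Sum>j=1..n. q j)) * (\<integral>\<^sup>+x. ennreal (hit_prob M B R T g x) \<partial>lborel)"
    by (intro nn_integral_cmult) simp
  finally show ?thesis .
qed

lemma nn_integral_prob_UN_near_le:
  assumes \<delta>: "0 < \<delta>" and R: "0 \<le> R" and J: "J \<subseteq> {1..h}"
    and G: "\<And>i j. i \<le> n \<Longrightarrow> j \<in> J \<Longrightarrow> norm (g (real (i + j) * \<delta>) - g (real i * \<delta>)) \<le> G"
    and l: "\<And>j (c::'a). j \<in> J \<Longrightarrow> norm c \<le> R + G \<Longrightarrow> l j \<le> measure (gauss (real j * \<delta>)) (cball c R)"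
    and l0: "\<And>j. 0 \<le> l j"
  shows "ennreal (\<Sum>j\<in>J. l j) * (\<integral>\<^sup>+x. ennreal (prob (\<Union>i\<le>n. near g \<delta> R i x)) \<partial>lborel)
    \<le> ennreal (real (n + h + 1) * measure lborel (cball (0::'a) R))"
proof -
  have L: "0 \<le> (\<Sum>j\<in>J. l j)" using l0 by (intro sum_nonneg) auto
  have "ennreal (\<Sum>j\<in>J. l j) * (\<integral>\<^sup>+x. ennreal (prob (\<Union>i\<le>n. near g \<delta> R i x)) \<partial>lborel)
      = (\<integral>\<^sup>+x. ennreal (\<Sum>j\<in>J. l j) * ennreal (prob (\<Union>i\<le>n. near g \<delta> R i x)) \<partial>lborel)"
    using prob_near_measurable[OF \<delta>, of "{..n}"] by (intro nn_integral_cmult[symmetric]) simp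
  also have "\<dots> \<le> (\<integral>\<^sup>+x. (\<Sum>k\<le>n+h. ennreal (prob (near g \<delta> R k x))) \<partial>lborel)"
  proof (intro nn_integral_mono)
    fix x
    show "ennreal (\<Sum>j\<in>J. l j) * ennreal (prob (\<Union>i\<le>n. near g \<delta> R i x)) \<le> (\<Sum>k\<le>n+h. ennreal (prob (near g \<delta> R k x)))"
      using prob_UN_near_le[OF \<delta> J G l l0] L
      by (subst ennreal_mult[symmetric]) (auto simp: sum_ennreal intro: ennreal_leI)
  qed
  also have "\<dots> = (\<Sum>k\<le>n+h. \<integral>\<^sup>+x. ennreal (prob (near g \<delta> R k x)) \<partial>lborel)"
    using prob_near_measurable[OF \<delta>, of "{k}" for k] by (intro nn_integral_sum) simp
  also have "\<dots> = ennreal (real (n + h + 1) * measure lborel (cball (0::'a) R))"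
  proof -
    have "(\<Sum>k\<le>n+h. \<integral>\<^sup>+x. ennreal (prob (near g \<delta> R k x)) \<partial>lborel)
        = of_nat (n + h + 1) * ennreal (measure lborel (cball (0::'a) R))"
      by (simp add: nn_integral_prob_near[OF \<delta> R])
    then show ?thesis
      by (simp only: ennreal_of_nat_eq_real_of_nat ennreal_mult' of_nat_0_le_iff)
  qed
  finally show ?thesis .
qed

text \<open>Enlarging the radius turns a hit at an arbitrary time into a hit at a time of every
  sufficiently fine dyadic grid.\<close>

lemma nn_integral_hit_prob_le_grid:
  assumes g: "continuous_on {0..} g" and T: "0 \<le> T" and r: "r < R"
    and C: "\<And>m. (\<integral>\<^sup>+x. ennreal (prob (\<Union>i\<le>nat \<lfloor>T * 2 ^ m\<rfloor>. near g (1 / 2 ^ m) R i x)) \<partial>lborel) \<le> C"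
  shows "(\<integral>\<^sup>+x. ennreal (hit_prob M B r T g x) \<partial>lborel) \<le> C"
proof -
  define U where "U m x = (\<Union>i\<le>nat \<lfloor>T * 2 ^ m\<rfloor>. near g (1 / 2 ^ m) R i x)" for m x
  have iff: "i \<le> nat \<lfloor>T * 2 ^ m\<rfloor> \<longleftrightarrow> real i * (1 / 2 ^ m) \<le> T" for i m :: nat
    using T by (simp add: le_nat_iff le_floor_iff field_simps)
  have Uinc: "incseq (\<lambda>m. U m x)" for x
  proof (rule incseq_SucI, rule subsetI)
    fix m \<omega> assume "\<omega> \<in> U m x"
    then obtain i where i: "real i * (1 / 2 ^ m) \<le> T" "\<omega> \<in> near g (1 / 2 ^ m) R i x"
      by (auto simp: U_def iff)
    have e: "real (2 * i) * (1 / 2 ^ Suc m) = real i * (1 / 2 ^ m)" by simp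
    have "\<omega> \<in> near g (1 / 2 ^ Suc m) R (2 * i) x" using i(2) unfolding near_def e .
    moreover have "2 * i \<le> nat \<lfloor>T * 2 ^ Suc m\<rfloor>" unfolding iff e by (rule i(1))
    ultimately show "\<omega> \<in> U (Suc m) x" unfolding U_def by blast
  qed
  have Um[measurable]: "U m x \<in> events" for m x
    unfolding U_def by (intro sets.finite_UN near_measurable) auto
  have sub: "{\<omega> \<in> space M. hits r T g x (\<lambda>s. B s \<omega>)} \<subseteq> (\<Union>m. U m x)" for x
  proof safe
    fix \<omega> assume w: "\<omega> \<in> space M" and h: "hits r T g x (\<lambda>s. B s \<omega>)"
    \<comment> \<open>The tolerance built into \<open>hits\<close> is chosen to fit into the gap
      between \<open>r\<close> and \<open>R\<close>, so that a dyadic near-hit is a genuine visit at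
      radius \<open>R\<close>.\<close>
    obtain k where "inverse (real (Suc k)) < R - r" using reals_Archimedean[of "R - r"] r by auto
    then have k: "r + 1 / real (Suc k) < R" by (simp add: inverse_eq_divide)
    obtain q where q: "q \<in> dyadic_times" "q \<in> {0..T}" "norm (g q - B q \<omega> - x) < r + 1 / real (Suc k)"
      using h unfolding hits_def by blast
    obtain i m where im: "q = real i * (1 / 2 ^ m)" using q(1) by (auto simp: dyadic_times_def)
    have "\<omega> \<in> near g (1 / 2 ^ m) R i x" using q(3) k w by (simp add: near_def im)
    moreover have "i \<le> nat \<lfloor>T * 2 ^ m\<rfloor>" unfolding iff using q(2) by (simp add: im)
    ultimately show "\<omega> \<in> (\<Union>m. U m x)" unfolding U_def by blast
  qed
  have "(\<integral>\<^sup>+x. ennreal (hit_prob M B r T g x) \<partial>lborel) \<le> (\<integral>\<^sup>+x. (SUP m. ennreal (prob (U m x))) \<partial>lborel)"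
  proof (intro nn_integral_mono)
    fix x
    have "ennreal (hit_prob M B r T g x) \<le> emeasure M (\<Union>m. U m x)"
      unfolding hit_prob_def emeasure_eq_measure[symmetric] by (intro emeasure_mono sub) auto
    also have "\<dots> = (SUP m. ennreal (prob (U m x)))"
      unfolding emeasure_eq_measure[symmetric] using Uinc by (intro SUP_emeasure_incseq[symmetric]) auto
    finally show "ennreal (hit_prob M B r T g x) \<le> (SUP m. ennreal (prob (U m x)))" .
  qed
  also have "\<dots> = (SUP m. \<integral>\<^sup>+x. ennreal (prob (U m x)) \<partial>lborel)"
  proof (intro nn_integral_monotone_convergence_SUP)
    show "incseq (\<lambda>m x. ennreal (prob (U m x)))"
      using Uinc by (auto simp: incseq_def le_fun_def intro!: ennreal_leI finite_measure_mono)
    show "(\<lambda>x. ennreal (prob (U m x))) \<in> borel_measurable lborel" for m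
      using prob_near_measurable[of "1 / 2 ^ m" "{..nat \<lfloor>T * 2 ^ m\<rfloor>}" g R] by (simp add: U_def)
  qed
  also have "\<dots> \<le> C" using C by (intro SUP_least) (simp add: U_def)
  finally show ?thesis .
qed

text \<open>Returns are counted at lags between times \<open>S\<close> and \<open>H\<close> only. A
  large \<open>S\<close> brings the Gaussian exponential factor near 1, and \<open>H\<close> is the
  extra time during which returns are observed. \<open>A * 2 ^ m\<close> bounds from below the sum
  of the densities on the grid of mesh \<open>1 / 2 ^ m\<close>; \<open>A\<close> plays the role of
  the integral of \<open>u powr (- d / 2)\<close> over \<open>[S, H]\<close>. Both sides of the
  count scale like \<open>2 ^ m\<close>, so the bound is uniform in the mesh.\<close>

lemma nn_integral_hit_prob_le:
  fixes S H :: nat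
  assumes g: "continuous_on {0..} g" and T: "0 \<le> T" and r: "0 \<le> r" "r < R"
    and S: "1 \<le> S" "S \<le> H" and A: "0 < A"
    and sumA: "\<And>m. A * 2 ^ m \<le> (\<Sum>j=S * 2 ^ m..H * 2 ^ m. (real j / 2 ^ m) powr (- real DIM('a) / 2))"
    and G0: "0 \<le> G" and G: "\<And>s u. 0 \<le> s \<Longrightarrow> s \<le> T \<Longrightarrow> 0 \<le> u \<Longrightarrow> u \<le> real H \<Longrightarrow> norm (g (s + u) - g s) \<le> G"
  shows "(\<integral>\<^sup>+x. ennreal (hit_prob M B r T g x) \<partial>lborel)
    \<le> ennreal ((T + real H + 1) * (2 * pi) powr (real DIM('a) / 2) * exp ((2 * R + G)\<^sup>2 / (2 * real S)) / A)"
proof (rule nn_integral_hit_prob_le_grid[OF g T r(2)])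
  fix m :: nat
  define \<delta> :: real where "\<delta> = 1 / 2 ^ m"
  define n where "n = nat \<lfloor>T * 2 ^ m\<rfloor>"
  define V where "V = measure lborel (cball (0::'a) R)"
  define K where "K = (2 * pi) powr (- real DIM('a) / 2) * exp (- (2 * R + G)\<^sup>2 / (2 * real S)) * V"
  define l where "l j = K * (real j * \<delta>) powr (- real DIM('a) / 2)" for j :: nat
  define I where "I = (\<integral>\<^sup>+x. ennreal (prob (\<Union>i\<le>n. near g \<delta> R i x)) \<partial>lborel)"
  have \<delta>: "0 < \<delta>" by (simp add: \<delta>_def)
  have R: "0 < R" using r by simp
  have V: "0 < V" using R by (simp add: V_def content_cball unit_ball_vol_pos)
  have K: "0 < K" using V by (simp add: K_def)
  have n: "real n * \<delta> \<le> T" "real n \<le> T * 2 ^ m"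
    using T of_int_floor_le[of "T * 2 ^ m"] by (auto simp: n_def \<delta>_def field_simps)
  have "ennreal (\<Sum>j=S * 2 ^ m..H * 2 ^ m. l j) * I \<le> ennreal (real (n + H * 2 ^ m + 1) * V)"
    unfolding I_def V_def
  proof (rule nn_integral_prob_UN_near_le[OF \<delta>, where G = G])
    show "0 \<le> R" using R by simp
    show "{S * 2 ^ m..H * 2 ^ m} \<subseteq> {1..H * 2 ^ m}" using S by auto
    show "0 \<le> l j" for j using K by (simp add: l_def)
    show "norm (g (real (i + j) * \<delta>) - g (real i * \<delta>)) \<le> G" if "i \<le> n" "j \<in> {S * 2 ^ m..H * 2 ^ m}" for i j
    proof -
      have "real i * \<delta> \<le> T" using that(1) n(1) \<delta> by (meson less_imp_le mult_right_mono of_nat_le_iff order_trans)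
      moreover have "real j * \<delta> \<le> real H"
        using that(2) of_nat_le_iff[of j "H * 2 ^ m", where 'a=real] by (simp add: \<delta>_def divide_le_eq)
      ultimately show ?thesis using G[of "real i * \<delta>" "real j * \<delta>"] \<delta> by (simp add: distrib_right)
    qed
    show "l j \<le> measure (gauss (real j * \<delta>)) (cball c R)" if "j \<in> {S * 2 ^ m..H * 2 ^ m}" "norm c \<le> R + G" for j and c :: 'a
    proof -
      have "real S \<le> real j * \<delta>"
        using that(1) of_nat_le_iff[of "S * 2 ^ m" j, where 'a=real] by (simp add: \<delta>_def le_divide_eq)
      then have s: "real S \<le> real j * \<delta>" "0 < real j * \<delta>" using S by auto
      have "l j = (2 * pi * (real j * \<delta>)) powr (- real DIM('a) / 2) * exp (- (2 * R + G)\<^sup>2 / (2 * real S)) * V"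
        using s by (simp add: l_def K_def powr_mult)
      also have "\<dots> \<le> (2 * pi * (real j * \<delta>)) powr (- real DIM('a) / 2) * exp (- (2 * R + G)\<^sup>2 / (2 * (real j * \<delta>))) * V"
      proof -
        have "(2 * R + G)\<^sup>2 / (2 * (real j * \<delta>)) \<le> (2 * R + G)\<^sup>2 / (2 * real S)"
          using S by (intro divide_left_mono mult_pos_pos s) (use s in simp_all)
        then show ?thesis using V by (intro mult_right_mono mult_left_mono) auto
      qed
      also have "\<dots> \<le> measure (gauss (real j * \<delta>)) (cball c R)"
        unfolding V_def
      proof (intro gauss_cball_ge s)
        \<comment> \<open>The centre has norm at most \<open>R + G\<close> and the ball adds another
          \<open>R\<close>; this is the origin of \<open>2 * R + G\<close> in the exponent.\<close>
        show "cball c R \<subseteq> cball 0 (2 * R + G)"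
          using that(2) by (intro cball_subset_cball_iff[THEN iffD2]) auto
      qed (use R in simp)
      finally show ?thesis .
    qed
  qed
  also have "(\<Sum>j=S * 2 ^ m..H * 2 ^ m. l j) = K * (\<Sum>j=S * 2 ^ m..H * 2 ^ m. (real j / 2 ^ m) powr (- real DIM('a) / 2))"
    by (simp add: l_def sum_distrib_left \<delta>_def)
  finally have 1: "ennreal (K * (\<Sum>j=S * 2 ^ m..H * 2 ^ m. (real j / 2 ^ m) powr (- real DIM('a) / 2))) * I
      \<le> ennreal (real (n + H * 2 ^ m + 1) * V)" .
  have "ennreal (K * A * 2 ^ m) * I \<le> ennreal (real (n + H * 2 ^ m + 1) * V)"
    using K sumA[of m] by (intro order_trans[OF mult_right_mono 1] ennreal_leI) (auto simp: mult.assoc)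
  also have "\<dots> \<le> ennreal ((T + real H + 1) * 2 ^ m * V)"
  proof (intro ennreal_leI mult_right_mono)
    have "(1::real) \<le> 2 ^ m" by simp
    moreover have "real (n + H * 2 ^ m + 1) = real n + real H * 2 ^ m + 1" by simp
    moreover have "(T + real H + 1) * 2 ^ m = T * 2 ^ m + real H * 2 ^ m + 2 ^ m"
      by (simp add: algebra_simps)
    ultimately show "real (n + H * 2 ^ m + 1) \<le> (T + real H + 1) * 2 ^ m" using n(2) by linarith
  qed (use V in simp)
  finally have 2: "ennreal (K * A * 2 ^ m) * I \<le> ennreal ((T + real H + 1) * 2 ^ m * V)" .
  have pos: "0 < K * A * 2 ^ m" using K A by simp
  have "I = ennreal (inverse (K * A * 2 ^ m)) * (ennreal (K * A * 2 ^ m) * I)"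
  proof -
    have "ennreal (inverse p) * ennreal p = 1" if "0 < p" for p :: real
      using that by (simp add: ennreal_mult[symmetric])
    from this[OF pos] have "ennreal (inverse (K * A * 2 ^ m)) * ennreal (K * A * 2 ^ m) = 1" .
    then show ?thesis by (simp only: mult.assoc[symmetric] mult_1_left)
  qed
  also have "\<dots> \<le> ennreal (inverse (K * A * 2 ^ m)) * ennreal ((T + real H + 1) * 2 ^ m * V)"
    by (intro mult_left_mono 2) simp
  also have "\<dots> = ennreal (inverse (K * A * 2 ^ m) * ((T + real H + 1) * 2 ^ m * V))"
    using pos T V K A by (intro ennreal_mult[symmetric]) auto
  \<comment> \<open>The ball volume cancels here, so the radius survives only in the exponential.
    Radii growing with time are possible for this reason.\<close>
  also have "inverse (K * A * 2 ^ m) * ((T + real H + 1) * 2 ^ m * V)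
      = (T + real H + 1) * (2 * pi) powr (real DIM('a) / 2) * exp ((2 * R + G)\<^sup>2 / (2 * real S)) / A"
    using V A by (simp add: K_def field_simps powr_minus exp_minus)
  finally show "(\<integral>\<^sup>+x. ennreal (prob (\<Union>i\<le>nat \<lfloor>T * 2 ^ m\<rfloor>. near g (1 / 2 ^ m) R i x)) \<partial>lborel)
      \<le> ennreal ((T + real H + 1) * (2 * pi) powr (real DIM('a) / 2) * exp ((2 * R + G)\<^sup>2 / (2 * real S)) / A)"
    by (simp add: I_def n_def \<delta>_def)
qed

text \<open>The crude choice \<open>S = 1\<close>, \<open>H = 2\<close>, \<open>R = r + 1\<close>:
  more than \<open>2 ^ m\<close> lags, each of density at least \<open>2 powr (- d / 2)\<close> up
  to constants. It yields finiteness for any continuous drift and the linear upper bound in every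
  dimension.\<close>

lemma nn_integral_hit_prob_le_linear:
  assumes g: "continuous_on {0..} g" and T: "0 \<le> T" and r: "0 \<le> r"
    and G0: "0 \<le> G" and G: "\<And>s u. 0 \<le> s \<Longrightarrow> s \<le> T \<Longrightarrow> 0 \<le> u \<Longrightarrow> u \<le> 2 \<Longrightarrow> norm (g (s + u) - g s) \<le> G"
  shows "(\<integral>\<^sup>+x. ennreal (hit_prob M B r T g x) \<partial>lborel)
    \<le> ennreal ((T + 3) * (2 * pi) powr (real DIM('a) / 2) * exp ((2 * (r + 1) + G)\<^sup>2 / 2) / 2 powr (- real DIM('a) / 2))"
proof -
  have "2 powr (- real DIM('a) / 2) * 2 ^ m
      \<le> (\<Sum>j=1 * 2 ^ m..2 * 2 ^ m. (real j / 2 ^ m) powr (- real DIM('a) / 2))" for m :: nat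
  proof -
    have "2 powr (- real DIM('a) / 2) * 2 ^ m \<le> (\<Sum>j=1 * 2 ^ m..2 * 2 ^ m::nat. 2 powr (- real DIM('a) / 2))"
      by (simp add: algebra_simps)
    also have "\<dots> \<le> (\<Sum>j=1 * 2 ^ m..2 * 2 ^ m. (real j / 2 ^ m) powr (- real DIM('a) / 2))"
    proof (rule sum_mono)
      fix j :: nat assume j: "j \<in> {1 * 2 ^ m..2 * 2 ^ m}"
      then have "real j \<le> real (2 * 2 ^ m)" unfolding of_nat_le_iff by simp
      moreover have "0 < j" using j by (auto intro: Nat.gr0I)
      ultimately show "2 powr (- real DIM('a) / 2) \<le> (real j / 2 ^ m) powr (- real DIM('a) / 2)"
        by (intro powr_mono2') (auto simp: divide_le_eq)
    qed
    finally show ?thesis .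
  qed
  then show ?thesis
    using nn_integral_hit_prob_le[OF g T r, of "r + 1" 1 2 "2 powr (- real DIM('a) / 2)" G] G0 G
    by (simp add: add.assoc)
qed

lemma nn_integral_hit_prob_finite:
  assumes g: "continuous_on {0..} g" and T: "0 \<le> T" and r: "0 \<le> r"
  shows "(\<integral>\<^sup>+x. ennreal (hit_prob M B r T g x) \<partial>lborel) < \<infinity>"
proof -
  \<comment> \<open>Increments of the drift over lags up to 2 are needed, hence the interval is
    extended by 2 beyond \<open>T\<close>.\<close>
  have "compact (g ` {0..T + 2})"
    using g by (intro compact_continuous_image) (auto intro: continuous_on_subset)
  then have "bounded (g ` {0..T + 2})" by (rule compact_imp_bounded)
  then obtain b where b: "\<And>s. s \<in> {0..T + 2} \<Longrightarrow> norm (g s) \<le> b"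
    unfolding bounded_iff by blast
  have "norm (g (s + u) - g s) \<le> 2 * b" if "0 \<le> s" "s \<le> T" "0 \<le> u" "u \<le> 2" for s u
    using b[of "s + u"] b[of s] that norm_triangle_ineq4[of "g (s + u)" "g s"] by simp
  moreover have "0 \<le> b" using b[of 0] T by (auto intro: order_trans[OF norm_ge_zero])
  ultimately show ?thesis
    using nn_integral_hit_prob_le_linear[OF g T r, of "2 * b"] by (auto intro: le_less_trans)
qed

lemma integrable_hit_prob:
  assumes "continuous_on {0..} g" "0 \<le> T" "0 \<le> r"
  shows "integrable lborel (hit_prob M B r T g)"
  using nn_integral_hit_prob_finite[OF assms]
  by (intro integrableI_nonneg) auto

lemma expected_sausage_volume_integral:
  assumes "continuous_on {0..} g" "0 \<le> T" "0 \<le> r"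
  shows "expected_sausage_volume M B r g T = (\<integral>x. hit_prob M B r T g x \<partial>lborel)"
  unfolding expected_sausage_volume_eq[OF assms(1,2)]
  using nn_integral_eq_integral[OF integrable_hit_prob[OF assms]]
  by simp

lemma ennreal_expected_sausage_volume:
  assumes "continuous_on {0..} g" "0 \<le> T" "0 \<le> r"
  shows "ennreal (expected_sausage_volume M B r g T) = (\<integral>\<^sup>+x. ennreal (hit_prob M B r T g x) \<partial>lborel)"
  unfolding expected_sausage_volume_integral[OF assms]
  using nn_integral_eq_integral[OF integrable_hit_prob[OF assms]]
  by simp

lemma integrable_sausage_volume:
  assumes "continuous_on {0..} g" "0 \<le> T" "0 \<le> r"
  shows "integrable M (\<lambda>\<omega>. measure lebesgue (wiener_sausage B r g T \<omega>))"
  using nn_integral_sausage_volume[OF assms(1,2)] nn_integral_hit_prob_finite[OF assms]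
    sausage_volume_measurable[OF assms(1,2)]
  by (intro integrableI_nonneg) auto

lemma expected_sausage_volume_nonneg: "0 \<le> expected_sausage_volume M B r g T"
  unfolding expected_sausage_volume_def by (intro integral_nonneg_AE AE_I2) simp

text \<open>A detection time strictly larger than \<open>t\<close> means absence of hits on an
  interval slightly longer than \<open>[0, t]\<close>; continuity from the right closes that gap.
  The hitting events decrease, and the integrable probabilities for time \<open>t + 1\<close>
  dominate.\<close>

lemma expected_sausage_volume_right_continuous:
  assumes g: "continuous_on {0..} g" and t: "0 \<le> t" and r: "0 \<le> r"
  shows "(\<lambda>n. expected_sausage_volume M B r g (t + 1 / real (Suc n))) \<longlonglongrightarrow> expected_sausage_volume M B r g t"
proof -
  define T where "T n = t + 1 / real (Suc n)" for n
  have T: "0 \<le> T n" "t \<le> T n" "T n \<le> t + 1" for n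
    using t by (auto simp: T_def divide_le_eq)
  have Tmono: "T n \<le> T m" if "m \<le> n" for m n using that by (auto simp: T_def frac_le)
  have mono: "hits r a g x z \<Longrightarrow> hits r b g x z" if "a \<le> b" for a b x z
    unfolding hits_def using that by (meson IntD1 IntD2 IntI atLeastAtMost_iff order_trans)
  have lim: "(\<lambda>n. hit_prob M B r (T n) g x) \<longlonglongrightarrow> hit_prob M B r t g x" for x
  proof -
    let ?E = "\<lambda>T. {\<omega> \<in> space M. hits r T g x (\<lambda>s. B s \<omega>)}"
    have "(\<lambda>n. prob (?E (T n))) \<longlonglongrightarrow> prob (\<Inter>n. ?E (T n))"
      by (rule finite_Lim_measure_decseq) (auto simp: decseq_def intro: mono[OF Tmono])
    moreover have "(\<Inter>n. ?E (T n)) = ?E t"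
    proof (intro equalityI subsetI)
      fix \<omega> assume "\<omega> \<in> (\<Inter>n. ?E (T n))"
      then have w: "\<omega> \<in> space M" and h: "\<And>n. hits r (T n) g x (\<lambda>s. B s \<omega>)" by auto
      define f where "f s = norm (g s - B s \<omega> - x)" for s
      have f: "continuous_on {0..} f"
        unfolding f_def by (intro continuous_intros g continuous_paths[OF w])
      show "\<omega> \<in> ?E t"
      proof (rule ccontr)
        assume "\<omega> \<notin> ?E t"
        then have no: "\<And>s. s \<in> {0..t} \<Longrightarrow> r < f s"
          using w hits_iff[OF t g continuous_paths[OF w]] by (force simp: f_def)
        \<comment> \<open>Without a hit up to \<open>t\<close> the distance at \<open>t\<close>
          exceeds \<open>r\<close> strictly, and by continuity it does so for a while longer,
          contradicting a hit before \<open>T n\<close> for large \<open>n\<close>.\<close>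
        then have "0 < f t - r" using t by auto
        then obtain d where d: "0 < d" "\<And>s. 0 \<le> s \<Longrightarrow> dist s t < d \<Longrightarrow> dist (f s) (f t) < f t - r"
          using f t unfolding continuous_on_iff by (metis atLeast_iff)
        obtain n where "inverse (real (Suc n)) < d" using reals_Archimedean[OF d(1)] by auto
        then have n: "T n < t + d" by (simp add: T_def inverse_eq_divide)
        obtain s where s: "0 \<le> s" "s \<le> T n" "f s \<le> r"
          using h[of n] hits_iff[OF T(1) g continuous_paths[OF w]] by (auto simp: f_def)
        have "t < s" using no[of s] s by force
        then have "dist (f s) (f t) < f t - r" using s n by (intro d(2)) (auto simp: dist_real_def)
        then show False using s(3) by (auto simp: dist_real_def)
      qed
    qed (use mono[OF T(2)] in auto)
    ultimately show ?thesis by (simp add: hit_prob_def)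
  qed
  have "(\<lambda>n. \<integral>x. hit_prob M B r (T n) g x \<partial>lborel) \<longlonglongrightarrow> (\<integral>x. hit_prob M B r t g x \<partial>lborel)"
  proof (rule integral_dominated_convergence[where w="hit_prob M B r (t + 1) g"])
    show "integrable lborel (hit_prob M B r (t + 1) g)" using t r by (intro integrable_hit_prob g) auto
    show "AE x in lborel. norm (hit_prob M B r (T n) g x) \<le> hit_prob M B r (t + 1) g x" for n
      unfolding hit_prob_def using mono[OF T(3)] by (auto intro!: AE_I2 finite_measure_mono)
  qed (auto simp: lim)
  then show ?thesis
    unfolding T_def[symmetric] using T(1) by (simp add: expected_sausage_volume_integral g t r)
qed

end

section \<open>The probability of no detection\<close>

lemma (in prob_space) measurable_sigma_gen:
  fixes Y :: "'i \<Rightarrow> 'a \<Rightarrow> 'b::topological_space"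
  assumes "i \<in> I"
  shows "Y i \<in> measurable (sigma (space M) (\<Union>i\<in>I. {Y i -` A \<inter> space M | A. A \<in> sets borel})) borel"
proof (rule measurableI)
  fix A :: "'b set" assume "A \<in> sets borel"
  then show "Y i -` A \<inter> space (sigma (space M) (\<Union>i\<in>I. {Y i -` A \<inter> space M | A. A \<in> sets borel}))
      \<in> sets (sigma (space M) (\<Union>i\<in>I. {Y i -` A \<inter> space M | A. A \<in> sets borel}))"
    using assms by (subst sets_measure_of) (auto simp: space_measure_of_conv intro!: sigma_sets.Basic)
qed simp

text \<open>Membership in a generated sigma-algebra is reduced to measurability for the
  corresponding measurable space, where the closure rules for product spaces apply.\<close>

lemma (in prob_space) vimage_in_sigma_gen:
  assumes f: "f \<in> measurable (sigma (space M) (\<Union>i\<in>I. {Y i -` A \<inter> space M | A. A \<in> sets borel})) N"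
    and A: "A \<in> sets N"
  shows "f -` A \<inter> space M \<in> sigma_gen M I Y"
proof -
  have "sets (sigma (space M) (\<Union>i\<in>I. {Y i -` A \<inter> space M | A. A \<in> sets borel})) = sigma_gen M I Y"
    unfolding sigma_gen_def by (rule sets_measure_of) auto
  then show ?thesis using measurable_sets[OF f A] by (simp add: space_measure_of_conv)
qed

context mobile_nodes
begin

lemma points_vimage:
  assumes "A \<in> sets (PiM {..<m} (\<lambda>_. borel))"
  shows "(\<lambda>\<omega>. \<lambda>i\<in>{..<m}. X i \<omega>) -` A \<inter> space M \<in> sigma_gen M UNIV X"
  by (rule vimage_in_sigma_gen[OF _ assms]) (intro measurable_restrict measurable_sigma_gen, simp)

lemma motions_vimage:
  assumes "A \<in> sets (PiM {..<m} (\<lambda>_. path_space))"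
  shows "(\<lambda>\<omega>. \<lambda>i\<in>{..<m}. \<lambda>t\<in>dyadic_times. \<zeta> i t \<omega>) -` A \<inter> space M \<in> sigma_gen M (UNIV \<times> {0..}) (\<lambda>(i, s). \<zeta> i s)"
proof (rule vimage_in_sigma_gen[OF _ assms], intro measurable_restrict)
  fix i t assume "t \<in> dyadic_times"
  then have "(i, t) \<in> (UNIV :: nat set) \<times> {0..}" by (auto dest: dyadic_times_nonneg)
  from measurable_sigma_gen[OF this, of "\<lambda>(i, s). \<zeta> i s"]
  show "\<zeta> i t \<in> measurable (sigma (space M) (\<Union>p\<in>UNIV \<times> {0..}. {(case p of (i::nat, s) \<Rightarrow> \<zeta> i s) -` A \<inter> space M |A. A \<in> sets borel})) borel"
    by simp
qed

lemma motion_measurable: "0 \<le> t \<Longrightarrow> \<zeta> i t \<in> borel_measurable M"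
  by (rule standard_brownian_motion.measurable_at[OF motions_brownian])

lemma motion_path_measurable: "(\<lambda>\<omega>. \<lambda>t\<in>dyadic_times. \<zeta> i t \<omega>) \<in> measurable M path_space"
  by (rule measurable_dyadic_path) (rule motion_measurable)

text \<open>Independence makes the law of finitely many motions a product; uniqueness of the path
  law lets every factor be that of the reference motion \<open>\<xi>\<close>.\<close>

lemma distr_motions:
  assumes "standard_brownian_motion N \<xi>" "0 < m"
  shows "distr M (PiM {..<m} (\<lambda>_. path_space)) (\<lambda>\<omega>. \<lambda>i\<in>{..<m}. \<lambda>t\<in>dyadic_times. \<zeta> i t \<omega>)
    = PiM {..<m} (\<lambda>_. distr N path_space (\<lambda>\<omega>. \<lambda>t\<in>dyadic_times. \<xi> t \<omega>))"
proof -
  have "indep_vars (\<lambda>_. path_space) (\<lambda>i \<omega>. \<lambda>t\<in>dyadic_times. \<zeta> i t \<omega>) UNIV"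
    unfolding indep_vars_def2
  proof (intro conjI ballI)
    show "indep_sets (\<lambda>i. {(\<lambda>\<omega>. \<lambda>t\<in>dyadic_times. \<zeta> i t \<omega>) -` A \<inter> space M |A. A \<in> sets path_space}) UNIV"
    proof (rule indep_sets_mono_sets[OF motions_indep], safe)
      fix i and A :: "(real \<Rightarrow> 'a) set" assume A: "A \<in> sets path_space"
      show "(\<lambda>\<omega>. \<lambda>t\<in>dyadic_times. \<zeta> i t \<omega>) -` A \<inter> space M \<in> sigma_gen M {0..} (\<zeta> i)"
        by (rule vimage_in_sigma_gen[OF _ A], intro measurable_restrict measurable_sigma_gen)
          (auto dest: dyadic_times_nonneg)
    qed
  qed (rule motion_path_measurable)
  then have "indep_vars (\<lambda>_. path_space) (\<lambda>i \<omega>. \<lambda>t\<in>dyadic_times. \<zeta> i t \<omega>) {..<m}"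
    by (rule indep_vars_subset) simp
  then have "distr M (PiM {..<m} (\<lambda>_. path_space)) (\<lambda>\<omega>. \<lambda>i\<in>{..<m}. \<lambda>t\<in>dyadic_times. \<zeta> i t \<omega>)
    = PiM {..<m} (\<lambda>i. distr M path_space (\<lambda>\<omega>. \<lambda>t\<in>dyadic_times. \<zeta> i t \<omega>))"
    using assms(2) motion_path_measurable by (subst (asm) indep_vars_iff_distr_eq_PiM') auto
  then show ?thesis
    by (simp add: distr_dyadic_path_unique[OF motions_brownian assms(1)])
qed

text \<open>A constant random variable generates the trivial sigma-algebra, which is independent of
  everything. The deterministic case is thereby an instance of the random one.\<close>

lemma deterministic_target:
  assumes "g 0 = 0" "continuous_on {0..} g"
  shows "independent_target M lam X \<zeta> (\<lambda>s _. g s)"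
proof unfold_locales
  let ?F = "sigma_sets (space M) (sigma_gen M UNIV X \<union> sigma_gen M (UNIV \<times> {0..}) (\<lambda>(i, s). \<zeta> i s))"
  have "sigma_gen M UNIV X \<subseteq> events" "sigma_gen M (UNIV \<times> {0..}) (\<lambda>(i, s). \<zeta> i s) \<subseteq> events"
    using motions_indep_points by (auto dest: indep_setD_ev1 indep_setD_ev2)
  then have F: "?F \<subseteq> events" by (intro sets.sigma_sets_subset) auto
  have G: "sigma_gen M {0..} (\<lambda>s _. g s) \<subseteq> {{}, space M}"
  proof
    fix A assume "A \<in> sigma_gen M {0..} (\<lambda>s _. g s)"
    then show "A \<in> {{}, space M}"
      unfolding sigma_gen_def
    proof (induction rule: sigma_sets.induct)
      case (Basic a)
      then show ?case by (auto simp: vimage_const split: if_splits)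
    next
      case (Union a)
      show ?case
      proof (cases "\<exists>i. a i = space M")
        case True
        moreover have "a i \<subseteq> space M" for i using Union.IH[of i] by auto
        ultimately have "(\<Union>i. a i) = space M" by blast
        then show ?thesis by simp
      next
        case False
        then have "a i = {}" for i using Union.IH[of i] by auto
        then show ?thesis by simp
      qed
    qed auto
  qed
  show "indep_set (sigma_gen M {0..} (\<lambda>s _. g s)) ?F"
  proof (rule indep_setI)
    show "sigma_gen M {0..} (\<lambda>s _. g s) \<subseteq> events" using G by auto
    fix a b assume "a \<in> sigma_gen M {0..} (\<lambda>s _. g s)" "b \<in> ?F"
    then have "a = {} \<or> a = space M" "b \<in> events" using F G by auto
    then show "prob (a \<inter> b) = prob a * prob b"
      by (auto simp: prob_space Int_absorb1 dest: sets.sets_into_space)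
  qed (rule F)
qed (use assms in auto)

end

context independent_target
begin

lemma target_measurable:
  assumes "0 \<le> t" shows "g t \<in> borel_measurable M"
proof -
  have "g t -` A \<inter> space M \<in> events" if "A \<in> sets borel" for A
    using indep_setD_ev1[OF target_indep] assms that
    by (auto simp: sigma_gen_def intro!: sigma_sets.Basic)
  then show ?thesis by (intro measurableI) auto
qed

lemma target_path_measurable: "(\<lambda>\<omega>. \<lambda>t\<in>dyadic_times. g t \<omega>) \<in> measurable M path_space"
  by (rule measurable_dyadic_path) (rule target_measurable)

lemma target_vimage:
  assumes "A \<in> sets path_space"
  shows "(\<lambda>\<omega>. \<lambda>t\<in>dyadic_times. g t \<omega>) -` A \<inter> space M \<in> sigma_gen M {0..} g"
  by (rule vimage_in_sigma_gen[OF _ assms], intro measurable_restrict measurable_sigma_gen)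
    (auto dest: dyadic_times_nonneg)

lemma hit_node_measurable:
  "Measurable.pred M (\<lambda>\<omega>. hits r T (\<lambda>s. g s \<omega>) (X i \<omega>) (\<lambda>s. \<zeta> i s \<omega>))"
proof -
  have "Measurable.pred M (\<lambda>\<omega>. hits r T (\<lambda>t\<in>dyadic_times. g t \<omega>) (X i \<omega>) (\<lambda>t\<in>dyadic_times. \<zeta> i t \<omega>))"
    by (intro measurable_hits_path target_path_measurable motion_path_measurable points_measurable)
  then show ?thesis by simp
qed

text \<open>Target path, points and motions have a product law, so the motions can be integrated out
  first. The two sample points on the right act as independent copies: \<open>\<omega>\<close>
  carries the target and \<open>\<omega>'\<close> the initial positions.\<close>

lemma prob_finitely_many_miss:
  assumes N: "standard_brownian_motion N \<xi>" and m: "0 < m"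
  shows "ennreal (prob {\<omega> \<in> space M. \<forall>i<m. \<not> hits r T (\<lambda>s. g s \<omega>) (X i \<omega>) (\<lambda>s. \<zeta> i s \<omega>)})
    = (\<integral>\<^sup>+\<omega>. ennreal (expectation (\<lambda>\<omega>'. \<Prod>i<m. 1 - hit_prob N \<xi> r T (\<lambda>s. g s \<omega>) (X i \<omega>'))) \<partial>M)"
    and "(\<lambda>\<omega>. expectation (\<lambda>\<omega>'. \<Prod>i<m. 1 - hit_prob N \<xi> r T (\<lambda>s. g s \<omega>) (X i \<omega>'))) \<in> borel_measurable M"
proof -
  interpret N: standard_brownian_motion N \<xi> by fact
  let ?P = "path_space :: (real \<Rightarrow> 'a) measure"
  let ?PX = "PiM {..<m} (\<lambda>_. borel) :: (nat \<Rightarrow> 'a) measure"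
  let ?PZ = "PiM {..<m} (\<lambda>_. path_space) :: (nat \<Rightarrow> real \<Rightarrow> 'a) measure"
  define G where "G \<omega> = (\<lambda>t\<in>dyadic_times. g t \<omega>)" for \<omega>
  define XX where "XX \<omega> = (\<lambda>i\<in>{..<m}. X i \<omega>)" for \<omega>
  define Z where "Z \<omega> = (\<lambda>i\<in>{..<m}. \<lambda>t\<in>dyadic_times. \<zeta> i t \<omega>)" for \<omega>
  define L where "L = distr N path_space (\<lambda>\<omega>. \<lambda>t\<in>dyadic_times. \<xi> t \<omega>)"
  have G[measurable]: "G \<in> measurable M ?P" unfolding G_def[abs_def] by (rule target_path_measurable)
  have XX[measurable]: "XX \<in> measurable M ?PX"
    unfolding XX_def[abs_def] by (intro measurable_restrict points_measurable)
  have Z[measurable]: "Z \<in> measurable M ?PZ"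
    unfolding Z_def[abs_def] by (intro measurable_restrict[of _ _ _ "\<lambda>_. path_space"] motion_path_measurable)
  interpret L: prob_space L unfolding L_def by (rule N.prob_space_distr) measurable
  have sL[measurable_cong, simp]: "sets L = sets ?P" by (simp add: L_def)
  interpret LZ: product_prob_space "\<lambda>_. L" "{..<m}" by unfold_locales
  interpret LZ: finite_product_prob_space "\<lambda>_. L" "{..<m}" by unfold_locales simp
  interpret DX: prob_space "distr M ?PX XX" by (rule prob_space_distr) measurable
  have distrZ: "distr M ?PZ Z = PiM {..<m} (\<lambda>_. L)"
    unfolding Z_def[abs_def] L_def by (rule distr_motions[OF N m])
  have distrXZ: "distr M (?PX \<Otimes>\<^sub>M ?PZ) (\<lambda>\<omega>. (XX \<omega>, Z \<omega>)) = distr M ?PX XX \<Otimes>\<^sub>M PiM {..<m} (\<lambda>_. L)"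
    unfolding distrZ[symmetric]
    by (rule distr_pair_indep_set[OF XX Z motions_indep_points])
      (simp_all add: XX_def[abs_def] Z_def[abs_def] points_vimage motions_vimage)
  have XZ[measurable]: "(\<lambda>\<omega>. (XX \<omega>, Z \<omega>)) \<in> measurable M (?PX \<Otimes>\<^sub>M ?PZ)" by measurable
  \<comment> \<open>Target against the pair of points and motions: the independence assumed is from
    the sigma-algebra that both generate together.\<close>
  have distrG: "distr M (?P \<Otimes>\<^sub>M (?PX \<Otimes>\<^sub>M ?PZ)) (\<lambda>\<omega>. (G \<omega>, XX \<omega>, Z \<omega>))
      = distr M ?P G \<Otimes>\<^sub>M distr M (?PX \<Otimes>\<^sub>M ?PZ) (\<lambda>\<omega>. (XX \<omega>, Z \<omega>))"
  proof (rule distr_pair_indep_set[OF G XZ target_indep])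
    show "G -` A \<inter> space M \<in> sigma_gen M {0..} g" if "A \<in> sets ?P" for A
      unfolding G_def[abs_def] by (rule target_vimage[OF that])
    fix A assume A: "A \<in> sets (?PX \<Otimes>\<^sub>M ?PZ)"
    let ?S = "sigma_gen M UNIV X \<union> sigma_gen M (UNIV \<times> {0..}) (\<lambda>(i, s). \<zeta> i s)"
    have S: "?S \<subseteq> Pow (space M)"
      using motions_indep_points sets.sets_into_space
      by (blast dest: indep_setD_ev1 indep_setD_ev2)
    have sS: "sets (sigma (space M) ?S) = sigma_sets (space M) ?S" using S by (rule sets_measure_of)
    have "XX \<in> measurable (sigma (space M) ?S) ?PX"
      using measurable_space[OF XX] points_vimage[of _ m]
      by (intro measurableI) (auto simp: sS space_measure_of_conv XX_def[abs_def] intro!: sigma_sets.Basic)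
    moreover have "Z \<in> measurable (sigma (space M) ?S) ?PZ"
      using measurable_space[OF Z] motions_vimage[of _ m]
      by (intro measurableI) (auto simp: sS space_measure_of_conv Z_def[abs_def] intro!: sigma_sets.Basic)
    ultimately have "(\<lambda>\<omega>. (XX \<omega>, Z \<omega>)) \<in> measurable (sigma (space M) ?S) (?PX \<Otimes>\<^sub>M ?PZ)"
      by (rule measurable_Pair)
    from measurable_sets[OF this A]
    show "(\<lambda>\<omega>. (XX \<omega>, Z \<omega>)) -` A \<inter> space M \<in> sigma_sets (space M) ?S" by (simp add: sS space_measure_of_conv)
  qed
  define f where "f a = (indicator {(w, x, z). \<forall>i<m. \<not> hits r T w (x i) (z i)} a :: ennreal)"
    for a :: "(real \<Rightarrow> 'a) \<times> (nat \<Rightarrow> 'a) \<times> (nat \<Rightarrow> real \<Rightarrow> 'a)"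
  have f[measurable]: "f \<in> borel_measurable (?P \<Otimes>\<^sub>M (?PX \<Otimes>\<^sub>M ?PZ))"
  proof -
    have "Measurable.pred (?P \<Otimes>\<^sub>M (?PX \<Otimes>\<^sub>M ?PZ)) (\<lambda>a. hits r T (fst a) (fst (snd a) i) (snd (snd a) i))" if "i < m" for i
      using that
      by (intro measurable_hits_path measurable_fst
          measurable_compose[OF measurable_compose[OF measurable_snd measurable_fst]]
          measurable_compose[OF measurable_compose[OF measurable_snd measurable_snd]]
          measurable_component_singleton) auto
    then show ?thesis
      unfolding f_def[abs_def] split_beta
      by (intro borel_measurable_indicator' pred_intros_logic pred_intros_countable) auto
  qed
  \<comment> \<open>With target and positions frozen, missing the target is a condition on each
    motion separately, so the event is a rectangle and its probability a product.\<close>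
  have inner: "(\<integral>\<^sup>+z. f (G \<omega>, XX \<omega>', z) \<partial>PiM {..<m} (\<lambda>_. L))
      = ennreal (\<Prod>i<m. 1 - hit_prob N \<xi> r T (\<lambda>s. g s \<omega>) (X i \<omega>'))" (is "?l = ?r") for \<omega> \<omega>'
  proof -
    define E where "E i = {z \<in> space ?P. \<not> hits r T (G \<omega>) (X i \<omega>') z}" for i
    have hm[measurable]: "Measurable.pred ?P (\<lambda>z. hits r T (G \<omega>) (X i \<omega>') z)" for i
      unfolding G_def by (intro measurable_hits_path measurable_const restrict_path_in_space) auto
    have E: "E i \<in> sets L" for i unfolding E_def by simp
    have PE: "emeasure L (E i) = ennreal (1 - hit_prob N \<xi> r T (\<lambda>s. g s \<omega>) (X i \<omega>'))" for i
    proof -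
      have "L.prob (E i) = 1 - L.prob {z \<in> space L. hits r T (G \<omega>) (X i \<omega>') z}"
        using L.prob_neg[of "\<lambda>z. hits r T (G \<omega>) (X i \<omega>') z"] by (simp add: E_def L_def)
      then show ?thesis
        unfolding L.emeasure_eq_measure by (simp add: N.hit_prob_eq_distr L_def G_def)
    qed
    have "?l = (\<integral>\<^sup>+z. indicator (Pi\<^sub>E {..<m} E) z \<partial>PiM {..<m} (\<lambda>_. L))"
      by (intro nn_integral_cong) (auto simp: f_def E_def XX_def indicator_def space_PiM PiE_iff L_def)
    also have "\<dots> = (\<Prod>i<m. emeasure L (E i))"
      using E by (subst nn_integral_indicator) (auto simp: LZ.emeasure_PiM)
    also have "\<dots> = ?r"
      unfolding PE using N.prob_le_1 by (intro prod_ennreal) (simp add: hit_prob_def)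
    finally show ?thesis .
  qed
  have bnd: "0 \<le> hit_prob N \<xi> r T w x" "hit_prob N \<xi> r T w x \<le> 1" for w x
    by (auto simp: hit_prob_def)
  have mid: "(\<integral>\<^sup>+x. \<integral>\<^sup>+z. f (G \<omega>, x, z) \<partial>PiM {..<m} (\<lambda>_. L) \<partial>distr M ?PX XX)
      = ennreal (expectation (\<lambda>\<omega>'. \<Prod>i<m. 1 - hit_prob N \<xi> r T (\<lambda>s. g s \<omega>) (X i \<omega>')))" (is "?l = ennreal (expectation ?h)")
    if "\<omega> \<in> space M" for \<omega>
  proof -
    have Gs: "G \<omega> \<in> space ?P" unfolding G_def by (rule restrict_path_in_space)
    have [measurable]: "(\<lambda>a. f (G \<omega>, a)) \<in> borel_measurable (?PX \<Otimes>\<^sub>M PiM {..<m} (\<lambda>_. L))"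
      using measurable_compose[OF measurable_Pair1'[OF Gs] f]
      by (simp cong: measurable_cong_sets sets_pair_measure_cong sets_PiM_cong)
    have "?l = (\<integral>\<^sup>+\<omega>'. \<integral>\<^sup>+z. f (G \<omega>, XX \<omega>', z) \<partial>PiM {..<m} (\<lambda>_. L) \<partial>M)"
      by (subst nn_integral_distr) measurable
    also have "\<dots> = (\<integral>\<^sup>+\<omega>'. ennreal (?h \<omega>') \<partial>M)"
      by (simp only: inner)
    also have "\<dots> = ennreal (expectation ?h)"
    proof (rule nn_integral_eq_integral)
      show "integrable M ?h"
      proof (rule integrable_const_bound[where B=1])
        show "?h \<in> borel_measurable M"
          by (intro borel_measurable_prod borel_measurable_diff borel_measurable_const
              measurable_compose[OF points_measurable N.hit_prob_measurable])
      qed (use bnd in \<open>auto simp: prod_nonneg intro!: prod_le_1\<close>)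
    qed (use bnd in \<open>auto intro!: prod_nonneg\<close>)
    finally show ?thesis .
  qed
  interpret Q: pair_sigma_finite "distr M ?PX XX" "PiM {..<m} (\<lambda>_. L)" ..
  have fq: "f \<in> borel_measurable (?P \<Otimes>\<^sub>M (distr M ?PX XX \<Otimes>\<^sub>M PiM {..<m} (\<lambda>_. L)))"
    using f by (simp cong: measurable_cong_sets sets_pair_measure_cong sets_PiM_cong)
  have snd: "(\<integral>\<^sup>+a. f (G \<omega>, a) \<partial>(distr M ?PX XX \<Otimes>\<^sub>M PiM {..<m} (\<lambda>_. L)))
      = ennreal (expectation (\<lambda>\<omega>'. \<Prod>i<m. 1 - hit_prob N \<xi> r T (\<lambda>s. g s \<omega>) (X i \<omega>')))" if "\<omega> \<in> space M" for \<omega>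
  proof -
    have Gs: "G \<omega> \<in> space ?P" unfolding G_def by (rule restrict_path_in_space)
    have "(\<lambda>a. f (G \<omega>, a)) \<in> borel_measurable (distr M ?PX XX \<Otimes>\<^sub>M PiM {..<m} (\<lambda>_. L))"
      by (rule measurable_compose[OF measurable_Pair1'[OF Gs] fq])
    from LZ.nn_integral_fst[OF this]
    show ?thesis unfolding mid[OF that, symmetric] by simp
  qed
  have mI: "(\<lambda>w. \<integral>\<^sup>+a. f (w, a) \<partial>(distr M ?PX XX \<Otimes>\<^sub>M PiM {..<m} (\<lambda>_. L))) \<in> borel_measurable ?P"
    using fq by (rule Q.P.borel_measurable_nn_integral_fst)
  have e0: "0 \<le> expectation (\<lambda>\<omega>'. \<Prod>i<m. 1 - hit_prob N \<xi> r T (\<lambda>s. g s \<omega>) (X i \<omega>'))" for \<omega>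
    using bnd by (intro integral_nonneg_AE AE_I2 prod_nonneg) auto
  have "(\<lambda>\<omega>. enn2real (\<integral>\<^sup>+a. f (G \<omega>, a) \<partial>(distr M ?PX XX \<Otimes>\<^sub>M PiM {..<m} (\<lambda>_. L)))) \<in> borel_measurable M"
    using mI by measurable
  then show "(\<lambda>\<omega>. expectation (\<lambda>\<omega>'. \<Prod>i<m. 1 - hit_prob N \<xi> r T (\<lambda>s. g s \<omega>) (X i \<omega>'))) \<in> borel_measurable M"
    using bnd by (subst (asm) measurable_cong[where g="\<lambda>\<omega>. expectation (\<lambda>\<omega>'. \<Prod>i<m. 1 - hit_prob N \<xi> r T (\<lambda>s. g s \<omega>) (X i \<omega>'))"])
      (simp_all add: snd e0)
  have ev: "{\<omega> \<in> space M. \<forall>i<m. \<not> hits r T (\<lambda>s. g s \<omega>) (X i \<omega>) (\<lambda>s. \<zeta> i s \<omega>)} \<in> events"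
  proof -
    note [measurable] = hit_node_measurable
    show ?thesis by measurable
  qed
  have "ennreal (prob {\<omega> \<in> space M. \<forall>i<m. \<not> hits r T (\<lambda>s. g s \<omega>) (X i \<omega>) (\<lambda>s. \<zeta> i s \<omega>)})
      = (\<integral>\<^sup>+\<omega>. f (G \<omega>, XX \<omega>, Z \<omega>) \<partial>M)"
    unfolding emeasure_eq_measure[symmetric] nn_integral_indicator[OF ev, symmetric]
    by (intro nn_integral_cong) (auto simp: f_def G_def XX_def Z_def indicator_def)
  also have "\<dots> = (\<integral>\<^sup>+a. f a \<partial>distr M (?P \<Otimes>\<^sub>M (?PX \<Otimes>\<^sub>M ?PZ)) (\<lambda>\<omega>. (G \<omega>, XX \<omega>, Z \<omega>)))"
    by (subst nn_integral_distr) auto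
  also have "\<dots> = (\<integral>\<^sup>+w. \<integral>\<^sup>+a. f (w, a) \<partial>(distr M ?PX XX \<Otimes>\<^sub>M PiM {..<m} (\<lambda>_. L)) \<partial>distr M ?P G)"
    unfolding distrG distrXZ using fq by (subst Q.P.nn_integral_fst) (auto cong: measurable_cong_sets sets_pair_measure_cong)
  also have "\<dots> = (\<integral>\<^sup>+\<omega>. \<integral>\<^sup>+a. f (G \<omega>, a) \<partial>(distr M ?PX XX \<Otimes>\<^sub>M PiM {..<m} (\<lambda>_. L)) \<partial>M)"
    using mI by (subst nn_integral_distr) auto
  also have "\<dots> = (\<integral>\<^sup>+\<omega>. ennreal (expectation (\<lambda>\<omega>'. \<Prod>i<m. 1 - hit_prob N \<xi> r T (\<lambda>s. g s \<omega>) (X i \<omega>'))) \<partial>M)"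
    by (intro nn_integral_cong snd)
  finally show "ennreal (prob {\<omega> \<in> space M. \<forall>i<m. \<not> hits r T (\<lambda>s. g s \<omega>) (X i \<omega>) (\<lambda>s. \<zeta> i s \<omega>)})
    = (\<integral>\<^sup>+\<omega>. ennreal (expectation (\<lambda>\<omega>'. \<Prod>i<m. 1 - hit_prob N \<xi> r T (\<lambda>s. g s \<omega>) (X i \<omega>'))) \<partial>M)" .
qed

text \<open>All nodes are reached in the limit of finitely many: continuity from above on one side,
  on the other the Laplace functional for each fixed target path with \<open>p\<close> the hitting
  probability, whose integral is the expected volume.\<close>

lemma prob_miss:
  assumes N: "standard_brownian_motion N \<xi>" and lam: "0 \<le> lam" and r: "0 \<le> r" and T: "0 \<le> T"
  shows "prob {\<omega> \<in> space M. \<forall>i. \<not> hits r T (\<lambda>s. g s \<omega>) (X i \<omega>) (\<lambda>s. \<zeta> i s \<omega>)}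
      = expectation (\<lambda>\<omega>. exp (- (lam * expected_sausage_volume N \<xi> r (\<lambda>s. g s \<omega>) T)))"
    and "(\<lambda>\<omega>. exp (- (lam * expected_sausage_volume N \<xi> r (\<lambda>s. g s \<omega>) T))) \<in> borel_measurable M"
proof -
  interpret N: standard_brownian_motion N \<xi> by fact
  let ?v = "\<lambda>\<omega>. exp (- (lam * expected_sausage_volume N \<xi> r (\<lambda>s. g s \<omega>) T))"
  \<comment> \<open>Indexed by \<open>Suc m\<close> because the finite case is stated for at least
    one node.\<close>
  define h where "h m \<omega> = expectation (\<lambda>\<omega>'. \<Prod>i<Suc m. 1 - hit_prob N \<xi> r T (\<lambda>s. g s \<omega>) (X i \<omega>'))" for m \<omega>
  have h[measurable]: "h m \<in> borel_measurable M" for m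
    unfolding h_def[abs_def] by (rule prob_finitely_many_miss(2)[OF N]) simp
  have bnd: "0 \<le> hit_prob N \<xi> r T w x" "hit_prob N \<xi> r T w x \<le> 1" for w x
    by (auto simp: hit_prob_def)
  have h0: "0 \<le> h m \<omega>" for m \<omega>
    unfolding h_def using bnd by (intro integral_nonneg_AE AE_I2 prod_nonneg) auto
  have h1: "h m \<omega> \<le> 1" for m \<omega>
    unfolding h_def
  proof (rule integral_le_const)
    show "integrable M (\<lambda>\<omega>'. \<Prod>i<Suc m. 1 - hit_prob N \<xi> r T (\<lambda>s. g s \<omega>) (X i \<omega>'))"
    proof (rule integrable_const_bound[where B=1])
      show "(\<lambda>\<omega>'. \<Prod>i<Suc m. 1 - hit_prob N \<xi> r T (\<lambda>s. g s \<omega>) (X i \<omega>')) \<in> borel_measurable M"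
        by (intro borel_measurable_prod borel_measurable_diff borel_measurable_const
            measurable_compose[OF points_measurable N.hit_prob_measurable])
      show "AE \<omega>' in M. norm (\<Prod>i<Suc m. 1 - hit_prob N \<xi> r T (\<lambda>s. g s \<omega>) (X i \<omega>')) \<le> 1"
        unfolding real_norm_def using bnd by (intro AE_I2, subst abs_of_nonneg) (auto intro!: prod_nonneg prod_le_1 simp del: prod.lessThan_Suc)
    qed
    show "AE \<omega>' in M. (\<Prod>i<Suc m. 1 - hit_prob N \<xi> r T (\<lambda>s. g s \<omega>) (X i \<omega>')) \<le> 1"
      using bnd by (intro AE_I2 prod_le_1) auto
  qed
  have hlim: "(\<lambda>m. h m \<omega>) \<longlonglongrightarrow> ?v \<omega>" if "\<omega> \<in> space M" for \<omega>
    unfolding h_def N.expected_sausage_volume_integral[OF target_continuous[OF that] T r]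
    by (rule LIMSEQ_Suc[OF laplace_functional[OF lam bnd N.integrable_hit_prob[OF target_continuous[OF that] T r]]])
  show vm: "?v \<in> borel_measurable M"
    by (rule borel_measurable_LIMSEQ_real[where u=h]) (auto simp: hlim)
  have P: "prob {\<omega> \<in> space M. \<forall>i<Suc m. \<not> hits r T (\<lambda>s. g s \<omega>) (X i \<omega>) (\<lambda>s. \<zeta> i s \<omega>)} = expectation (h m)" for m
  proof -
    have "ennreal (prob {\<omega> \<in> space M. \<forall>i<Suc m. \<not> hits r T (\<lambda>s. g s \<omega>) (X i \<omega>) (\<lambda>s. \<zeta> i s \<omega>)})
        = (\<integral>\<^sup>+\<omega>. ennreal (h m \<omega>) \<partial>M)"
      unfolding h_def by (rule prob_finitely_many_miss(1)[OF N]) simp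
    also have "\<dots> = ennreal (expectation (h m))"
      using h0 h1 by (intro nn_integral_eq_integral integrable_const_bound[where B=1]) auto
    finally show ?thesis
      using h0 by (subst (asm) ennreal_inj) (auto intro!: integral_nonneg_AE)
  qed
  have L1: "(\<lambda>m. expectation (h m)) \<longlonglongrightarrow> expectation ?v"
    using h0 h1 vm by (intro integral_dominated_convergence[where w="\<lambda>_. 1"]) (auto simp: hlim)
  have L2: "(\<lambda>m. expectation (h m)) \<longlonglongrightarrow> prob (\<Inter>m. {\<omega> \<in> space M. \<forall>i<Suc m. \<not> hits r T (\<lambda>s. g s \<omega>) (X i \<omega>) (\<lambda>s. \<zeta> i s \<omega>)})"
    unfolding P[symmetric]
  proof (rule finite_Lim_measure_decseq)
    note [measurable] = hit_node_measurable
    show "range (\<lambda>m. {\<omega> \<in> space M. \<forall>i<Suc m. \<not> hits r T (\<lambda>s. g s \<omega>) (X i \<omega>) (\<lambda>s. \<zeta> i s \<omega>)}) \<subseteq> events"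
      by (rule image_subsetI) measurable
    show "decseq (\<lambda>m. {\<omega> \<in> space M. \<forall>i<Suc m. \<not> hits r T (\<lambda>s. g s \<omega>) (X i \<omega>) (\<lambda>s. \<zeta> i s \<omega>)})"
      by (rule decseq_SucI) auto
  qed
  have eq: "(\<Inter>m. {\<omega> \<in> space M. \<forall>i<Suc m. \<not> hits r T (\<lambda>s. g s \<omega>) (X i \<omega>) (\<lambda>s. \<zeta> i s \<omega>)})
      = {\<omega> \<in> space M. \<forall>i. \<not> hits r T (\<lambda>s. g s \<omega>) (X i \<omega>) (\<lambda>s. \<zeta> i s \<omega>)}"
    by auto
  show "prob {\<omega> \<in> space M. \<forall>i. \<not> hits r T (\<lambda>s. g s \<omega>) (X i \<omega>) (\<lambda>s. \<zeta> i s \<omega>)} = expectation ?v"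
    using LIMSEQ_unique[OF L2 L1] unfolding eq .
qed

text \<open>A strict inequality for an infimum requires a gap: the detection times must all lie
  beyond some \<open>t + 1 / Suc n\<close>.\<close>

lemma detection_time_gt_iff:
  assumes w: "\<omega> \<in> space M" and t: "0 \<le> t"
  shows "detection_time X \<zeta> r g \<omega> > ereal t
    \<longleftrightarrow> (\<exists>n. \<forall>i. \<not> hits r (t + 1 / real (Suc n)) (\<lambda>s. g s \<omega>) (X i \<omega>) (\<lambda>s. \<zeta> i s \<omega>))"
proof -
  define S where "S = {t. 0 \<le> t \<and> g t \<omega> \<in> (\<Union>i. cball (X i \<omega> + \<zeta> i t \<omega>) r)}"
  have T: "0 \<le> t + 1 / real (Suc n)" for n using t by simp
  have miss: "(\<forall>i. \<not> hits r (t + 1 / real (Suc n)) (\<lambda>s. g s \<omega>) (X i \<omega>) (\<lambda>s. \<zeta> i s \<omega>))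
      \<longleftrightarrow> (\<forall>s\<in>S. t + 1 / real (Suc n) < s)" for n
  proof -
    have "(s \<in> S) \<longleftrightarrow> 0 \<le> s \<and> (\<exists>i. norm (g s \<omega> - \<zeta> i s \<omega> - X i \<omega>) \<le> r)" for s
      by (auto simp: S_def dist_norm norm_minus_commute algebra_simps)
    then show ?thesis
      unfolding hits_iff[OF T target_continuous[OF w] standard_brownian_motion.continuous_paths[OF motions_brownian w]]
        Ball_def Bex_def atLeastAtMost_iff not_le[symmetric]
      by blast
  qed
  have "detection_time X \<zeta> r g \<omega> > ereal t \<longleftrightarrow> (\<exists>n. \<forall>s\<in>S. t + 1 / real (Suc n) < s)"
  proof
    assume "detection_time X \<zeta> r g \<omega> > ereal t"
    then obtain y where y: "ereal t < ereal y" "ereal y < Inf (ereal ` S)"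
      unfolding detection_time_def S_def[symmetric] using ereal_dense2 by blast
    obtain n where "inverse (real (Suc n)) < y - t" using reals_Archimedean[of "y - t"] y by auto
    then have n: "t + 1 / real (Suc n) < y" by (simp add: inverse_eq_divide)
    have "t + 1 / real (Suc n) < s" if "s \<in> S" for s
    proof -
      have "Inf (ereal ` S) \<le> ereal s" using that by (intro Inf_lower) auto
      then have "y < s" using y(2) by (simp flip: less_ereal.simps(1))
      with n show ?thesis by linarith
    qed
    then show "\<exists>n. \<forall>s\<in>S. t + 1 / real (Suc n) < s" by blast
  next
    assume "\<exists>n. \<forall>s\<in>S. t + 1 / real (Suc n) < s"
    then obtain n where n: "\<And>s. s \<in> S \<Longrightarrow> t + 1 / real (Suc n) < s" by blast
    have "ereal t < ereal (t + 1 / real (Suc n))" by simp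
    also have "\<dots> \<le> Inf (ereal ` S)" using n by (intro Inf_greatest) (auto intro: less_imp_le)
    finally show "detection_time X \<zeta> r g \<omega> > ereal t"
      unfolding detection_time_def S_def[symmetric] .
  qed
  then show ?thesis unfolding miss .
qed

text \<open>The events of no hit up to \<open>t + 1 / Suc n\<close> increase to the event in
  question, and their probabilities converge by right continuity of the expected volume along each
  target path.\<close>

theorem prob_undetected:
  assumes N: "standard_brownian_motion N \<xi>" and lam: "0 \<le> lam" and r: "0 \<le> r" and t: "0 \<le> t"
  shows "prob {\<omega> \<in> space M. detection_time X \<zeta> r g \<omega> > ereal t}
    = expectation (\<lambda>\<omega>. exp (- (lam * expected_sausage_volume N \<xi> r (\<lambda>s. g s \<omega>) t)))"
proof -
  interpret N: standard_brownian_motion N \<xi> by fact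
  define E where "E n = {\<omega> \<in> space M. \<forall>i. \<not> hits r (t + 1 / real (Suc n)) (\<lambda>s. g s \<omega>) (X i \<omega>) (\<lambda>s. \<zeta> i s \<omega>)}" for n
  have T: "0 \<le> t + 1 / real (Suc n)" for n using t by simp
  have L1: "(\<lambda>n. prob (E n)) \<longlonglongrightarrow> prob (\<Union>n. E n)"
  proof (rule finite_Lim_measure_incseq)
    note [measurable] = hit_node_measurable
    show "range E \<subseteq> events" unfolding E_def[abs_def] by (rule image_subsetI) measurable
    show "incseq E"
    proof (rule incseq_SucI)
      fix n
      have "1 / real (Suc (Suc n)) \<le> 1 / real (Suc n)" by (intro divide_left_mono) auto
      then show "E n \<subseteq> E (Suc n)"
        unfolding E_def hits_def
        by (auto simp del: of_nat_Suc) (meson atLeastAtMost_iff IntD1 IntD2 IntI add_left_mono order_trans)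
    qed
  qed
  have eq: "(\<Union>n. E n) = {\<omega> \<in> space M. detection_time X \<zeta> r g \<omega> > ereal t}"
    using detection_time_gt_iff[OF _ t] by (auto simp: E_def)
  have L2: "(\<lambda>n. prob (E n)) \<longlonglongrightarrow> expectation (\<lambda>\<omega>. exp (- (lam * expected_sausage_volume N \<xi> r (\<lambda>s. g s \<omega>) t)))"
    unfolding E_def prob_miss(1)[OF N lam r T]
    by (intro integral_dominated_convergence[where w="\<lambda>_. 1"] prob_miss(2)[OF N lam r] t T AE_I2
        tendsto_intros N.expected_sausage_volume_right_continuous target_continuous r)
      (auto simp: lam N.expected_sausage_volume_nonneg)
  show ?thesis using LIMSEQ_unique[OF L1 L2] unfolding eq .
qed

end

section \<open>Confinement of Brownian motion\<close>

lemma distr_gauss_scaleR: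
  assumes s: "0 < s"
  shows "distr (gauss 1) borel (\<lambda>y::'a::euclidean_space. sqrt s *\<^sub>R y) = gauss s"
proof -
  let ?f = "\<lambda>s x::'a. ennreal (\<Prod>b\<in>Basis. normal_density 0 (sqrt s) (x \<bullet> b))"
  have c: "sqrt s \<noteq> 0" using s by simp
  have f: "?f 1 x = ennreal (sqrt s ^ DIM('a)) * ?f s (sqrt s *\<^sub>R x)" for x
  proof -
    have "(\<Prod>b\<in>Basis. normal_density 0 (sqrt s) (sqrt s *\<^sub>R x \<bullet> b)) * sqrt s ^ DIM('a)
        = (\<Prod>b\<in>Basis. normal_density 0 (sqrt s) (sqrt s *\<^sub>R x \<bullet> b) * sqrt s)"
      by (simp add: prod.distrib)
    also have "\<dots> = (\<Prod>b\<in>Basis. normal_density 0 (sqrt 1) (x \<bullet> b))"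
      using s by (intro prod.cong refl) (simp add: normal_density_def real_sqrt_mult power_mult_distrib)
    finally show ?thesis using s by (simp add: ennreal_mult[symmetric] prod_nonneg mult.commute)
  qed
  have "gauss s = density (density (distr lborel borel (\<lambda>x. 0 + sqrt s *\<^sub>R x)) (\<lambda>_. ennreal (\<bar>sqrt s\<bar> ^ DIM('a)))) (?f s)"
    unfolding gauss_def using lborel_affine[OF c, of "0::'a"] by simp
  also have "\<dots> = density (distr lborel borel (\<lambda>x. sqrt s *\<^sub>R x)) (\<lambda>x. ennreal (sqrt s ^ DIM('a)) * ?f s x)"
    using s by (subst density_density_eq) auto
  also have "\<dots> = distr (density lborel (\<lambda>x. ennreal (sqrt s ^ DIM('a)) * ?f s (sqrt s *\<^sub>R x))) borel (\<lambda>x. sqrt s *\<^sub>R x)"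
    by (subst density_distr) auto
  also have "\<dots> = distr (gauss 1) borel (\<lambda>x. sqrt s *\<^sub>R x)"
    by (simp only: gauss_def f[symmetric])
  finally show ?thesis ..
qed

lemma
  fixes F :: "'a::euclidean_space \<Rightarrow> real \<Rightarrow> real"
  assumes F: "\<And>b. b \<in> Basis \<Longrightarrow> integrable (density lborel std_normal_density) (F b)"
  shows integrable_gauss_prod: "integrable (gauss 1) (\<lambda>y. \<Prod>b\<in>Basis. F b (y \<bullet> b))"
    and integral_gauss_prod: "(\<integral>y. (\<Prod>b\<in>Basis. F b (y \<bullet> b)) \<partial>gauss 1)
      = (\<Prod>b\<in>Basis. \<integral>x. F b x \<partial>density lborel std_normal_density)"
proof -
  interpret N: prob_space "density lborel std_normal_density" by (rule prob_space_normal_density) simp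
  interpret C: product_sigma_finite "\<lambda>_::'a. density lborel std_normal_density" by unfold_locales
  have [measurable]: "F b \<in> borel_measurable borel" if "b \<in> Basis" for b using F[OF that] by auto
  have m: "(\<lambda>y. \<Prod>b\<in>Basis. F b (y \<bullet> b)) \<in> borel_measurable borel" by measurable
  have g: "gauss 1 = distr (PiM (Basis::'a set) (\<lambda>_. density lborel std_normal_density)) borel (\<lambda>f. \<Sum>b\<in>Basis. f b *\<^sub>R b)"
    using gauss_eq_distr_PiM[of 1, where 'a='a] by simp
  have e: "(\<Prod>b\<in>Basis. F b ((\<Sum>b\<in>Basis. f b *\<^sub>R b) \<bullet> b)) = (\<Prod>b\<in>Basis. F b (f b))" for f
    by (intro prod.cong) auto
  show "integrable (gauss 1) (\<lambda>y. \<Prod>b\<in>Basis. F b (y \<bullet> b))"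
    unfolding g using m C.product_integrable_prod[OF finite_Basis F] by (subst integrable_distr_eq) (auto simp: e)
  show "(\<integral>y. (\<Prod>b\<in>Basis. F b (y \<bullet> b)) \<partial>gauss 1)
      = (\<Prod>b\<in>Basis. \<integral>x. F b x \<partial>density lborel std_normal_density)"
    unfolding g using m C.product_integral_prod[OF finite_Basis F] by (subst integral_distr) (auto simp: e)
qed

lemma std_normal_moments:
  shows "integrable (density lborel std_normal_density) (\<lambda>x. x ^ k)"
    and "integrable (density lborel std_normal_density) (\<lambda>x. \<bar>x\<bar> ^ k)"
    and "(\<integral>x. x \<partial>density lborel std_normal_density) = 0"
    and "(\<integral>x. x\<^sup>2 \<partial>density lborel std_normal_density) = 1"
  using integrable_std_normal_moment[of k] integrable_std_normal_moment_abs[of k]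
    integral_std_normal_moment_odd[of 0] integral_std_normal_moment_even[of 1]
  by (auto simp: integrable_real_density integral_real_density fact_numeral)

lemma integrable_gauss_coord_power:
  assumes "b \<in> Basis"
  shows "integrable (gauss 1) (\<lambda>y::'a::euclidean_space. \<bar>y \<bullet> b\<bar> ^ k)"
proof -
  interpret N: prob_space "density lborel std_normal_density" by (rule prob_space_normal_density) simp
  have "integrable (gauss 1) (\<lambda>y::'a. \<Prod>i\<in>Basis. if i = b then \<bar>y \<bullet> i\<bar> ^ k else 1)"
  proof (rule integrable_gauss_prod[of "\<lambda>i x. if i = b then \<bar>x\<bar> ^ k else 1"])
    show "integrable (density lborel std_normal_density) (\<lambda>x. if i = b then \<bar>x\<bar> ^ k else 1)" for i
      using std_normal_moments(2) by (cases "i = b") auto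
  qed
  then show ?thesis using assms by (simp add: prod.delta)
qed

lemma
  fixes b b' :: "'a::euclidean_space"
  assumes b: "b \<in> Basis" "b' \<in> Basis"
  shows integrable_gauss_coord2: "integrable (gauss 1) (\<lambda>y. (y \<bullet> b) * (y \<bullet> b'))"
    and integral_gauss_coord2: "(\<integral>y. (y \<bullet> b) * (y \<bullet> b') \<partial>gauss 1) = (if b = b' then 1 else 0)"
proof -
  interpret N: prob_space "density lborel std_normal_density" by (rule prob_space_normal_density) simp
  \<comment> \<open>The product of two coordinates, written as a product over all coordinates; if
    \<open>b = b'\<close> the factor for that coordinate is a square, all the others are 1.\<close>
  define F where "F i x = (if i = b then x else 1) * (if i = b' then x else 1)" for i :: 'a and x :: real
  have F: "integrable (density lborel std_normal_density) (F i)" for i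
    using std_normal_moments(1)[of 1] std_normal_moments(1)[of 2]
    by (cases "i = b"; cases "i = b'") (auto simp: F_def[abs_def] power2_eq_square)
  have e: "(\<Prod>i\<in>Basis. F i (y \<bullet> i)) = (y \<bullet> b) * (y \<bullet> b')" for y
    using b by (simp add: F_def prod.distrib prod.delta)
  show "integrable (gauss 1) (\<lambda>y. (y \<bullet> b) * (y \<bullet> b'))"
    using integrable_gauss_prod[of F, OF F] unfolding e .
  have "(\<integral>y. (y \<bullet> b) * (y \<bullet> b') \<partial>gauss 1) = (\<Prod>i\<in>Basis. \<integral>x. F i x \<partial>density lborel std_normal_density)"
    using integral_gauss_prod[of F, OF F] unfolding e .
  also have "\<dots> = (if b = b' then 1 else 0)"
  proof (cases "b = b'")
    case True
    have "(\<integral>x. F i x \<partial>density lborel std_normal_density) = 1" for i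
      using std_normal_moments(4) N.prob_space True by (cases "i = b") (auto simp: F_def power2_eq_square)
    then show ?thesis using True by simp
  next
    case False
    have "(\<integral>x. F b x \<partial>density lborel std_normal_density) = 0"
      using std_normal_moments(3) False by (simp add: F_def)
    then show ?thesis using False b by (auto intro!: prod_zero)
  qed
  finally show "(\<integral>y. (y \<bullet> b) * (y \<bullet> b') \<partial>gauss 1) = (if b = b' then 1 else 0)" .
qed

lemma integral_gauss_coord:
  fixes b :: "'a::euclidean_space"
  assumes b: "b \<in> Basis"
  shows "(\<integral>y. y \<bullet> b \<partial>gauss 1) = 0"
proof -
  have "(\<integral>y. y \<bullet> b \<partial>gauss 1) = (\<integral>y. y \<bullet> b \<partial>distr (gauss 1 :: 'a measure) borel uminus)"
    by (simp add: distr_gauss_uminus)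
  also have "\<dots> = - (\<integral>y. y \<bullet> b \<partial>gauss 1)" by (subst integral_distr) auto
  finally show ?thesis by simp
qed

lemma norm_power_le_coords:
  fixes y :: "'a::euclidean_space"
  shows "norm y ^ k \<le> real DIM('a) ^ k * (\<Sum>b\<in>Basis. \<bar>y \<bullet> b\<bar> ^ k)"
proof -
  obtain b where b: "b \<in> Basis" "\<And>i. i \<in> Basis \<Longrightarrow> \<bar>y \<bullet> i\<bar> \<le> \<bar>y \<bullet> b\<bar>"
    using obtains_MAX[of Basis "\<lambda>i. \<bar>y \<bullet> i\<bar>"] finite_Basis nonempty_Basis by (metis Max_ge finite_imageI image_eqI)
  have "norm y \<le> (\<Sum>i\<in>Basis. \<bar>y \<bullet> i\<bar>)" by (rule norm_le_l1)
  also have "\<dots> \<le> real DIM('a) * \<bar>y \<bullet> b\<bar>" using b(2) by (intro sum_bounded_above)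
  finally have "norm y ^ k \<le> (real DIM('a) * \<bar>y \<bullet> b\<bar>) ^ k" by (intro power_mono) auto
  also have "\<dots> \<le> real DIM('a) ^ k * (\<Sum>b\<in>Basis. \<bar>y \<bullet> b\<bar> ^ k)"
    unfolding power_mult_distrib using b(1) by (intro mult_left_mono member_le_sum) auto
  finally show ?thesis .
qed

lemma integrable_gauss1_norm_power: "integrable (gauss 1) (\<lambda>y::'a::euclidean_space. norm y ^ k)"
proof (rule Bochner_Integration.integrable_bound)
  show "integrable (gauss 1) (\<lambda>y::'a. real DIM('a) ^ k * (\<Sum>b\<in>Basis. \<bar>y \<bullet> b\<bar> ^ k))"
    by (intro integrable_mult_right Bochner_Integration.integrable_sum integrable_gauss_coord_power)
  show "AE y::'a in gauss 1. norm (norm y ^ k) \<le> norm (real DIM('a) ^ k * (\<Sum>b\<in>Basis. \<bar>y \<bullet> b\<bar> ^ k))"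
    by (intro AE_I2) (use norm_power_le_coords in \<open>force simp: sum_nonneg abs_mult\<close>)
qed simp

text \<open>Everything reduces to \<open>s = 1\<close> by scaling. The third moment is of order
  \<open>sqrt s ^ 3\<close>, negligible against the second as \<open>s\<close> tends to 0, which
  makes it usable as an error term.\<close>

lemma
  fixes x :: "'a::euclidean_space"
  assumes s: "0 < s"
  shows integrable_gauss_norm_power: "integrable (gauss s) (\<lambda>y::'a. norm y ^ k)"
    and integral_gauss_norm_power: "(\<integral>y. norm y ^ k \<partial>(gauss s :: 'a measure)) = sqrt s ^ k * (\<integral>y. norm y ^ k \<partial>(gauss 1 :: 'a measure))"
    and integrable_gauss_inner: "integrable (gauss s) (\<lambda>y. x \<bullet> y)"
    and integral_gauss_inner: "(\<integral>y. x \<bullet> y \<partial>gauss s) = 0"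
    and integrable_gauss_inner2: "integrable (gauss s) (\<lambda>y. (x \<bullet> y)\<^sup>2)"
    and integral_gauss_inner2: "(\<integral>y. (x \<bullet> y)\<^sup>2 \<partial>gauss s) = s * (norm x)\<^sup>2"
    and integral_gauss_norm2: "(\<integral>y. (norm y)\<^sup>2 \<partial>(gauss s :: 'a measure)) = s * real DIM('a)"
proof -
  have g: "gauss s = distr (gauss 1) borel (\<lambda>y::'a. sqrt s *\<^sub>R y)" using distr_gauss_scaleR[OF s] ..
  have inner: "x \<bullet> y = (\<Sum>b\<in>Basis. (x \<bullet> b) * (y \<bullet> b))" for y by (rule euclidean_inner)
  have inner2: "(x \<bullet> y)\<^sup>2 = (\<Sum>b\<in>Basis. \<Sum>b'\<in>Basis. ((x \<bullet> b) * (x \<bullet> b')) * ((y \<bullet> b) * (y \<bullet> b')))" for y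
    by (subst inner) (simp add: power2_eq_square sum_product ac_simps)
  have norm2: "(norm y)\<^sup>2 = (\<Sum>b\<in>Basis. (y \<bullet> b) * (y \<bullet> b))" for y :: 'a
    unfolding power2_norm_eq_inner by (rule euclidean_inner)
  have i1: "integrable (gauss 1) (\<lambda>y. y \<bullet> b)" if "b \<in> Basis" for b :: 'a
  proof (rule integrable_norm_cancel)
    show "integrable (gauss 1) (\<lambda>y. norm (y \<bullet> b))"
      using integrable_gauss_coord_power[OF that, of 1] by simp
  qed simp
  have eq: "(\<lambda>y. x \<bullet> y) = (\<lambda>y. \<Sum>b\<in>Basis. (x \<bullet> b) * (y \<bullet> b))"
    by (rule ext) (rule inner)
  have 1: "integrable (gauss 1) (\<lambda>y. x \<bullet> y)"
    by (subst eq) (intro Bochner_Integration.integrable_sum integrable_mult_right i1)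
  have mean: "(\<integral>y. x \<bullet> y \<partial>gauss 1) = 0"
    by (subst eq, subst Bochner_Integration.integral_sum) (auto intro: i1 simp: integral_gauss_coord)
  have 2: "integrable (gauss 1) (\<lambda>y. (x \<bullet> y)\<^sup>2)"
    unfolding inner2 by (intro Bochner_Integration.integrable_sum integrable_mult_right integrable_gauss_coord2)
  have "(\<integral>y. (x \<bullet> y)\<^sup>2 \<partial>gauss 1) = (\<Sum>b\<in>Basis. \<Sum>b'\<in>Basis. ((x \<bullet> b) * (x \<bullet> b')) * (if b = b' then 1 else 0))"
    unfolding inner2 by (simp add: Bochner_Integration.integral_sum integrable_gauss_coord2 integral_gauss_coord2)
  also have "\<dots> = (norm x)\<^sup>2" by (simp add: norm2 if_distrib sum.delta cong: if_cong)
  finally have 3: "(\<integral>y. (x \<bullet> y)\<^sup>2 \<partial>gauss 1) = (norm x)\<^sup>2" .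
  have 4: "(\<integral>y. (norm y)\<^sup>2 \<partial>(gauss 1 :: 'a measure)) = real DIM('a)"
    unfolding norm2 by (simp add: Bochner_Integration.integral_sum integrable_gauss_coord2 integral_gauss_coord2)
  show "integrable (gauss s) (\<lambda>y::'a. norm y ^ k)"
    unfolding g using integrable_gauss1_norm_power[of k, where 'a='a]
    by (subst integrable_distr_eq) (auto simp: power_mult_distrib)
  show nk: "(\<integral>y. norm y ^ k \<partial>(gauss s :: 'a measure)) = sqrt s ^ k * (\<integral>y. norm y ^ k \<partial>(gauss 1 :: 'a measure))" for k
    unfolding g using s by (subst integral_distr) (auto simp: power_mult_distrib)
  show "(\<integral>y. (norm y)\<^sup>2 \<partial>(gauss s :: 'a measure)) = s * real DIM('a)"
    unfolding nk 4 using s by simp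
  show "integrable (gauss s) (\<lambda>y. x \<bullet> y)" unfolding g using 1 by (subst integrable_distr_eq) auto
  show "(\<integral>y. x \<bullet> y \<partial>gauss s) = 0" unfolding g using mean by (subst integral_distr) auto
  show "integrable (gauss s) (\<lambda>y. (x \<bullet> y)\<^sup>2)"
    unfolding g using 2 by (subst integrable_distr_eq) (auto simp: power_mult_distrib)
  show "(\<integral>y. (x \<bullet> y)\<^sup>2 \<partial>gauss s) = s * (norm x)\<^sup>2"
    unfolding g using 3 s by (subst integral_distr) (auto simp: power_mult_distrib)
qed

text \<open>The odd power makes the barrier nonpositive outside the ball of radius \<open>R\<close>, and its
  Laplacian dominates a negative multiple of it inside; truncating at \<open>- 1\<close> only makes it bounded.\<close>

definition barrier :: "real \<Rightarrow> 'a::euclidean_space \<Rightarrow> real" where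
  "barrier R x = max (-1) ((1 - (norm x)\<^sup>2 / R\<^sup>2) ^ 3)"

text \<open>With \<open>e = 3 * d + 12\<close>, half the Laplacian of the cubic barrier is
  \<open>u * (12 - e * u) / R\<^sup>2\<close>, where \<open>u\<close> is the base of the cube. The
  rate is the least \<open>k\<close> with \<open>k * u\<^sup>2 - e * u + 12\<close> nonnegative for
  all real \<open>u\<close>, that is, with nonpositive discriminant
  \<open>e\<^sup>2 - 48 * k\<close>.\<close>

definition barrier_rate :: "'a::euclidean_space itself \<Rightarrow> real" where
  "barrier_rate _ = (3 * real DIM('a) + 12)\<^sup>2 / 48"

lemma barrier_measurable [measurable]: "barrier R \<in> borel_measurable borel"
  unfolding barrier_def[abs_def] by measurable

text \<open>A second-order expansion of the cube with an explicit remainder, valid for every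
  displacement \<open>y\<close>. The terms \<open>norm y ^ 3\<close> and \<open>norm y ^ 6\<close>
  absorb the rest. Truncation only raises the barrier, so the lower bound survives it.\<close>

lemma barrier_pointwise:
  fixes x y :: "'a::euclidean_space"
  assumes R: "0 < R" and x: "norm x \<le> R"
  defines "u \<equiv> 1 - (norm x)\<^sup>2 / R\<^sup>2"
  shows "u ^ 3 - 3 * u\<^sup>2 / R\<^sup>2 * (2 * (x \<bullet> y) + (norm y)\<^sup>2)
      + 12 * u / R ^ 4 * ((x \<bullet> y)\<^sup>2 - R * norm y ^ 3) - (32 / R ^ 3 * norm y ^ 3 + 4 / R ^ 6 * norm y ^ 6)
    \<le> barrier R (x + y)"
proof -
  define a where "a = x \<bullet> y"
  define n where "n = norm y"
  define w where "w = (2 * a + n\<^sup>2) / R\<^sup>2"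
  have n: "0 \<le> n" by (simp add: n_def)
  have a: "\<bar>a\<bar> \<le> R * n"
    unfolding a_def n_def using Cauchy_Schwarz_ineq2[of x y] x by (meson mult_right_mono norm_ge_zero order_trans)
  have u: "0 \<le> u" "u \<le> 1" using x R by (auto simp: u_def power_mono)
  have "1 - (norm (x + y))\<^sup>2 / R\<^sup>2 = u - w"
    by (simp add: u_def w_def a_def n_def power2_norm_eq_inner inner_add inner_commute add_divide_distrib)
  then have f1: "(u - w) ^ 3 \<le> barrier R (x + y)" by (simp add: barrier_def)
  have f2: "(u - w) ^ 3 = u ^ 3 - 3 * u\<^sup>2 * w + 3 * u * w\<^sup>2 - w ^ 3"
    by (simp add: power2_eq_square power3_eq_cube algebra_simps)
  have "4 / R ^ 4 * (a\<^sup>2 - R * n ^ 3) \<le> w\<^sup>2"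
  proof -
    have "- (R * n ^ 3) \<le> a * n\<^sup>2"
    proof -
      have "- (R * n) * n\<^sup>2 \<le> a * n\<^sup>2" using a by (intro mult_right_mono) auto
      then show ?thesis by (simp add: power2_eq_square power3_eq_cube algebra_simps)
    qed
    then have "4 * (a\<^sup>2 - R * n ^ 3) \<le> (2 * a + n\<^sup>2)\<^sup>2"
      using zero_le_power[OF n, of 4] by (simp add: power2_eq_square power4_eq_xxxx algebra_simps)
    then have "4 * (a\<^sup>2 - R * n ^ 3) / R ^ 4 \<le> (2 * a + n\<^sup>2)\<^sup>2 / R ^ 4"
      by (intro divide_right_mono) auto
    then show ?thesis by (simp add: w_def power_divide flip: power_mult)
  qed
  then have f3: "3 * u * (4 / R ^ 4 * (a\<^sup>2 - R * n ^ 3)) \<le> 3 * u * w\<^sup>2" using u by (intro mult_left_mono) auto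
  have f4: "w ^ 3 \<le> 32 / R ^ 3 * n ^ 3 + 4 / R ^ 6 * n ^ 6"
  proof -
    \<comment> \<open>Convexity of the cube on nonnegative numbers, with the constant
      \<open>2\<^sup>2 = 4\<close>.\<close>
    have cube: "(p + q) ^ 3 \<le> 4 * (p ^ 3 + q ^ 3)" if "0 \<le> p" "0 \<le> q" for p q :: real
    proof -
      have "4 * (p ^ 3 + q ^ 3) - (p + q) ^ 3 = 3 * ((p + q) * (p - q)\<^sup>2)"
        by (simp add: power2_eq_square power3_eq_cube algebra_simps)
      also have "\<dots> \<ge> 0" using that by simp
      finally show ?thesis by simp
    qed
    have "w \<le> (2 * R * n + n\<^sup>2) / R\<^sup>2" unfolding w_def using a by (intro divide_right_mono) auto
    then have "w ^ 3 \<le> ((2 * R * n + n\<^sup>2) / R\<^sup>2) ^ 3" by (rule power_mono_odd[rotated]) simp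
    also have "\<dots> = (2 * R * n + n\<^sup>2) ^ 3 / R ^ 6" by (simp add: power_divide flip: power_mult)
    also have "\<dots> \<le> 4 * ((2 * R * n) ^ 3 + (n\<^sup>2) ^ 3) / R ^ 6"
      using R n by (intro divide_right_mono cube) auto
    also have "\<dots> = 32 / R ^ 3 * n ^ 3 + 4 / R ^ 6 * n ^ 6"
      using R by (simp add: power_mult_distrib field_simps flip: power_mult power_add)
    finally show ?thesis .
  qed
  have e1: "3 * u\<^sup>2 / R\<^sup>2 * (2 * a + n\<^sup>2) = 3 * u\<^sup>2 * w" by (simp add: w_def)
  have e2: "12 * u / R ^ 4 * (a\<^sup>2 - R * n ^ 3) = 3 * u * (4 / R ^ 4 * (a\<^sup>2 - R * n ^ 3))" by simp
  show ?thesis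
    unfolding a_def[symmetric] n_def[symmetric] e1 e2 using f1 f2 f3 f4 by linarith
qed

text \<open>One Gaussian step of length \<open>\<delta>\<close> lowers the mean barrier by at most
  the factor \<open>1 - rate * \<delta> / R\<^sup>2\<close>, up to an error of order
  \<open>sqrt \<delta> ^ 3\<close>. Since \<open>K\<close> serves all \<open>\<delta>\<close> and
  all \<open>x\<close> in the ball, the errors of the roughly \<open>t / \<delta>\<close> steps add
  up to order \<open>sqrt \<delta>\<close>.\<close>

lemma barrier_step:
  fixes x :: "'a::euclidean_space"
  assumes R: "0 < R"
  obtains K where "0 \<le> K" "\<And>\<delta> x::'a. 0 < \<delta> \<Longrightarrow> \<delta> \<le> 1 \<Longrightarrow> norm x \<le> R \<Longrightarrow>
    (1 - barrier_rate TYPE('a) / R\<^sup>2 * \<delta>) * barrier R x - K * sqrt \<delta> ^ 3 \<le> (\<integral>y. barrier R (x + y) \<partial>gauss \<delta>)"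
proof -
  define m3 where "m3 = (\<integral>y. norm y ^ 3 \<partial>(gauss 1 :: 'a measure))"
  define m6 where "m6 = (\<integral>y. norm y ^ 6 \<partial>(gauss 1 :: 'a measure))"
  define e where "e = 3 * real DIM('a) + 12"
  have m: "0 \<le> m3" "0 \<le> m6" unfolding m3_def m6_def by (auto intro!: integral_nonneg_AE)
  \<comment> \<open>The means of the remainder terms: \<open>12 / R ^ 3\<close> comes from the
    correction to the quadratic term with \<open>u\<close> bounded by 1, the others from the cubic
    term. The sixth moment is of order \<open>\<delta> ^ 3\<close>, at most
    \<open>sqrt \<delta> ^ 3\<close> because \<open>\<delta> \<le> 1\<close>.\<close>
  define K where "K = 12 / R ^ 3 * m3 + (32 / R ^ 3 * m3 + 4 / R ^ 6 * m6)"
  have "0 \<le> K" using R m by (auto simp: K_def)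
  moreover have "(1 - barrier_rate TYPE('a) / R\<^sup>2 * \<delta>) * barrier R x - K * sqrt \<delta> ^ 3 \<le> (\<integral>y. barrier R (x + y) \<partial>gauss \<delta>)"
    if \<delta>: "0 < \<delta>" "\<delta> \<le> 1" and x: "norm x \<le> R" for \<delta> and x :: 'a
  proof -
    interpret G: prob_space "gauss \<delta> :: 'a measure" by (rule prob_space_gauss) fact
    define u where "u = 1 - (norm x)\<^sup>2 / R\<^sup>2"
    have u: "0 \<le> u" "u \<le> 1" using x R by (auto simp: u_def power_mono)
    have "0 \<le> u ^ 3" using u(1) by (rule zero_le_power)
    then have "- 1 \<le> u ^ 3" by linarith
    then have bx: "barrier R x = u ^ 3" unfolding barrier_def u_def[symmetric] by (rule max_absorb2)
    define P where "P y = u ^ 3 - 3 * u\<^sup>2 / R\<^sup>2 * (2 * (x \<bullet> y) + (norm y)\<^sup>2)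
      + 12 * u / R ^ 4 * ((x \<bullet> y)\<^sup>2 - R * norm y ^ 3) - (32 / R ^ 3 * norm y ^ 3 + 4 / R ^ 6 * norm y ^ 6)" for y
    note ints = integrable_gauss_norm_power[OF \<delta>(1)] integrable_gauss_inner[OF \<delta>(1)] integrable_gauss_inner2[OF \<delta>(1)]
    have Pi: "integrable (gauss \<delta>) P"
      unfolding P_def[abs_def]
      by (intro Bochner_Integration.integrable_diff Bochner_Integration.integrable_add integrable_mult_right ints) auto
    have 1: "(\<integral>y. P y \<partial>gauss \<delta>) = u ^ 3 - 3 * u\<^sup>2 / R\<^sup>2 * (2 * 0 + \<delta> * real DIM('a))
      + 12 * u / R ^ 4 * (\<delta> * (norm x)\<^sup>2 - R * (sqrt \<delta> ^ 3 * m3)) - (32 / R ^ 3 * (sqrt \<delta> ^ 3 * m3) + 4 / R ^ 6 * (sqrt \<delta> ^ 6 * m6))"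
      unfolding P_def
      by (simp add: ints G.prob_space[simplified] integral_gauss_norm_power[OF \<delta>(1), of 3] integral_gauss_norm_power[OF \<delta>(1), of 6]
          integral_gauss_inner[OF \<delta>(1)] integral_gauss_inner2[OF \<delta>(1)] integral_gauss_norm2[OF \<delta>(1)] m3_def m6_def)
    have 2: "(\<integral>y. P y \<partial>gauss \<delta>) \<le> (\<integral>y. barrier R (x + y) \<partial>gauss \<delta>)"
    proof (rule integral_mono[OF Pi])
      show "integrable (gauss \<delta>) (\<lambda>y. barrier R (x + y))"
      proof (rule G.integrable_const_bound[where B=1])
        have "(1 - (norm z)\<^sup>2 / R\<^sup>2) ^ 3 \<le> 1" for z :: 'a
          using power_mono_odd[of 3 "1 - (norm z)\<^sup>2 / R\<^sup>2" 1] by simp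
        then show "AE y in gauss \<delta>. norm (barrier R (x + y)) \<le> 1" by (auto simp: barrier_def max_def abs_le_iff)
      qed simp
    qed (unfold P_def u_def, rule barrier_pointwise[OF R x])
    have 3: "(norm x)\<^sup>2 = R\<^sup>2 * (1 - u)" using R by (simp add: u_def)
    have 4: "12 * u * (sqrt \<delta> ^ 3 * m3) / R ^ 3 \<le> 12 * (sqrt \<delta> ^ 3 * m3) / R ^ 3"
      using u m R \<delta> by (intro divide_right_mono mult_right_mono) auto
    have 5: "4 / R ^ 6 * (sqrt \<delta> ^ 6 * m6) \<le> 4 / R ^ 6 * (sqrt \<delta> ^ 3 * m6)"
      using \<delta> m R by (intro mult_left_mono mult_right_mono power_decreasing) auto
    \<comment> \<open>The differential inequality for the barrier, multiplied by
      \<open>\<delta>\<close>; \<open>barrier_rate\<close> turns the quadratic into a perfect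
      square.\<close>
    have 6: "0 \<le> u * \<delta> / R\<^sup>2 * ((e\<^sup>2 / 48) * u\<^sup>2 - e * u + 12)"
    proof (intro mult_nonneg_nonneg)
      have square: "(e\<^sup>2 / 48) * u\<^sup>2 - e * u + 12 = (e * u - 24)\<^sup>2 / 48"
        by (simp add: power2_eq_square field_simps)
      show "0 \<le> (e\<^sup>2 / 48) * u\<^sup>2 - e * u + 12" unfolding square by simp
    qed (use u \<delta> in auto)
    define D where "D = sqrt \<delta> ^ 3"
    have "12 * u / R ^ 4 * (\<delta> * (norm x)\<^sup>2 - R * (D * m3)) = 12 * u * (1 - u) * \<delta> / R\<^sup>2 - 12 * u * (D * m3) / R ^ 3"
      unfolding 3 using R by (simp add: field_simps power2_eq_square power3_eq_cube power4_eq_xxxx)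
    moreover have "u * \<delta> / R\<^sup>2 * ((e\<^sup>2 / 48) * u\<^sup>2 - e * u + 12)
        = e\<^sup>2 / 48 / R\<^sup>2 * \<delta> * u ^ 3 - 3 * u\<^sup>2 / R\<^sup>2 * (\<delta> * real DIM('a)) + 12 * u * (1 - u) * \<delta> / R\<^sup>2"
      using R by (simp add: e_def field_simps power2_eq_square power3_eq_cube)
    moreover have "K * D = 12 * (D * m3) / R ^ 3 + (32 / R ^ 3 * (D * m3) + 4 / R ^ 6 * (D * m6))"
      by (simp add: K_def field_simps)
    moreover have "(1 - e\<^sup>2 / 48 / R\<^sup>2 * \<delta>) * u ^ 3 = u ^ 3 - e\<^sup>2 / 48 / R\<^sup>2 * \<delta> * u ^ 3"
      by (simp add: algebra_simps)
    ultimately show ?thesis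
      using 1 2 4 5 6 unfolding bx barrier_rate_def e_def[symmetric] D_def[symmetric]
      by (simp only: mult_zero_right add_0_left)
  qed
  ultimately show thesis using that by blast
qed

lemma barrier_le_1: "barrier R x \<le> 1" and barrier_ge_minus_1: "- 1 \<le> barrier R x"
proof -
  have "(1 - (norm x)\<^sup>2 / R\<^sup>2) ^ 3 \<le> 1"
    using power_mono_odd[of 3 "1 - (norm x)\<^sup>2 / R\<^sup>2" 1] by simp
  then show "barrier R x \<le> 1" by (simp add: barrier_def)
qed (simp add: barrier_def)

section \<open>Staying in a ball, on grids and in continuous time\<close>

context standard_brownian_motion
begin

text \<open>The Markov property for bounded functions of either sign; the barrier is negative
  outside the ball.\<close>

lemma integral_past_increment:
  fixes k :: nat and f :: "(nat \<Rightarrow> 'a) \<times> 'a \<Rightarrow> real"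
  assumes "0 < \<delta>" "real k * \<delta> < s"
    and f[measurable]: "f \<in> borel_measurable (PiM {..k} (\<lambda>_. borel) \<Otimes>\<^sub>M borel)" and bnd: "\<And>z. \<bar>f z\<bar> \<le> 1"
  shows "expectation (\<lambda>\<omega>. f (\<lambda>i\<in>{..k}. B (real i * \<delta>) \<omega>, B s \<omega> - B (real k * \<delta>) \<omega>))
    = expectation (\<lambda>\<omega>. \<integral>y. f (\<lambda>i\<in>{..k}. B (real i * \<delta>) \<omega>, y) \<partial>gauss (s - real k * \<delta>))"
proof -
  let ?U = "\<lambda>\<omega>. \<lambda>i\<in>{..k}. B (real i * \<delta>) \<omega>" and ?V = "\<lambda>\<omega>. B s \<omega> - B (real k * \<delta>) \<omega>"
  let ?P = "PiM {..k} (\<lambda>_. borel) :: (nat \<Rightarrow> 'a) measure"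
  let ?G = "gauss (s - real k * \<delta>) :: 'a measure"
  have s: "0 \<le> real k * \<delta>" using assms by simp
  have U[measurable]: "?U \<in> measurable M ?P"
    using assms by (intro measurable_restrict measurable_at) auto
  have V[measurable]: "?V \<in> borel_measurable M"
    using less_imp_le[OF le_less_trans[OF s assms(2)]] s by (intro borel_measurable_diff measurable_at)
  interpret G: prob_space ?G using assms by (intro prob_space_gauss) simp
  interpret D: prob_space "distr M ?P ?U" by (rule prob_space_distr) measurable
  interpret DG: pair_prob_space "distr M ?P ?U" ?G ..
  have f': "f \<in> borel_measurable (distr M ?P ?U \<Otimes>\<^sub>M ?G)"
    using f by (simp cong: measurable_cong_sets sets_pair_measure_cong)
  have eq: "distr M (?P \<Otimes>\<^sub>M borel) (\<lambda>\<omega>. (?U \<omega>, ?V \<omega>)) = distr M ?P ?U \<Otimes>\<^sub>M ?G"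
    by (rule distr_past_increment[OF assms(1,2)])
  have "expectation (\<lambda>\<omega>. f (?U \<omega>, ?V \<omega>)) = (\<integral>z. f z \<partial>distr M (?P \<Otimes>\<^sub>M borel) (\<lambda>\<omega>. (?U \<omega>, ?V \<omega>)))"
    by (subst integral_distr) auto
  also have "\<dots> = (\<integral>u. \<integral>y. f (u, y) \<partial>?G \<partial>distr M ?P ?U)"
    unfolding eq
    by (rule DG.integral_fst'[symmetric], rule DG.integrable_const_bound[where B=1])
      (use bnd f' in auto)
  also have "\<dots> = expectation (\<lambda>\<omega>. \<integral>y. f (?U \<omega>, y) \<partial>?G)"
  proof (subst integral_distr)
    have "case_prod (\<lambda>u y. f (u, y)) \<in> borel_measurable (?P \<Otimes>\<^sub>M ?G)"
      using f by (simp cong: measurable_cong_sets sets_pair_measure_cong)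
    then show "(\<lambda>u. \<integral>y. f (u, y) \<partial>?G) \<in> borel_measurable ?P"
      by (rule G.borel_measurable_lebesgue_integral)
  qed auto
  finally show ?thesis .
qed

definition confined :: "real \<Rightarrow> real \<Rightarrow> nat \<Rightarrow> 'w set" where
  "confined R \<delta> n = {\<omega> \<in> space M. \<forall>i\<le>n. norm (B (real i * \<delta>) \<omega>) \<le> R}"

lemma confined_measurable [measurable]:
  assumes "0 < \<delta>" shows "confined R \<delta> n \<in> events"
proof -
  have [measurable]: "B (real i * \<delta>) \<in> borel_measurable M" for i :: nat
    using assms by (intro measurable_at) simp
  show ?thesis unfolding confined_def by measurable
qed

text \<open>\<open>a k\<close> is the mean barrier of the path killed at its first exit observed on
  the grid. Each step multiplies it by at least \<open>c\<close> up to the error \<open>K\<close>;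
  as the barrier is at most 1, \<open>a n\<close> is a lower bound for the survival
  probability.\<close>

lemma prob_confined_ge:
  assumes R: "0 < R" and \<delta>: "0 < \<delta>" and c: "0 \<le> c" "c \<le> 1" and K: "0 \<le> K"
    and step: "\<And>x::'a. norm x \<le> R \<Longrightarrow> c * barrier R x - K \<le> (\<integral>y. barrier R (x + y) \<partial>gauss \<delta>)"
  shows "c ^ n - real n * K \<le> prob (confined R \<delta> n)"
proof -
  define a where "a k = expectation (\<lambda>\<omega>. indicator (confined R \<delta> k) \<omega> * barrier R (B (real k * \<delta>) \<omega>))" for k
  have Bm[measurable]: "B (real i * \<delta>) \<in> borel_measurable M" for i :: nat
    using \<delta> by (intro measurable_at) simp
  note [measurable] = confined_measurable[OF \<delta>]
  have bnd: "\<bar>barrier R x\<bar> \<le> 1" for x :: 'a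
    using barrier_le_1[of R x] barrier_ge_minus_1[of R x] by (simp add: abs_le_iff)
  have int: "integrable M (\<lambda>\<omega>. indicator (confined R \<delta> k) \<omega> * barrier R (B (real j * \<delta>) \<omega>))" for k j
    using bnd by (intro integrable_const_bound[where B=1]) (auto simp: indicator_def)
  have step_a: "c * a k - K \<le> a (Suc k)" for k
  proof -
    define f :: "(nat \<Rightarrow> 'a) \<times> 'a \<Rightarrow> real" where
      "f z = indicator {u. \<forall>i\<le>k. norm (u i) \<le> R} (fst z) * barrier R (fst z k + snd z)" for z
    let ?U = "\<lambda>\<omega>. \<lambda>i\<in>{..k}. B (real i * \<delta>) \<omega>"
    have fm: "f \<in> borel_measurable (PiM {..k} (\<lambda>_. borel) \<Otimes>\<^sub>M borel)"
    proof -
      have le: "Measurable.pred Q (\<lambda>x. h x \<le> R)" if [measurable]: "h \<in> borel_measurable Q"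
        for h :: "(nat \<Rightarrow> 'a) \<times> 'a \<Rightarrow> real" and Q by measurable
      have comp: "(\<lambda>z. fst z l) \<in> borel_measurable (PiM {..k} (\<lambda>_. borel :: 'a measure) \<Otimes>\<^sub>M (borel :: 'a measure))" if "l \<le> k" for l
        using that by (intro measurable_compose[OF measurable_fst] measurable_component_singleton) auto
      have "Measurable.pred (PiM {..k} (\<lambda>_. borel :: 'a measure) \<Otimes>\<^sub>M (borel :: 'a measure)) (\<lambda>z. \<forall>i\<in>{..k}. norm (fst z i) \<le> R)"
        by (intro pred_intros_countable_bounded le borel_measurable_norm comp) auto
      then have "(\<lambda>z. indicator {u. \<forall>i\<le>k. norm (u i) \<le> R} (fst z) :: real) \<in> borel_measurable (PiM {..k} (\<lambda>_. borel :: 'a measure) \<Otimes>\<^sub>M (borel :: 'a measure))"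
        by (intro borel_measurable_indicator') (simp add: pred_def)
      then show ?thesis
        unfolding f_def[abs_def]
        by (intro borel_measurable_times measurable_compose[OF _ barrier_measurable] borel_measurable_add comp measurable_snd) auto
    qed
    have ind: "indicator {u. \<forall>i\<le>k. norm (u i) \<le> R} (?U \<omega>) = (indicator (confined R \<delta> k) \<omega> :: real)" if "\<omega> \<in> space M" for \<omega>
      using that by (auto simp: confined_def indicator_def)
    have ds: "real (Suc k) * \<delta> - real k * \<delta> = \<delta>" by (simp add: algebra_simps)
    have "c * a k - K \<le> expectation (\<lambda>\<omega>. c * (indicator (confined R \<delta> k) \<omega> * barrier R (B (real k * \<delta>) \<omega>)) - K)"
      unfolding a_def by (subst Bochner_Integration.integral_diff) (auto simp: int prob_space)
    also have "\<dots> \<le> expectation (\<lambda>\<omega>. \<integral>y. f (?U \<omega>, y) \<partial>gauss \<delta>)"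
    proof (rule integral_mono_AE)
      interpret G: prob_space "gauss \<delta> :: 'a measure" by (rule prob_space_gauss[OF \<delta>])
      have fint: "(\<integral>y. f (?U \<omega>, y) \<partial>gauss \<delta>) = indicator (confined R \<delta> k) \<omega> * (\<integral>y. barrier R (B (real k * \<delta>) \<omega> + y) \<partial>gauss \<delta>)"
        if "\<omega> \<in> space M" for \<omega>
        unfolding f_def fst_conv snd_conv ind[OF that] by simp
      have U[measurable]: "?U \<in> measurable M (PiM {..k} (\<lambda>_. borel))" by (intro measurable_restrict Bm)
      have "case_prod (\<lambda>u y. f (u, y)) \<in> borel_measurable (PiM {..k} (\<lambda>_. borel) \<Otimes>\<^sub>M (gauss \<delta> :: 'a measure))"
        using fm by (simp cong: measurable_cong_sets sets_pair_measure_cong)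
      then have m: "(\<lambda>u. \<integral>y. f (u, y) \<partial>gauss \<delta>) \<in> borel_measurable (PiM {..k} (\<lambda>_. borel))"
        by (rule G.borel_measurable_lebesgue_integral)
      have f1: "\<bar>f z\<bar> \<le> 1" for z using bnd by (auto simp: f_def indicator_def)
      show "integrable M (\<lambda>\<omega>. \<integral>y. f (?U \<omega>, y) \<partial>gauss \<delta>)"
      proof (rule integrable_const_bound[where B=1])
        show "(\<lambda>\<omega>. \<integral>y. f (?U \<omega>, y) \<partial>gauss \<delta>) \<in> borel_measurable M"
          by (rule measurable_compose[OF U m])
        have "\<bar>\<integral>y. f (u, y) \<partial>gauss \<delta>\<bar> \<le> (\<integral>y. \<bar>f (u, y)\<bar> \<partial>gauss \<delta>)" for u
          by (rule integral_abs_bound)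
        moreover have "(\<integral>y. \<bar>f (u, y)\<bar> \<partial>gauss \<delta>) \<le> 1" for u
        proof (cases "integrable (gauss \<delta>) (\<lambda>y. \<bar>f (u, y)\<bar>)")
          case True
          then show ?thesis using f1 by (intro G.integral_le_const) auto
        qed (simp add: not_integrable_integral_eq)
        ultimately show "AE \<omega> in M. norm (\<integral>y. f (?U \<omega>, y) \<partial>gauss \<delta>) \<le> 1"
          unfolding real_norm_def by (intro AE_I2) (rule order_trans)
      qed
      show "AE \<omega> in M. c * (indicator (confined R \<delta> k) \<omega> * barrier R (B (real k * \<delta>) \<omega>)) - K \<le> (\<integral>y. f (?U \<omega>, y) \<partial>gauss \<delta>)"
        using step K by (intro AE_I2) (auto simp: fint indicator_def confined_def)
    qed (auto intro!: int)
    also have "\<dots> = expectation (\<lambda>\<omega>. f (?U \<omega>, B (real (Suc k) * \<delta>) \<omega> - B (real k * \<delta>) \<omega>))"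
      using integral_past_increment[OF \<delta>, of k "real (Suc k) * \<delta>" f] \<delta> fm bnd unfolding ds
      by (auto simp: f_def indicator_def simp del: of_nat_Suc)
    also have "\<dots> = expectation (\<lambda>\<omega>. indicator (confined R \<delta> k) \<omega> * barrier R (B (real (Suc k) * \<delta>) \<omega>))"
      by (intro Bochner_Integration.integral_cong refl) (simp add: f_def ind del: of_nat_Suc)
    \<comment> \<open>Killing a path outside the ball removes a nonpositive contribution, so the
      mean can only grow.\<close>
    also have "\<dots> \<le> a (Suc k)"
      unfolding a_def
    proof (intro integral_mono int)
      fix \<omega> assume w: "\<omega> \<in> space M"
      show "indicator (confined R \<delta> k) \<omega> * barrier R (B (real (Suc k) * \<delta>) \<omega>)
          \<le> indicator (confined R \<delta> (Suc k)) \<omega> * barrier R (B (real (Suc k) * \<delta>) \<omega>)"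
      proof (cases "norm (B (real (Suc k) * \<delta>) \<omega>) \<le> R")
        case True
        then show ?thesis using w by (auto simp: confined_def indicator_def le_Suc_eq simp del: of_nat_Suc)
      next
        case False
        then have "R\<^sup>2 \<le> (norm (B (real (Suc k) * \<delta>) \<omega>))\<^sup>2" using R by (intro power_mono) auto
        then have "(1 - (norm (B (real (Suc k) * \<delta>) \<omega>))\<^sup>2 / R\<^sup>2) ^ 3 \<le> 0"
          using R by (simp add: power_le_zero_eq del: of_nat_Suc)
        then have "barrier R (B (real (Suc k) * \<delta>) \<omega>) \<le> 0" by (simp add: barrier_def del: of_nat_Suc)
        moreover have "\<omega> \<notin> confined R \<delta> (Suc k)" using False by (auto simp: confined_def simp del: of_nat_Suc)
        ultimately show ?thesis by (simp add: indicator_def del: of_nat_Suc)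
      qed
    qed
    finally show ?thesis .
  qed
  have "c ^ k - real k * K \<le> a k" for k
  proof (induction k)
    case 0
    have "a 0 = expectation (\<lambda>_. 1)"
      unfolding a_def using start R
      by (intro Bochner_Integration.integral_cong refl) (auto simp: confined_def indicator_def barrier_def)
    then show ?case by (simp add: prob_space)
  next
    case (Suc k)
    have "c ^ Suc k - real (Suc k) * K \<le> c * (c ^ k - real k * K) - K"
      using mult_right_mono[OF c(2), of "real k * K"] K by (simp add: algebra_simps)
    also have "\<dots> \<le> c * a k - K" using Suc c by (intro diff_right_mono mult_left_mono) auto
    also have "\<dots> \<le> a (Suc k)" by (rule step_a)
    finally show ?case .
  qed
  from this[of n] have "c ^ n - real n * K \<le> a n" .
  also have "\<dots> \<le> expectation (indicator (confined R \<delta> n))"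
    unfolding a_def using barrier_le_1
    by (intro integral_mono int) (auto simp: indicator_def less_top[symmetric])
  finally show ?thesis by simp
qed

text \<open>The grid events decrease to the event in continuous time. In the limit of fine grids
  \<open>c ^ n\<close> is bounded below by the exponential, and the accumulated error, at most
  \<open>t * K * sqrt (\<delta> m)\<close>, vanishes.\<close>

theorem prob_stays_in_ball:
  assumes R: "0 < R" and t: "0 \<le> t"
  shows "{\<omega> \<in> space M. \<forall>s\<in>{0..t}. norm (B s \<omega>) \<le> R} \<in> events"
    and "exp (- (barrier_rate TYPE('a) / R\<^sup>2 * t)) \<le> prob {\<omega> \<in> space M. \<forall>s\<in>{0..t}. norm (B s \<omega>) \<le> R}"
proof -
  define \<kappa> where "\<kappa> = barrier_rate TYPE('a) / R\<^sup>2"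
  have \<kappa>: "0 \<le> \<kappa>" by (simp add: \<kappa>_def barrier_rate_def)
  define \<delta> :: "nat \<Rightarrow> real" where "\<delta> m = 1 / 2 ^ m" for m
  define n where "n m = nat \<lfloor>t * 2 ^ m\<rfloor>" for m
  define E where "E m = confined R (\<delta> m) (n m)" for m
  have \<delta>: "0 < \<delta> m" "\<delta> m \<le> 1" for m by (auto simp: \<delta>_def)
  have \<delta>lim: "\<delta> \<longlonglongrightarrow> 0"
    unfolding \<delta>_def using LIMSEQ_power_zero[of "1/2::real"] by (simp add: power_divide)
  have iff: "i \<le> n m \<longleftrightarrow> real i * \<delta> m \<le> t" for i m
    using t by (simp add: n_def \<delta>_def le_nat_iff le_floor_iff field_simps)
  have Em[measurable]: "E m \<in> events" for m unfolding E_def by (rule confined_measurable[OF \<delta>(1)])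
  have dec: "decseq E"
  proof (rule decseq_SucI, rule subsetI)
    fix m \<omega> assume w: "\<omega> \<in> E (Suc m)"
    have "norm (B (real i * \<delta> m) \<omega>) \<le> R" if "i \<le> n m" for i
    proof -
      have e: "real (2 * i) * \<delta> (Suc m) = real i * \<delta> m" by (simp add: \<delta>_def)
      have "2 * i \<le> n (Suc m)" using that unfolding iff e .
      with w have "norm (B (real (2 * i) * \<delta> (Suc m)) \<omega>) \<le> R" unfolding E_def confined_def by blast
      then show ?thesis unfolding e .
    qed
    with w show "\<omega> \<in> E m" by (auto simp: E_def confined_def)
  qed
  have Int: "(\<Inter>m. E m) = {\<omega> \<in> space M. \<forall>s\<in>{0..t}. norm (B s \<omega>) \<le> R}"
  proof (intro equalityI subsetI)
    fix \<omega> assume w: "\<omega> \<in> (\<Inter>m. E m)"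
    then have ws: "\<omega> \<in> space M" by (auto simp: E_def confined_def)
    have q: "norm (B q \<omega>) \<le> R" if qd: "q \<in> dyadic_times" "q \<le> t" for q
    proof -
      obtain i m where "q = real i / 2 ^ m" using qd(1) unfolding dyadic_times_def by blast
      then have "q = real i * \<delta> m" by (simp add: \<delta>_def)
      moreover from this have "i \<le> n m" using qd(2) by (simp add: iff)
      moreover have "\<omega> \<in> E m" using w by blast
      ultimately show ?thesis by (auto simp: E_def confined_def)
    qed
    have "norm (B s \<omega>) \<le> R" if s: "s \<in> {0..t}" for s
    proof (rule ccontr)
      assume "\<not> norm (B s \<omega>) \<le> R"
      then have pos: "0 < norm (B s \<omega>) - R" by simp
      have cont: "continuous_on {0..} (\<lambda>s. norm (B s \<omega>))"
        by (intro continuous_intros continuous_paths[OF ws])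
      then obtain d where d: "0 < d" "\<And>q. 0 \<le> q \<Longrightarrow> dist q s < d \<Longrightarrow> dist (norm (B q \<omega>)) (norm (B s \<omega>)) < norm (B s \<omega>) - R"
        using s pos unfolding continuous_on_iff by (metis atLeastAtMost_iff atLeast_iff)
      \<comment> \<open>Dyadic times approach \<open>s\<close> from the left, so as to remain in
        \<open>[0, t]\<close>; this needs \<open>0 < s\<close>, and at time 0 the path is at the
        origin.\<close>
      have "s \<noteq> 0" using start[OF ws] pos R by auto
      then obtain q where "q \<in> dyadic_times" "max 0 (s - d) < q" "q < s"
        using s d dyadic_times_dense[of "max 0 (s - d)" s] by auto
      then show False
        using d(2)[of q] q[of q] s by (auto simp: dist_real_def)
    qed
    with ws show "\<omega> \<in> {\<omega> \<in> space M. \<forall>s\<in>{0..t}. norm (B s \<omega>) \<le> R}" by blast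
  next
    fix \<omega> assume "\<omega> \<in> {\<omega> \<in> space M. \<forall>s\<in>{0..t}. norm (B s \<omega>) \<le> R}"
    then show "\<omega> \<in> (\<Inter>m. E m)"
      using less_imp_le[OF \<delta>(1)] by (auto simp: E_def confined_def iff)
  qed
  show "{\<omega> \<in> space M. \<forall>s\<in>{0..t}. norm (B s \<omega>) \<le> R} \<in> events"
    unfolding Int[symmetric] by measurable
  obtain K where K: "0 \<le> K" "\<And>\<delta> x::'a. 0 < \<delta> \<Longrightarrow> \<delta> \<le> 1 \<Longrightarrow> norm x \<le> R \<Longrightarrow>
    (1 - barrier_rate TYPE('a) / R\<^sup>2 * \<delta>) * barrier R x - K * sqrt \<delta> ^ 3 \<le> (\<integral>y. barrier R (x + y) \<partial>gauss \<delta>)"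
    using barrier_step[OF R] by blast
  have lower: "exp (- (\<kappa> * t / (1 - \<kappa> * \<delta> m))) - t * K * sqrt (\<delta> m) \<le> prob (E m)" if small: "\<kappa> * \<delta> m < 1" for m
  proof -
    define c where "c = 1 - \<kappa> * \<delta> m"
    have c: "0 < c" "c \<le> 1" using small \<kappa> \<delta>(1)[of m] by (auto simp: c_def)
    have nt: "real (n m) * \<delta> m \<le> t" using iff[of "n m" m] by simp
    have "c ^ n m - real (n m) * (K * sqrt (\<delta> m) ^ 3) \<le> prob (E m)"
      unfolding E_def
    proof (rule prob_confined_ge[OF R \<delta>(1)])
      show "0 \<le> K * sqrt (\<delta> m) ^ 3" using K(1) less_imp_le[OF \<delta>(1)] by (intro mult_nonneg_nonneg zero_le_power) auto
      show "c * barrier R x - K * sqrt (\<delta> m) ^ 3 \<le> (\<integral>y. barrier R (x + y) \<partial>gauss (\<delta> m))" if "norm x \<le> R" for x :: 'a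
        using K(2)[OF \<delta> that] by (simp add: c_def \<kappa>_def)
    qed (use c in auto)
    moreover have "real (n m) * (K * sqrt (\<delta> m) ^ 3) \<le> t * K * sqrt (\<delta> m)"
    proof -
      have "real (n m) * (K * sqrt (\<delta> m) ^ 3) = (real (n m) * \<delta> m) * (K * sqrt (\<delta> m))"
        using \<delta>(1)[of m] by (simp add: power3_eq_cube)
      also have "\<dots> \<le> t * (K * sqrt (\<delta> m))" using nt K \<delta>(1)[of m] by (intro mult_right_mono) auto
      finally show ?thesis by (simp add: mult.assoc)
    qed
    moreover have "exp (- (\<kappa> * t / c)) \<le> c ^ n m"
    proof -
      \<comment> \<open>This is \<open>ln c \<ge> 1 - 1 / c\<close>, the usual bound for the
        logarithm applied to \<open>1 / c\<close>.\<close>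
      have "- (\<kappa> * \<delta> m / c) \<le> ln c" 
        using ln_le_minus_one[of "1 / c"] c by (simp add: ln_div c_def field_simps)
      then have "real (n m) * (- (\<kappa> * \<delta> m / c)) \<le> real (n m) * ln c" by (rule mult_left_mono) simp
      moreover have "real (n m) * (- (\<kappa> * \<delta> m / c)) = - ((real (n m) * \<delta> m) * (\<kappa> / c))" by simp
      moreover have "(real (n m) * \<delta> m) * (\<kappa> / c) \<le> t * (\<kappa> / c)"
        using nt c \<kappa> by (intro mult_right_mono) auto
      moreover have "t * (\<kappa> / c) = \<kappa> * t / c" by simp
      ultimately have "- (\<kappa> * t / c) \<le> real (n m) * ln c" by linarith
      then have "exp (- (\<kappa> * t / c)) \<le> exp (real (n m) * ln c)" by simp
      also have "\<dots> = c ^ n m" using c by (simp add: exp_of_nat_mult)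
      finally show ?thesis .
    qed
    ultimately show ?thesis unfolding c_def by linarith
  qed
  have "(\<lambda>m. prob (E m)) \<longlonglongrightarrow> prob (\<Inter>m. E m)"
    using dec by (intro finite_Lim_measure_decseq) auto
  moreover have "(\<lambda>m. exp (- (\<kappa> * t / (1 - \<kappa> * \<delta> m))) - t * K * sqrt (\<delta> m)) \<longlonglongrightarrow> exp (- (\<kappa> * t / (1 - \<kappa> * 0))) - t * K * sqrt 0"
    by (intro tendsto_intros \<delta>lim) simp
  moreover have "\<forall>\<^sub>F m in sequentially. exp (- (\<kappa> * t / (1 - \<kappa> * \<delta> m))) - t * K * sqrt (\<delta> m) \<le> prob (E m)"
  proof -
    have "(\<lambda>m. \<kappa> * \<delta> m) \<longlonglongrightarrow> \<kappa> * 0" by (intro tendsto_intros \<delta>lim)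
    then have "\<forall>\<^sub>F m in sequentially. \<kappa> * \<delta> m < 1" by (rule order_tendstoD) simp
    then show ?thesis by (rule eventually_mono) (rule lower)
  qed
  ultimately have "exp (- (\<kappa> * t / (1 - \<kappa> * 0))) - t * K * sqrt 0 \<le> prob (\<Inter>m. E m)"
    by (intro tendsto_le[OF sequentially_bot])
  then show "exp (- (barrier_rate TYPE('a) / R\<^sup>2 * t)) \<le> prob {\<omega> \<in> space M. \<forall>s\<in>{0..t}. norm (B s \<omega>) \<le> R}"
    unfolding Int by (simp add: \<kappa>_def)
qed

end

section \<open>Comparison with the driftless sausage\<close>

text \<open>On a line the intermediate value theorem fills the gap between the extremes of the path,
  so the union is an interval: the range of the path, widened by \<open>r\<close> at either
  end.\<close>

lemma measure_interval_sausage: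
  fixes f :: "real \<Rightarrow> 'a::euclidean_space"
  assumes b: "Basis = {b}" and f: "continuous_on {0..T} f" and r: "0 \<le> r"
    and s0: "s0 \<in> {0..T}" and s1: "s1 \<in> {0..T}"
    and ext: "\<And>s. s \<in> {0..T} \<Longrightarrow> f s0 \<bullet> b \<le> f s \<bullet> b" "\<And>s. s \<in> {0..T} \<Longrightarrow> f s \<bullet> b \<le> f s1 \<bullet> b"
  shows "measure lebesgue (\<Union>s\<in>{0..T}. cball (f s) r) = f s1 \<bullet> b - f s0 \<bullet> b + 2 * r"
proof -
  have bb: "b \<bullet> b = 1" by (rule inner_same_Basis) (simp add: b)
  have norm: "norm x = \<bar>x \<bullet> b\<bar>" for x :: 'a
  proof (rule antisym)
    show "norm x \<le> \<bar>x \<bullet> b\<bar>" using norm_le_l1[of x] by (simp add: b)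
    show "\<bar>x \<bullet> b\<bar> \<le> norm x" by (rule Basis_le_norm) (simp add: b)
  qed
  have "(\<Union>s\<in>{0..T}. cball (f s) r) = cbox ((f s0 \<bullet> b - r) *\<^sub>R b) ((f s1 \<bullet> b + r) *\<^sub>R b)"
  proof (intro equalityI subsetI)
    fix x assume "x \<in> (\<Union>s\<in>{0..T}. cball (f s) r)"
    then obtain s where s: "s \<in> {0..T}" "\<bar>f s \<bullet> b - x \<bullet> b\<bar> \<le> r" by (auto simp: dist_norm norm inner_diff_left)
    then show "x \<in> cbox ((f s0 \<bullet> b - r) *\<^sub>R b) ((f s1 \<bullet> b + r) *\<^sub>R b)"
      using ext[OF s(1)] by (auto simp: mem_box b bb)
  next
    fix x assume "x \<in> cbox ((f s0 \<bullet> b - r) *\<^sub>R b) ((f s1 \<bullet> b + r) *\<^sub>R b)"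
    then have x: "f s0 \<bullet> b - r \<le> x \<bullet> b" "x \<bullet> b \<le> f s1 \<bullet> b + r" by (auto simp: mem_box b bb)
    have "\<exists>s\<in>{0..T}. \<bar>f s \<bullet> b - x \<bullet> b\<bar> \<le> r"
    proof (cases "f s0 \<bullet> b \<le> x \<bullet> b \<and> x \<bullet> b \<le> f s1 \<bullet> b")
      case True
      have "connected ((\<lambda>s. f s \<bullet> b) ` {0..T})"
        using f by (intro connected_continuous_image continuous_intros) auto
      then have "x \<bullet> b \<in> (\<lambda>s. f s \<bullet> b) ` {0..T}"
        by (rule connectedD_interval[OF _ imageI[OF s0] imageI[OF s1]]) (use True in auto)
      then show ?thesis using r by force
    next
      case False
      then show ?thesis using x s0 s1 by (force intro: bexI[of _ s0] bexI[of _ s1])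
    qed
    then show "x \<in> (\<Union>s\<in>{0..T}. cball (f s) r)" by (auto simp: dist_norm norm inner_diff_left)
  qed
  moreover have "f s0 \<bullet> b \<le> f s1 \<bullet> b" using ext(1)[OF s1] .
  ultimately show ?thesis
    using r by (simp add: content_cbox_if b bb box_eq_empty not_less)
qed

text \<open>The extreme times are chosen before the radius in the last conclusion. The same times
  thus serve \<open>r\<close> and \<open>r + R\<close>, whose volumes then differ by exactly
  \<open>2 * R\<close>.\<close>

lemma wiener_sausage_interval:
  fixes g :: "real \<Rightarrow> 'a::euclidean_space"
  assumes b: "Basis = {b}" and T: "0 \<le> T" and r: "0 \<le> r"
    and g: "continuous_on {0..} g" and \<xi>: "continuous_on {0..} (\<lambda>s. \<xi> s \<omega>)"
  obtains s0 s1 where "s0 \<in> {0..T}" "s1 \<in> {0..T}"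
    "\<And>s. s \<in> {0..T} \<Longrightarrow> (g s0 - \<xi> s0 \<omega>) \<bullet> b \<le> (g s - \<xi> s \<omega>) \<bullet> b"
    "\<And>s. s \<in> {0..T} \<Longrightarrow> (g s - \<xi> s \<omega>) \<bullet> b \<le> (g s1 - \<xi> s1 \<omega>) \<bullet> b"
    "\<And>r. 0 \<le> r \<Longrightarrow> measure lebesgue (wiener_sausage \<xi> r g T \<omega>) = (g s1 - \<xi> s1 \<omega>) \<bullet> b - (g s0 - \<xi> s0 \<omega>) \<bullet> b + 2 * r"
proof -
  have c: "continuous_on {0..T} (\<lambda>s. g s - \<xi> s \<omega>)"
    by (intro continuous_intros continuous_on_subset[OF g] continuous_on_subset[OF \<xi>]) auto
  then have cb: "continuous_on {0..T} (\<lambda>s. (g s - \<xi> s \<omega>) \<bullet> b)" by (intro continuous_on_inner continuous_on_const)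
  obtain s0 where s0: "s0 \<in> {0..T}" "\<And>s. s \<in> {0..T} \<Longrightarrow> (g s0 - \<xi> s0 \<omega>) \<bullet> b \<le> (g s - \<xi> s \<omega>) \<bullet> b"
    using continuous_attains_inf[OF _ _ cb] T by auto
  obtain s1 where s1: "s1 \<in> {0..T}" "\<And>s. s \<in> {0..T} \<Longrightarrow> (g s - \<xi> s \<omega>) \<bullet> b \<le> (g s1 - \<xi> s1 \<omega>) \<bullet> b"
    using continuous_attains_sup[OF _ _ cb] T by auto
  show thesis
    using that[OF s0(1) s1(1) s0(2) s1(2)] measure_interval_sausage[OF b c _ s0(1) s1(1) s0(2) s1(2)]
    unfolding wiener_sausage_def by blast
qed

lemma expected_sausage_volume_unique:
  assumes "standard_brownian_motion M B" "standard_brownian_motion N C"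
    and "continuous_on {0..} g" "0 \<le> T"
  shows "expected_sausage_volume M B r g T = expected_sausage_volume N C r g T"
  using standard_brownian_motion.expected_sausage_volume_eq[OF assms(1) assms(3,4)]
    standard_brownian_motion.expected_sausage_volume_eq[OF assms(2) assms(3,4)] hit_prob_unique[OF assms(1,2)]
  by simp

context standard_brownian_motion
begin

text \<open>By symmetry the drift may be added to or subtracted from the motion; at the extremes of the
  driftless motion the two contributions of the drift cancel.\<close>

lemma expected_sausage_volume_ge_driftless_1d:
  assumes d: "DIM('a) = 1" and T: "0 \<le> T" and r: "0 \<le> r" and g: "continuous_on {0..} g"
  shows "expected_sausage_volume M B r (\<lambda>_. 0) T \<le> expected_sausage_volume M B r g T"
proof -
  obtain b :: 'a where b: "Basis = {b}" using d by (auto simp: card_1_singleton_iff)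
  interpret U: standard_brownian_motion M "\<lambda>t \<omega>. - B t \<omega>"
    by (rule standard_brownian_motion_uminus) (rule standard_brownian_motion_axioms)
  have sym: "expected_sausage_volume M (\<lambda>t \<omega>. - B t \<omega>) r g T = expected_sausage_volume M B r g T"
    by (rule expected_sausage_volume_unique[OF U.standard_brownian_motion_axioms standard_brownian_motion_axioms g T])
  have c0: "continuous_on {0..} (\<lambda>_. 0 :: 'a)" by simp
  have pw: "2 * measure lebesgue (wiener_sausage B r (\<lambda>_. 0) T \<omega>)
      \<le> measure lebesgue (wiener_sausage B r g T \<omega>) + measure lebesgue (wiener_sausage (\<lambda>t \<omega>. - B t \<omega>) r g T \<omega>)"
    if w: "\<omega> \<in> space M" for \<omega>
  proof -
    obtain a0 a1 where a: "a0 \<in> {0..T}" "a1 \<in> {0..T}"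
      "measure lebesgue (wiener_sausage B r (\<lambda>_. 0) T \<omega>) = (0 - B a1 \<omega>) \<bullet> b - (0 - B a0 \<omega>) \<bullet> b + 2 * r"
      using wiener_sausage_interval[where \<xi>=B and \<omega>=\<omega>, OF b T r c0 continuous_paths[OF w]] r by metis
    obtain p0 p1 where p: "\<And>s. s \<in> {0..T} \<Longrightarrow> (g p0 - B p0 \<omega>) \<bullet> b \<le> (g s - B s \<omega>) \<bullet> b"
      "\<And>s. s \<in> {0..T} \<Longrightarrow> (g s - B s \<omega>) \<bullet> b \<le> (g p1 - B p1 \<omega>) \<bullet> b"
      "measure lebesgue (wiener_sausage B r g T \<omega>) = (g p1 - B p1 \<omega>) \<bullet> b - (g p0 - B p0 \<omega>) \<bullet> b + 2 * r"
      using wiener_sausage_interval[where \<xi>=B and \<omega>=\<omega>, OF b T r g continuous_paths[OF w]] r by metis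
    obtain q0 q1 where q: "\<And>s. s \<in> {0..T} \<Longrightarrow> (g q0 - - B q0 \<omega>) \<bullet> b \<le> (g s - - B s \<omega>) \<bullet> b"
      "\<And>s. s \<in> {0..T} \<Longrightarrow> (g s - - B s \<omega>) \<bullet> b \<le> (g q1 - - B q1 \<omega>) \<bullet> b"
      "measure lebesgue (wiener_sausage (\<lambda>t \<omega>. - B t \<omega>) r g T \<omega>) = (g q1 - - B q1 \<omega>) \<bullet> b - (g q0 - - B q0 \<omega>) \<bullet> b + 2 * r"
      using wiener_sausage_interval[where \<xi>="\<lambda>t \<omega>. - B t \<omega>" and \<omega>=\<omega>, OF b T r g U.continuous_paths[OF w]] r by metis
    \<comment> \<open>The driftless volume is \<open>B a0 - B a1 + 2 * r\<close> in coordinates. The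
      range of \<open>g - B\<close> is tested at \<open>a1\<close> above and \<open>a0\<close>
      below, that of \<open>g + B\<close> the other way round, so the values of \<open>g\<close>
      cancel in the sum.\<close>
    show ?thesis
      using a(3) p(3) q(3) p(1)[OF a(1)] p(2)[OF a(2)] q(1)[OF a(2)] q(2)[OF a(1)]
      by (simp add: inner_diff_left inner_add_left)
  qed
  have "2 * expected_sausage_volume M B r (\<lambda>_. 0) T
      = expectation (\<lambda>\<omega>. 2 * measure lebesgue (wiener_sausage B r (\<lambda>_. 0) T \<omega>))"
    by (simp add: expected_sausage_volume_def)
  also have "\<dots> \<le> expectation (\<lambda>\<omega>. measure lebesgue (wiener_sausage B r g T \<omega>) + measure lebesgue (wiener_sausage (\<lambda>t \<omega>. - B t \<omega>) r g T \<omega>))"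
    by (intro integral_mono integrable_mult_right Bochner_Integration.integrable_add
        integrable_sausage_volume U.integrable_sausage_volume c0 g T r pw)
  also have "\<dots> = expected_sausage_volume M B r g T + expected_sausage_volume M (\<lambda>t \<omega>. - B t \<omega>) r g T"
    unfolding expected_sausage_volume_def
    by (intro Bochner_Integration.integral_add integrable_sausage_volume U.integrable_sausage_volume g T r)
  finally show ?thesis unfolding sym by simp
qed

lemma expected_sausage_volume_radius_1d:
  assumes d: "DIM('a) = 1" and T: "0 \<le> T" and r: "0 \<le> r" and R: "0 \<le> R"
  shows "expected_sausage_volume M B (r + R) (\<lambda>_. 0) T = expected_sausage_volume M B r (\<lambda>_. 0) T + 2 * R"
proof -
  obtain b :: 'a where b: "Basis = {b}" using d by (auto simp: card_1_singleton_iff)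
  have c0: "continuous_on {0..} (\<lambda>_. 0 :: 'a)" by simp
  have "measure lebesgue (wiener_sausage B (r + R) (\<lambda>_. 0) T \<omega>) = measure lebesgue (wiener_sausage B r (\<lambda>_. 0) T \<omega>) + 2 * R"
    if w: "\<omega> \<in> space M" for \<omega>
  proof -
    obtain a0 a1 where "\<And>r. 0 \<le> r \<Longrightarrow>
      measure lebesgue (wiener_sausage B r (\<lambda>_. 0) T \<omega>) = (0 - B a1 \<omega>) \<bullet> b - (0 - B a0 \<omega>) \<bullet> b + 2 * r"
      using wiener_sausage_interval[where \<xi>=B and \<omega>=\<omega>, OF b T r c0 continuous_paths[OF w]] by metis
    then show ?thesis using r R by simp
  qed
  then have "expected_sausage_volume M B (r + R) (\<lambda>_. 0) T
      = expectation (\<lambda>\<omega>. measure lebesgue (wiener_sausage B r (\<lambda>_. 0) T \<omega>) + 2 * R)"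
    unfolding expected_sausage_volume_def by (intro Bochner_Integration.integral_cong refl)
  also have "\<dots> = expected_sausage_volume M B r (\<lambda>_. 0) T + 2 * R"
    unfolding expected_sausage_volume_def
    by (subst Bochner_Integration.integral_add) (auto intro: integrable_sausage_volume c0 T r simp: prob_space)
  finally show ?thesis .
qed

lemma expected_sausage_volume_confined_le:
  assumes g: "continuous_on {0..} g" and T: "0 \<le> T" and r: "0 \<le> r" and R: "0 \<le> R"
    and gR: "\<And>s. s \<in> {0..T} \<Longrightarrow> norm (g s) \<le> R"
  shows "expected_sausage_volume M B r g T \<le> expected_sausage_volume M B (r + R) (\<lambda>_. 0) T"
proof -
  have c0: "continuous_on {0..} (\<lambda>_. 0 :: 'a)" by simp
  have "hit_prob M B r T g x \<le> hit_prob M B (r + R) T (\<lambda>_. 0) x" for x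
    unfolding hit_prob_def
  proof (intro finite_measure_mono hit_event Collect_mono conj_mono impI)
    fix \<omega> assume "hits r T g x (\<lambda>s. B s \<omega>)"
    show "hits (r + R) T (\<lambda>_. 0) x (\<lambda>s. B s \<omega>)"
      unfolding hits_def
    proof
      fix n
      obtain q where q: "q \<in> dyadic_times \<inter> {0..T}" "norm (g q - B q \<omega> - x) < r + 1 / real (Suc n)"
        using \<open>hits r T g x (\<lambda>s. B s \<omega>)\<close> unfolding hits_def by blast
      have "norm (0 - B q \<omega> - x) \<le> norm (g q - B q \<omega> - x) + norm (g q)"
      proof -
        have eq: "0 - B q \<omega> - x = (g q - B q \<omega> - x) - g q" by simp
        show ?thesis unfolding eq by (rule norm_triangle_ineq4)
      qed
      also have "\<dots> < (r + R) + 1 / real (Suc n)" using q gR[of q] by auto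
      finally show "\<exists>q\<in>dyadic_times \<inter> {0..T}. norm (0 - B q \<omega> - x) < r + R + 1 / real (Suc n)"
        using q(1) by blast
    qed
  qed auto
  then show ?thesis
    unfolding expected_sausage_volume_integral[OF g T r]
      expected_sausage_volume_integral[OF c0 T add_nonneg_nonneg[OF r R]]
    by (intro integral_mono integrable_hit_prob g c0 T r add_nonneg_nonneg R)
qed

text \<open>Visits are counted at integer times, and \<open>Q\<close> bounds the truncated sum of
  peak densities. Unit mesh costs only the summand 1 in the denominator, which is negligible when
  \<open>Q\<close> diverges and a matter of constants otherwise.\<close>

lemma expected_sausage_volume_ge:
  assumes g: "continuous_on {0..} g" and T: "0 \<le> T" and r: "0 \<le> r"
    and Q: "(\<Sum>j=1..nat \<lfloor>T\<rfloor>. (2 * pi * real j) powr (- real DIM('a) / 2)) \<le> Q"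
  shows "T * measure lborel (cball (0::'a) r) / (1 + measure lborel (cball (0::'a) r) * Q)
    \<le> expected_sausage_volume M B r g T"
proof -
  define V where "V = measure lborel (cball (0::'a) r)"
  define n where "n = nat \<lfloor>T\<rfloor>"
  define q where "q j = (2 * pi * real j) powr (- real DIM('a) / 2) * V" for j :: nat
  have V: "0 \<le> V" by (simp add: V_def)
  have sq: "0 \<le> (\<Sum>j=1..n. q j)" using V by (intro sum_nonneg) (auto simp: q_def)
  have Q0: "0 \<le> Q" using order_trans[OF sum_nonneg Q] by simp
  have nT: "real n \<le> T" "T \<le> real (Suc n)"
    using T by (auto simp: n_def) linarith
  have "ennreal (real (Suc n) * V) \<le> ennreal (1 + (\<Sum>j=1..n. q j)) * (\<integral>\<^sup>+x. ennreal (hit_prob M B r T g x) \<partial>lborel)"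
    unfolding V_def
  proof (rule nn_integral_hit_prob_ge[of 1])
    show "measure (gauss (real j * 1)) (cball c r) \<le> q j" if "1 \<le> j" for j and c :: 'a
      using gauss_cball_le[of "real j" r c] r that by (simp add: q_def V_def)
  qed (use r g nT in \<open>auto simp: q_def V_def\<close>)
  also have "\<dots> = ennreal ((1 + (\<Sum>j=1..n. q j)) * expected_sausage_volume M B r g T)"
    unfolding ennreal_expected_sausage_volume[OF g T r, symmetric] using sq
    by (intro ennreal_mult[symmetric] expected_sausage_volume_nonneg) auto
  finally have "real (Suc n) * V \<le> (1 + (\<Sum>j=1..n. q j)) * expected_sausage_volume M B r g T"
    using sq expected_sausage_volume_nonneg[of r g T] by (subst (asm) ennreal_le_iff) auto
  moreover have "(\<Sum>j=1..n. q j) \<le> V * Q"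
  proof -
    have "(\<Sum>j=1..n. q j) = (\<Sum>j=1..nat \<lfloor>T\<rfloor>. (2 * pi * real j) powr (- real DIM('a) / 2)) * V"
      by (simp only: q_def n_def sum_distrib_right)
    then show ?thesis using mult_right_mono[OF Q V] by (simp only: mult.commute)
  qed
  then have "(1 + (\<Sum>j=1..n. q j)) * expected_sausage_volume M B r g T \<le> (1 + V * Q) * expected_sausage_volume M B r g T"
    using expected_sausage_volume_nonneg by (intro mult_right_mono) auto
  moreover have "T * V \<le> real (Suc n) * V" using nT V by (intro mult_right_mono)
  ultimately have "T * V \<le> (1 + V * Q) * expected_sausage_volume M B r g T" by linarith
  moreover have "0 < 1 + V * Q" using V Q0 by (simp add: add_pos_nonneg)
  ultimately show ?thesis by (simp add: V_def[symmetric] pos_divide_le_eq mult.commute)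
qed

end

section \<open>Asymptotics\<close>

lemma sum_inverse_sqrt_le: "(\<Sum>j=1..n. 1 / sqrt (real j)) \<le> 2 * sqrt (real n)"
proof (induction n)
  case (Suc n)
  have "1 / sqrt (real (Suc n)) \<le> 2 * (sqrt (real (Suc n)) - sqrt (real n))"
  proof -
    define a where "a = sqrt (real n)"
    define b where "b = sqrt (real (Suc n))"
    have ab: "0 \<le> a" "a \<le> b" "0 < b" "b\<^sup>2 - a\<^sup>2 = 1" by (auto simp: a_def b_def)
    have "1 = (b - a) * (b + a)" using ab(4) by (simp add: power2_eq_square algebra_simps)
    also have "\<dots> \<le> (b - a) * (2 * b)" using ab by (intro mult_left_mono) auto
    finally show ?thesis using ab(3) unfolding a_def[symmetric] b_def[symmetric] by (simp add: field_simps)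
  qed
  with Suc show ?case by simp
qed simp

lemma sum_inverse_le: "1 \<le> n \<Longrightarrow> (\<Sum>j=1..n. 1 / real j) \<le> 1 + ln (real n)"
proof (induction n rule: dec_induct)
  case (step n)
  have "ln (real n / real (Suc n)) \<le> real n / real (Suc n) - 1"
    using step by (intro ln_le_minus_one) auto
  moreover have "ln (real n / real (Suc n)) = ln (real n) - ln (real (Suc n))" using step.hyps by (simp add: ln_div del: of_nat_Suc)
  moreover have "real n / real (Suc n) - 1 = - (1 / real (Suc n))" by (simp add: field_simps)
  ultimately show ?case using step by simp
qed simp

lemma ln_le_sum_inverse:
  assumes "1 \<le> a" "a \<le> b"
  shows "ln (real b / real a) \<le> (\<Sum>j=a..b. 1 / real j)"
proof -
  have increment: "ln (real (Suc n) / real n) \<le> 1 / real n" if "1 \<le> n" for n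
  proof -
    have "ln (real (Suc n) / real n) \<le> real (Suc n) / real n - 1" using that by (intro ln_le_minus_one) auto
    then show ?thesis using that by (simp add: field_simps)
  qed
  have "ln (real (Suc b) / real a) \<le> (\<Sum>j=a..b. 1 / real j)"
    using assms(2)
  proof (induction b rule: dec_induct)
    case base
    then show ?case using increment assms(1) by simp
  next
    case (step n)
    have "ln (real (Suc (Suc n)) / real a) = ln (real (Suc (Suc n)) / real (Suc n)) + ln (real (Suc n) / real a)"
      using assms(1) by (simp add: ln_div del: of_nat_Suc)
    then show ?case using step.IH step.hyps increment[of "Suc n"] by simp
  qed
  moreover have "ln (real b / real a) \<le> ln (real (Suc b) / real a)"
    using assms by (intro ln_mono divide_right_mono) auto
  ultimately show ?thesis by linarith
qed

section \<open>Volume bounds by dimension\<close>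

context standard_brownian_motion
begin

text \<open>The density sum is a Riemann sum of \<open>1 / u\<close> over \<open>[S, H]\<close>, so
  \<open>A = ln (H / S)\<close>. Sharpness requires \<open>S\<close> large against the squared
  radius, \<open>ln S\<close> small against \<open>ln H\<close>, and \<open>H\<close> small against
  \<open>T\<close>.\<close>

lemma expected_sausage_volume_le_2d:
  fixes S H :: nat
  assumes d: "DIM('a) = 2" and T: "0 \<le> T" and r: "0 \<le> r" and S: "1 \<le> S" "S < H"
  shows "expected_sausage_volume M B r (\<lambda>_. 0) T
    \<le> (T + real H + 1) * (2 * pi) * exp ((2 * (r + 1))\<^sup>2 / (2 * real S)) / ln (real H / real S)"
proof -
  have c0: "continuous_on {0..} (\<lambda>_. 0 :: 'a)" by simp
  have A: "0 < ln (real H / real S)" using S by simp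
  have "ln (real H / real S) * 2 ^ m \<le> (\<Sum>j=S * 2 ^ m..H * 2 ^ m. (real j / 2 ^ m) powr (- real DIM('a) / 2))" for m :: nat
  proof -
    have "ln (real H / real S) * 2 ^ m = ln (real (H * 2 ^ m) / real (S * 2 ^ m)) * 2 ^ m" by simp
    also have "\<dots> \<le> (\<Sum>j=S * 2 ^ m..H * 2 ^ m. 1 / real j) * 2 ^ m"
      using S by (intro mult_right_mono ln_le_sum_inverse) auto
    also have "\<dots> = (\<Sum>j=S * 2 ^ m..H * 2 ^ m. (real j / 2 ^ m) powr (- real DIM('a) / 2))"
      unfolding sum_distrib_right
    proof (rule sum.cong)
      fix j assume "j \<in> {S * 2 ^ m..H * 2 ^ m}"
      then have "0 < j" using S by (auto intro: Nat.gr0I)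
      then show "1 / real j * 2 ^ m = (real j / 2 ^ m) powr (- real DIM('a) / 2)"
        by (simp add: d powr_minus field_simps)
    qed simp
    finally show ?thesis .
  qed
  then have "ennreal (expected_sausage_volume M B r (\<lambda>_. 0) T)
    \<le> ennreal ((T + real H + 1) * (2 * pi) powr (real DIM('a) / 2) * exp ((2 * (r + 1) + 0)\<^sup>2 / (2 * real S)) / ln (real H / real S))"
    unfolding ennreal_expected_sausage_volume[OF c0 T r]
    using S by (intro nn_integral_hit_prob_le[OF c0 T r _ S(1) _ A]) auto
  then show ?thesis
    using A T by (subst (asm) ennreal_le_iff) (auto simp: d)
qed

lemma expected_sausage_volume_le_linear:
  assumes r: "0 \<le> r"
  obtains C where "0 < C" "\<And>T. 1 \<le> T \<Longrightarrow> expected_sausage_volume M B r (\<lambda>_. 0) T \<le> C * T"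
proof
  define c where "c = (2 * pi) powr (real DIM('a) / 2) * exp ((2 * (r + 1) + 0)\<^sup>2 / 2) / 2 powr (- real DIM('a) / 2)"
  have c: "0 < c" by (simp add: c_def)
  then show "0 < 4 * c" by simp
  fix T :: real assume T: "1 \<le> T"
  have c0: "continuous_on {0..} (\<lambda>_. 0 :: 'a)" by simp
  have T0: "0 \<le> T" using T by simp
  have "ennreal (expected_sausage_volume M B r (\<lambda>_. 0) T) \<le> ennreal ((T + 3) * c)"
    unfolding ennreal_expected_sausage_volume[OF c0 T0 r] c_def
    using nn_integral_hit_prob_le_linear[OF c0 T0 r order_refl] by (simp add: mult.assoc)
  then have "expected_sausage_volume M B r (\<lambda>_. 0) T \<le> (T + 3) * c"
    using T c by (subst (asm) ennreal_le_iff) auto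
  also have "\<dots> \<le> (4 * T) * c" using T c by (intro mult_right_mono) auto
  finally show "expected_sausage_volume M B r (\<lambda>_. 0) T \<le> 4 * c * T" by (simp add: mult_ac)
qed

text \<open>Only the order \<open>sqrt T\<close> matters, as the scale against which errors of order
  \<open>t powr (1/3)\<close> are negligible; constants are handled crudely.\<close>

lemma expected_sausage_volume_ge_1d:
  assumes d: "DIM('a) = 1" and g: "continuous_on {0..} g" and T: "0 \<le> T" and r: "0 \<le> r"
  shows "T * measure lborel (cball (0::'a) r) / (1 + measure lborel (cball (0::'a) r) * (2 * sqrt T))
    \<le> expected_sausage_volume M B r g T"
proof (rule expected_sausage_volume_ge[OF g T r])
  have "(\<Sum>j=1..nat \<lfloor>T\<rfloor>. (2 * pi * real j) powr (- real DIM('a) / 2)) \<le> (\<Sum>j=1..nat \<lfloor>T\<rfloor>. 1 / sqrt (real j))"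
  proof (rule sum_mono)
    fix j assume "j \<in> {1..nat \<lfloor>T\<rfloor>}"
    then have j: "0 < j" by simp
    have "1 * real j \<le> 2 * pi * real j" using pi_gt3 by (intro mult_right_mono) auto
    then have "(2 * pi * real j) powr (- (1/2)) \<le> real j powr (- (1/2))"
      using j by (intro powr_mono2') auto
    then show "(2 * pi * real j) powr (- real DIM('a) / 2) \<le> 1 / sqrt (real j)"
      using j by (simp add: d powr_minus powr_half_sqrt inverse_eq_divide)
  qed
  also have "\<dots> \<le> 2 * sqrt (real (nat \<lfloor>T\<rfloor>))" by (rule sum_inverse_sqrt_le)
  also have "\<dots> \<le> 2 * sqrt T" using T by simp
  finally show "(\<Sum>j=1..nat \<lfloor>T\<rfloor>. (2 * pi * real j) powr (- real DIM('a) / 2)) \<le> 2 * sqrt T" .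
qed

text \<open>The factor \<open>1 / (2 * pi)\<close> is kept exactly: for a positive radius it
  determines the leading term \<open>2 * pi * T / ln T\<close>, whereas the ball volume drops
  out.\<close>

lemma expected_sausage_volume_ge_2d:
  assumes d: "DIM('a) = 2" and g: "continuous_on {0..} g" and T: "1 \<le> T" and r: "0 \<le> r"
  shows "T * measure lborel (cball (0::'a) r) / (1 + measure lborel (cball (0::'a) r) * ((1 + ln T) / (2 * pi)))
    \<le> expected_sausage_volume M B r g T"
proof (rule expected_sausage_volume_ge[OF g _ r])
  have n: "1 \<le> nat \<lfloor>T\<rfloor>" "real (nat \<lfloor>T\<rfloor>) \<le> T" using T by (auto simp: le_nat_iff le_floor_iff)
  have "(\<Sum>j=1..nat \<lfloor>T\<rfloor>. (2 * pi * real j) powr (- real DIM('a) / 2)) = (\<Sum>j=1..nat \<lfloor>T\<rfloor>. 1 / real j) / (2 * pi)"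
    unfolding sum_divide_distrib by (intro sum.cong refl) (simp add: d powr_minus field_simps)
  also have "\<dots> \<le> (1 + ln (real (nat \<lfloor>T\<rfloor>))) / (2 * pi)"
    using sum_inverse_le[OF n(1)] by (intro divide_right_mono) auto
  also have "\<dots> \<le> (1 + ln T) / (2 * pi)" using n by (intro divide_right_mono) auto
  finally show "(\<Sum>j=1..nat \<lfloor>T\<rfloor>. (2 * pi * real j) powr (- real DIM('a) / 2)) \<le> (1 + ln T) / (2 * pi)" .
qed (use T in simp)

text \<open>Transience: the return densities are summable, so the expected number of returns is
  bounded for all time. The constant is obtained before \<open>g\<close> and \<open>T\<close>, hence
  one choice works for every target.\<close>

lemma expected_sausage_volume_ge_linear:
  assumes d: "3 \<le> DIM('a)" and r: "0 < r"
  obtains c where "0 < c" "\<And>g T. continuous_on {0..} g \<Longrightarrow> 0 \<le> T \<Longrightarrow> c * T \<le> expected_sausage_volume M B r g T"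
proof
  define Q where "Q = (\<Sum>j. real j powr (- real DIM('a) / 2))"
  define V where "V = measure lborel (cball (0::'a) r)"
  have V: "0 < V" using r by (simp add: V_def content_cball unit_ball_vol_pos)
  have s: "summable (\<lambda>j. real j powr (- real DIM('a) / 2))" using d by (subst summable_real_powr_iff) auto
  have Q: "0 \<le> Q" unfolding Q_def by (intro suminf_nonneg s) simp
  show "0 < V / (1 + V * Q)" using V Q by (intro divide_pos_pos add_pos_nonneg) auto
  fix g :: "real \<Rightarrow> 'a" and T :: real assume g: "continuous_on {0..} g" and T: "0 \<le> T"
  have "(\<Sum>j=1..nat \<lfloor>T\<rfloor>. (2 * pi * real j) powr (- real DIM('a) / 2)) \<le> (\<Sum>j=1..nat \<lfloor>T\<rfloor>. real j powr (- real DIM('a) / 2))"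
  proof (intro sum_mono powr_mono2')
    fix j :: nat
    show "real j \<le> 2 * pi * real j" using mult_right_mono[of 1 "2 * pi" "real j"] pi_gt3 by simp
  qed auto
  also have "\<dots> \<le> Q" unfolding Q_def by (intro sum_le_suminf s) auto
  finally show "V / (1 + V * Q) * T \<le> expected_sausage_volume M B r g T"
    using expected_sausage_volume_ge[OF g T _ , of r Q] r by (simp add: V_def mult.commute)
qed

end

section \<open>From volume bounds to probabilities of no detection\<close>

context independent_target
begin

text \<open>A bound on the volume that holds along every path of the target passes through the mean
  of the exponential. The mean is positive because its integrand is, and this is what allows the
  logarithm to be compared.\<close>

lemma neg_log_undetected_ge:
  fixes \<xi> :: "real \<Rightarrow> 'v \<Rightarrow> 'a"
  assumes N: "standard_brownian_motion N \<xi>" and lam: "0 < lam" and r: "0 \<le> r" and t: "0 \<le> t"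
    and L: "\<And>\<omega>. \<omega> \<in> space M \<Longrightarrow> L \<le> expected_sausage_volume N \<xi> r (\<lambda>s. g s \<omega>) t"
  shows "L \<le> neg_log_undetected M lam X \<zeta> r g t"
proof -
  interpret N: standard_brownian_motion N \<xi> by fact
  let ?f = "\<lambda>\<omega>. exp (- (lam * expected_sausage_volume N \<xi> r (\<lambda>s. g s \<omega>) t))"
  have lam': "0 \<le> lam" using lam by simp
  have int: "integrable M ?f"
    using lam N.expected_sausage_volume_nonneg
    by (intro integrable_const_bound[where B=1] prob_miss(2)[OF N lam' r t]) auto
  have "expectation ?f \<noteq> 0"
  proof
    assume "expectation ?f = 0"
    then have "AE \<omega> in M. ?f \<omega> = 0" by (subst (asm) integral_nonneg_eq_0_iff_AE[OF int]) auto
    then have "AE \<omega> in M. False" by (rule AE_mp) auto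
    then show False by simp
  qed
  moreover have "0 \<le> expectation ?f" by (intro integral_nonneg_AE) auto
  ultimately have pos: "0 < expectation ?f" by linarith
  have "expectation ?f \<le> exp (- (lam * L))"
    using lam L by (intro integral_le_const int AE_I2) auto
  then have "ln (expectation ?f) \<le> ln (exp (- (lam * L)))" using pos by (intro ln_mono) auto
  then have "ln (expectation ?f) \<le> - (lam * L)" by simp
  then show ?thesis
    unfolding neg_log_undetected_def prob_undetected[OF N lam' r t] using lam by (simp add: field_simps)
qed

text \<open>The mean is restricted to the event of confinement. Its cost in the exponent, divided by
  \<open>lam\<close>, becomes the additive term of order \<open>t / R\<^sup>2\<close>;
  \<open>R\<close> is left free for the three regimes.\<close>

lemma neg_log_undetected_le:
  fixes \<xi> :: "real \<Rightarrow> 'v \<Rightarrow> 'a"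
  assumes N: "standard_brownian_motion N \<xi>" and G: "standard_brownian_motion M g"
    and lam: "0 < lam" and r: "0 \<le> r" and t: "0 \<le> t" and R: "0 < R"
  shows "neg_log_undetected M lam X \<zeta> r g t
    \<le> barrier_rate TYPE('a) / lam * t / R\<^sup>2 + expected_sausage_volume N \<xi> (r + R) (\<lambda>_. 0) t"
proof -
  interpret N: standard_brownian_motion N \<xi> by fact
  interpret G: standard_brownian_motion M g by fact
  let ?f = "\<lambda>\<omega>. exp (- (lam * expected_sausage_volume N \<xi> r (\<lambda>s. g s \<omega>) t))"
  define v where "v = expected_sausage_volume N \<xi> (r + R) (\<lambda>_. 0) t"
  define E where "E = {\<omega> \<in> space M. \<forall>s\<in>{0..t}. norm (g s \<omega>) \<le> R}"
  define a where "a = barrier_rate TYPE('a) / R\<^sup>2 * t"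
  have lam': "0 \<le> lam" using lam by simp
  have int: "integrable M ?f"
    using lam N.expected_sausage_volume_nonneg
    by (intro integrable_const_bound[where B=1] prob_miss(2)[OF N lam' r t]) auto
  have E: "E \<in> events" unfolding E_def by (rule G.prob_stays_in_ball(1)[OF R t])
  have "exp (- (a + lam * v)) = exp (- a) * exp (- (lam * v))" by (simp flip: exp_add)
  also have "\<dots> \<le> prob E * exp (- (lam * v))"
    unfolding E_def a_def by (intro mult_right_mono G.prob_stays_in_ball(2)[OF R t]) simp
  also have "\<dots> = expectation (\<lambda>\<omega>. indicator E \<omega> * exp (- (lam * v)))" using E by simp
  also have "\<dots> \<le> expectation ?f"
  proof (rule integral_mono[OF _ int])
    show "integrable M (\<lambda>\<omega>. indicator E \<omega> * exp (- (lam * v)))"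
      using E by (intro integrable_mult_left integrable_real_indicator) (auto simp: less_top[symmetric])
    fix \<omega> assume w: "\<omega> \<in> space M"
    show "indicator E \<omega> * exp (- (lam * v)) \<le> ?f \<omega>"
    proof (cases "\<omega> \<in> E")
      case True
      then have "expected_sausage_volume N \<xi> r (\<lambda>s. g s \<omega>) t \<le> v"
        unfolding v_def using R
        by (intro N.expected_sausage_volume_confined_le target_continuous[OF w] t r) (auto simp: E_def)
      then show ?thesis using True lam by simp
    qed simp
  qed
  finally have le: "exp (- (a + lam * v)) \<le> expectation ?f" .
  then have "- (a + lam * v) \<le> ln (expectation ?f)"
    by (subst ln_ge_iff) (auto intro: less_le_trans[OF exp_gt_zero])
  then have "- ln (expectation ?f) / lam \<le> (a + lam * v) / lam" using lam by (intro divide_right_mono) auto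
  also have "\<dots> = barrier_rate TYPE('a) / lam * t / R\<^sup>2 + v" using lam by (simp add: a_def field_simps)
  finally show ?thesis
    unfolding neg_log_undetected_def prob_undetected[OF N lam' r t] v_def by simp
qed

end

text \<open>Numerator and denominator are both asymptotic to \<open>2 * pi * t / ln t\<close>: the
  exponent is of order \<open>1 / ln t\<close>, and \<open>ln (H / S)\<close> differs from
  \<open>ln t\<close> only by a multiple of \<open>ln (ln t)\<close> to leading order.\<close>

lemma ratio_2d:
  fixes V r :: real assumes "0 < V"
  shows "((\<lambda>t. (t * V / (1 + V * ((1 + ln t) / (2 * pi))))
      / ((t + (t / ln t + 1) + 1) * (2 * pi) * exp ((2 * (r + ln t + 1))\<^sup>2 / (2 * (ln t) ^ 3))
         / ln ((t / ln t) / ((ln t) ^ 3 + 2)))) \<longlongrightarrow> 1) at_top"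
  using assms by real_asymp

lemma eventually_sausage_volume_le_2d:
  assumes N: "standard_brownian_motion N (\<xi> :: real \<Rightarrow> 'v \<Rightarrow> 'a::euclidean_space)" and d: "DIM('a) = 2" and r: "0 < r"
  shows "\<forall>\<^sub>F t in at_top. expected_sausage_volume N \<xi> (r + ln t) (\<lambda>_. 0) t
    \<le> (t + (t / ln t + 1) + 1) * (2 * pi) * exp ((2 * (r + ln t + 1))\<^sup>2 / (2 * (ln t) ^ 3))
         / ln ((t / ln t) / ((ln t) ^ 3 + 2))"
proof -
  interpret N: standard_brownian_motion N \<xi> by fact
  have "\<forall>\<^sub>F t::real in at_top. 1 < (t / ln t) / ((ln t) ^ 3 + 2)" by real_asymp
  moreover have "\<forall>\<^sub>F t::real in at_top. exp 1 < t" by (rule eventually_gt_at_top)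
  ultimately show ?thesis
  proof eventually_elim
    case (elim t)
    \<comment> \<open>With a radius of order \<open>ln t\<close>, the cube makes the exponent vanish
      while \<open>ln S\<close> stays of order \<open>ln (ln t)\<close>; the added 1 guarantees
      \<open>1 \<le> S\<close>. The choice of \<open>H\<close> is of smaller order than
      \<open>t\<close>, yet its logarithm is asymptotic to \<open>ln t\<close>.\<close>
    define S where "S = nat \<lceil>(ln t) ^ 3\<rceil> + 1"
    define H where "H = nat \<lceil>t / ln t\<rceil>"
    have "(1::real) < exp 1" by simp
    with elim(2) have t: "1 \<le> t" "0 < t" by linarith+
    have "ln (exp 1) < ln t" using elim(2) t by (subst ln_less_cancel_iff) auto
    then have l: "1 < ln t" by simp
    have S: "(ln t) ^ 3 \<le> real S" "real S \<le> (ln t) ^ 3 + 2" "1 \<le> S"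
      using l by (auto simp: S_def) linarith+
    have H: "t / ln t \<le> real H" "real H \<le> t / ln t + 1"
      using l t by (auto simp: H_def)
    have Spos: "0 < real S" "0 < (ln t) ^ 3" using S(3) l by auto
    have ratio: "(t / ln t) / ((ln t) ^ 3 + 2) \<le> real H / real S"
      using H(1) S(2) Spos l t by (intro frac_le) (simp_all only: of_nat_0_le_iff divide_nonneg_nonneg less_imp_le)
    then have "1 < real H / real S" using elim(1) by linarith
    then have SH: "S < H" using Spos by (simp add: less_divide_eq)
    have "expected_sausage_volume N \<xi> (r + ln t) (\<lambda>_. 0) t
        \<le> (t + real H + 1) * (2 * pi) * exp ((2 * (r + ln t + 1))\<^sup>2 / (2 * real S)) / ln (real H / real S)"
      using r l t by (intro N.expected_sausage_volume_le_2d d S SH) auto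
    also have "\<dots> \<le> (t + (t / ln t + 1) + 1) * (2 * pi) * exp ((2 * (r + ln t + 1))\<^sup>2 / (2 * (ln t) ^ 3))
         / ln ((t / ln t) / ((ln t) ^ 3 + 2))"
    proof (intro frac_le mult_mono)
      show "exp ((2 * (r + ln t + 1))\<^sup>2 / (2 * real S)) \<le> exp ((2 * (r + ln t + 1))\<^sup>2 / (2 * (ln t) ^ 3))"
        unfolding exp_le_cancel_iff using S(1) S(3) l by (intro divide_left_mono mult_pos_pos) auto
      show "ln ((t / ln t) / ((ln t) ^ 3 + 2)) \<le> ln (real H / real S)"
        using ratio elim(1) by (intro ln_mono) auto
      show "0 < ln ((t / ln t) / ((ln t) ^ 3 + 2))" using elim(1) by simp
    qed (use H t l in auto)
    finally show ?case .
  qed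
qed

theorem theorem3p5:
  fixes lam r :: real
    and N :: "'v measure"
    and \<xi> :: "real \<Rightarrow> 'v \<Rightarrow> 'a::euclidean_space"
  assumes "lam > 0" and "r > 0"
    and "standard_brownian_motion N \<xi>"
  shows
    "(\<forall>(M :: 'w measure) (X :: nat \<Rightarrow> 'w \<Rightarrow> 'a) \<zeta> (g :: real \<Rightarrow> 'a).
        mobile_nodes M lam X \<zeta> \<longrightarrow> g 0 = 0 \<longrightarrow> continuous_on {0..} g \<longrightarrow>
        (\<forall>t\<ge>0. neg_log_undetected M lam X \<zeta> r (\<lambda>s _. g s) t
               = expected_sausage_volume N \<xi> r g t))
     \<and> (\<exists>\<beta>\<^sub>1::real>0. \<forall>(M :: 'w measure) (X :: nat \<Rightarrow> 'w \<Rightarrow> 'a) \<zeta> g.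
        independent_target M lam X \<zeta> g \<longrightarrow>
        (DIM('a) = 1 \<longrightarrow>
           (\<forall>\<^sub>F t in at_top. neg_log_undetected M lam X \<zeta> r g t \<ge> V0 N \<xi> r t)) \<and>
        (DIM('a) = 2 \<longrightarrow> (\<exists>\<epsilon> \<in> o(\<lambda>_::real. 1::real).
           \<forall>\<^sub>F t in at_top. neg_log_undetected M lam X \<zeta> r g t \<ge> (1 - \<epsilon> t) * V0 N \<xi> r t)) \<and>
        (DIM('a) \<ge> 3 \<longrightarrow> (\<exists>\<epsilon> \<in> o(\<lambda>_::real. 1::real).
           \<forall>\<^sub>F t in at_top. neg_log_undetected M lam X \<zeta> r g t \<ge> (1 - \<epsilon> t) * \<beta>\<^sub>1 * V0 N \<xi> r t)))
     \<and> (\<exists>\<beta>\<^sub>2::real>0. \<forall>(M :: 'w measure) (X :: nat \<Rightarrow> 'w \<Rightarrow> 'a) \<zeta> g.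
        independent_target M lam X \<zeta> g \<longrightarrow> standard_brownian_motion M g \<longrightarrow>
        (DIM('a) = 1 \<or> DIM('a) = 2 \<longrightarrow> (\<exists>\<epsilon> \<in> o(\<lambda>_::real. 1::real).
           \<forall>\<^sub>F t in at_top. neg_log_undetected M lam X \<zeta> r g t \<le> (1 + \<epsilon> t) * V0 N \<xi> r t)) \<and>
        (DIM('a) \<ge> 3 \<longrightarrow> (\<exists>\<epsilon> \<in> o(\<lambda>_::real. 1::real).
           \<forall>\<^sub>F t in at_top. neg_log_undetected M lam X \<zeta> r g t \<le> (1 + \<epsilon> t) * \<beta>\<^sub>2 * V0 N \<xi> r t)))"
proof -
  interpret N: standard_brownian_motion N \<xi> by fact
  note lam = assms(1) and r = assms(2) and bm = assms(3)
  have r0: "0 \<le> r" using r by simp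
  have c0: "continuous_on {0..} (\<lambda>_. 0 :: 'a)" by simp
  define V where "V = measure lborel (cball (0::'a) r)"
  have V: "0 < V" using r by (simp add: V_def content_cball unit_ball_vol_pos)
  define \<kappa> where "\<kappa> = barrier_rate TYPE('a) / lam"
  have \<kappa>: "0 \<le> \<kappa>" using lam by (simp add: \<kappa>_def barrier_rate_def)
  define L2 where "L2 t = t * V / (1 + V * ((1 + ln t) / (2 * pi)))" for t
  define U2 where "U2 t = (t + (t / ln t + 1) + 1) * (2 * pi) * exp ((2 * (r + ln t + 1))\<^sup>2 / (2 * (ln t) ^ 3))
         / ln ((t / ln t) / ((ln t) ^ 3 + 2))" for t
  have L2U2: "((\<lambda>t. L2 t / U2 t) \<longlongrightarrow> 1) at_top"
    unfolding L2_def[abs_def] U2_def[abs_def] by (rule ratio_2d[OF V])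
  have L2pos: "\<forall>\<^sub>F t in at_top. 0 < L2 t" unfolding L2_def[abs_def] using V by real_asymp
  have U2pos: "\<forall>\<^sub>F t in at_top. 0 < U2 t" unfolding U2_def[abs_def] by real_asymp
  show ?thesis
  proof (intro conjI)
    show "\<forall>(M :: 'w measure) (X :: nat \<Rightarrow> 'w \<Rightarrow> 'a) \<zeta> (g :: real \<Rightarrow> 'a).
        mobile_nodes M lam X \<zeta> \<longrightarrow> g 0 = 0 \<longrightarrow> continuous_on {0..} g \<longrightarrow>
        (\<forall>t\<ge>0. neg_log_undetected M lam X \<zeta> r (\<lambda>s _. g s) t = expected_sausage_volume N \<xi> r g t)"
    proof (intro allI impI)
      fix M :: "'w measure" and X :: "nat \<Rightarrow> 'w \<Rightarrow> 'a" and \<zeta> and g :: "real \<Rightarrow> 'a" and t :: real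
      assume m: "mobile_nodes M lam X \<zeta>" and g: "g 0 = 0" "continuous_on {0..} g" and t: "0 \<le> t"
      interpret independent_target M lam X \<zeta> "\<lambda>s _. g s"
        by (rule mobile_nodes.deterministic_target[OF m g])
      show "neg_log_undetected M lam X \<zeta> r (\<lambda>s _. g s) t = expected_sausage_volume N \<xi> r g t"
        unfolding neg_log_undetected_def prob_undetected[OF bm less_imp_le[OF lam] r0 t]
        using lam by (simp add: prob_space)
    qed
  next
    show "\<exists>\<beta>\<^sub>1::real>0. \<forall>(M :: 'w measure) (X :: nat \<Rightarrow> 'w \<Rightarrow> 'a) \<zeta> g.
        independent_target M lam X \<zeta> g \<longrightarrow>
        (DIM('a) = 1 \<longrightarrow>
           (\<forall>\<^sub>F t in at_top. neg_log_undetected M lam X \<zeta> r g t \<ge> V0 N \<xi> r t)) \<and>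
        (DIM('a) = 2 \<longrightarrow> (\<exists>\<epsilon> \<in> o(\<lambda>_::real. 1::real).
           \<forall>\<^sub>F t in at_top. neg_log_undetected M lam X \<zeta> r g t \<ge> (1 - \<epsilon> t) * V0 N \<xi> r t)) \<and>
        (DIM('a) \<ge> 3 \<longrightarrow> (\<exists>\<epsilon> \<in> o(\<lambda>_::real. 1::real).
           \<forall>\<^sub>F t in at_top. neg_log_undetected M lam X \<zeta> r g t \<ge> (1 - \<epsilon> t) * \<beta>\<^sub>1 * V0 N \<xi> r t))"
    proof -
      obtain C where C: "0 < C" "\<And>T. 1 \<le> T \<Longrightarrow> V0 N \<xi> r T \<le> C * T"
        using N.expected_sausage_volume_le_linear[OF r0] by blast
      \<comment> \<open>The constant of (ii) is quantified before the split by dimension, so a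
        positive number is required in all cases; below dimension 3 it is arbitrary, here 1.\<close>
      have "\<exists>c>0. 3 \<le> DIM('a) \<longrightarrow> (\<forall>g T. continuous_on {0..} g \<longrightarrow> 0 \<le> T \<longrightarrow> c * T \<le> expected_sausage_volume N \<xi> r g T)"
        using N.expected_sausage_volume_ge_linear[OF _ r] by (metis zero_less_one)
      then obtain c where c: "0 < c" "\<And>g T. 3 \<le> DIM('a) \<Longrightarrow> continuous_on {0..} g \<Longrightarrow> 0 \<le> T \<Longrightarrow> c * T \<le> expected_sausage_volume N \<xi> r g T"
        by blast
      show ?thesis
      \<comment> \<open>Linear lower constant for every drift over the linear upper constant of the
        driftless volume.\<close>
      proof (intro exI[of _ "c / C"] conjI allI impI)
        show "0 < c / C" using c C by simp
        fix M :: "'w measure" and X :: "nat \<Rightarrow> 'w \<Rightarrow> 'a" and \<zeta> g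
        assume it: "independent_target M lam X \<zeta> g"
        interpret independent_target M lam X \<zeta> g by fact
        note ge = neg_log_undetected_ge[OF bm lam r0]
        {
          assume d: "DIM('a) = 1"
          show "\<forall>\<^sub>F t in at_top. neg_log_undetected M lam X \<zeta> r g t \<ge> V0 N \<xi> r t"
            using eventually_ge_at_top[of 0]
            by (rule eventually_mono)
              (auto intro!: ge N.expected_sausage_volume_ge_driftless_1d d r0 target_continuous)
        next
          assume d: "DIM('a) = 2"
          \<comment> \<open>With \<open>V0 \<le> U2\<close> and \<open>L2\<close> below the volume
            for every drift, the factor \<open>L2 / U2\<close> in front of \<open>V0\<close> is
            admissible.\<close>
          have eps: "(\<lambda>t. 1 - L2 t / U2 t) \<in> o(\<lambda>_::real. 1::real)"
            by (rule smalloI_tendsto) (use tendsto_diff[OF tendsto_const[of 1] L2U2] in auto)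
          have "\<forall>\<^sub>F t in at_top. neg_log_undetected M lam X \<zeta> r g t \<ge> (1 - (1 - L2 t / U2 t)) * V0 N \<xi> r t"
            using eventually_sausage_volume_le_2d[OF bm d r] U2pos L2pos eventually_ge_at_top[of 1]
          proof eventually_elim
            case (elim t)
            have t: "0 \<le> t" "0 \<le> ln t" using elim(4) by auto
            \<comment> \<open>The comparison for confined drifts, applied to the zero path, is
              monotonicity in the radius. The bound at radius \<open>r + ln t\<close>, needed for
              (iii), thus serves here too.\<close>
            have "V0 N \<xi> r t \<le> expected_sausage_volume N \<xi> (r + ln t) (\<lambda>_. 0) t"
              using t by (intro N.expected_sausage_volume_confined_le c0 r0) auto
            then have V0U: "V0 N \<xi> r t \<le> U2 t" using elim(1) by (simp add: U2_def)
            have "L2 t \<le> neg_log_undetected M lam X \<zeta> r g t"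
              unfolding L2_def V_def
              by (intro ge t N.expected_sausage_volume_ge_2d d target_continuous elim(4) r0)
            moreover have "L2 t / U2 t * V0 N \<xi> r t \<le> L2 t / U2 t * U2 t"
              using elim V0U by (intro mult_left_mono) auto
            ultimately show ?case using elim(2) by simp
          qed
          with eps show "\<exists>\<epsilon> \<in> o(\<lambda>_::real. 1::real).
             \<forall>\<^sub>F t in at_top. neg_log_undetected M lam X \<zeta> r g t \<ge> (1 - \<epsilon> t) * V0 N \<xi> r t"
            by (intro bexI[where x="\<lambda>t. 1 - L2 t / U2 t"])
        next
          assume d: "3 \<le> DIM('a)"
          have "\<forall>\<^sub>F t in at_top. neg_log_undetected M lam X \<zeta> r g t \<ge> (1 - 0) * (c / C) * V0 N \<xi> r t"
            using eventually_ge_at_top[of 1]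
          proof eventually_elim
            case (elim t)
            then have t: "0 \<le> t" by simp
            have "c / C * V0 N \<xi> r t \<le> c / C * (C * t)"
              using C(2)[OF elim] c C by (intro mult_left_mono) auto
            also have "\<dots> = c * t" using C by simp
            also have "\<dots> \<le> neg_log_undetected M lam X \<zeta> r g t"
              by (intro ge t c(2)[OF d] target_continuous)
            finally show ?case by simp
          qed
          then show "\<exists>\<epsilon> \<in> o(\<lambda>_::real. 1::real).
             \<forall>\<^sub>F t in at_top. neg_log_undetected M lam X \<zeta> r g t \<ge> (1 - \<epsilon> t) * (c / C) * V0 N \<xi> r t"
            by (intro bexI[of _ "\<lambda>_. 0"]) auto
        }
      qed
    qed
  next
    show "\<exists>\<beta>\<^sub>2::real>0. \<forall>(M :: 'w measure) (X :: nat \<Rightarrow> 'w \<Rightarrow> 'a) \<zeta> g.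
        independent_target M lam X \<zeta> g \<longrightarrow> standard_brownian_motion M g \<longrightarrow>
        (DIM('a) = 1 \<or> DIM('a) = 2 \<longrightarrow> (\<exists>\<epsilon> \<in> o(\<lambda>_::real. 1::real).
           \<forall>\<^sub>F t in at_top. neg_log_undetected M lam X \<zeta> r g t \<le> (1 + \<epsilon> t) * V0 N \<xi> r t)) \<and>
        (DIM('a) \<ge> 3 \<longrightarrow> (\<exists>\<epsilon> \<in> o(\<lambda>_::real. 1::real).
           \<forall>\<^sub>F t in at_top. neg_log_undetected M lam X \<zeta> r g t \<le> (1 + \<epsilon> t) * \<beta>\<^sub>2 * V0 N \<xi> r t))"
    proof -
      have r1: "0 \<le> r + 1" using r by simp
      obtain C where C: "0 < C" "\<And>T. 1 \<le> T \<Longrightarrow> V0 N \<xi> (r + 1) T \<le> C * T"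
        using N.expected_sausage_volume_le_linear[OF r1] by blast
      have "\<exists>c>0. 3 \<le> DIM('a) \<longrightarrow> (\<forall>T\<ge>0. c * T \<le> V0 N \<xi> r T)"
        using N.expected_sausage_volume_ge_linear[OF _ r] c0 by (metis zero_less_one)
      then obtain c where c: "0 < c" "\<And>T. 3 \<le> DIM('a) \<Longrightarrow> 0 \<le> T \<Longrightarrow> c * T \<le> V0 N \<xi> r T"
        by blast
      show ?thesis
      \<comment> \<open>Confinement in a ball of radius 1 costs \<open>\<kappa> * t\<close> and the
        enlarged sausage at most \<open>C * t\<close>; both are measured against the lower bound
        \<open>c * t\<close> for \<open>V0\<close>.\<close>
      proof (intro exI[of _ "(\<kappa> + C) / c"] conjI allI impI)
        show "0 < (\<kappa> + C) / c" using c C \<kappa> by simp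
        fix M :: "'w measure" and X :: "nat \<Rightarrow> 'w \<Rightarrow> 'a" and \<zeta> g
        assume it: "independent_target M lam X \<zeta> g" and gbm: "standard_brownian_motion M g"
        interpret independent_target M lam X \<zeta> g by fact
        have le: "neg_log_undetected M lam X \<zeta> r g t \<le> \<kappa> * t / R\<^sup>2 + V0 N \<xi> (r + R) t" if "0 \<le> t" "0 < R" for t R
          using neg_log_undetected_le[OF bm gbm lam r0 that] by (simp add: \<kappa>_def)
        {
          assume "DIM('a) = 1 \<or> DIM('a) = 2"
          then show "\<exists>\<epsilon> \<in> o(\<lambda>_::real. 1::real).
             \<forall>\<^sub>F t in at_top. neg_log_undetected M lam X \<zeta> r g t \<le> (1 + \<epsilon> t) * V0 N \<xi> r t"
          proof
            assume d: "DIM('a) = 1"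
            define L1 where "L1 t = t * V / (1 + V * (2 * sqrt t))" for t
            \<comment> \<open>The exponent 1/3 balances the cost of confinement,
              \<open>t / R\<^sup>2\<close>, against the widening \<open>2 * R\<close>. Both become
              of order \<open>t powr (1/3)\<close>, while \<open>L1\<close> is of order
              \<open>sqrt t\<close>.\<close>
            define e where "e t = (\<kappa> * t / (t powr (1/3))\<^sup>2 + 2 * t powr (1/3)) / L1 t" for t
            have eps: "e \<in> o(\<lambda>_::real. 1::real)"
              unfolding e_def[abs_def] L1_def using V \<kappa> by real_asymp
            have "\<forall>\<^sub>F t in at_top. neg_log_undetected M lam X \<zeta> r g t \<le> (1 + e t) * V0 N \<xi> r t"
              using eventually_gt_at_top[of 0]
            proof eventually_elim
              case (elim t)
              define R where "R = t powr (1/3)"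
              have R: "0 < R" using elim by (simp add: R_def)
              have L1: "0 < L1 t" using elim V by (auto simp: L1_def intro!: divide_pos_pos add_pos_nonneg)
              have "L1 t \<le> V0 N \<xi> r t"
                unfolding L1_def V_def using elim by (intro N.expected_sausage_volume_ge_1d d c0 r0) auto
              then have "\<kappa> * t / R\<^sup>2 + 2 * R \<le> e t * V0 N \<xi> r t"
                using L1 R elim \<kappa> mult_left_mono[of "L1 t" "V0 N \<xi> r t" "(\<kappa> * t / R\<^sup>2 + 2 * R) / L1 t"]
                by (simp add: e_def R_def[symmetric])
              moreover have "neg_log_undetected M lam X \<zeta> r g t \<le> \<kappa> * t / R\<^sup>2 + (V0 N \<xi> r t + 2 * R)"
                using le[of t R] N.expected_sausage_volume_radius_1d[OF d _ r0, of t R] elim R by simp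
              ultimately show ?case by (simp add: distrib_right)
            qed
            with eps show ?thesis by (intro bexI[where x=e])
          next
            assume d: "DIM('a) = 2"
            \<comment> \<open>\<open>1 + e\<close> is the whole upper bound, confinement cost plus
              \<open>U2\<close>, divided by the lower bound \<open>L2\<close> for \<open>V0\<close>.
              The cost is of order \<open>t / (ln t)\<^sup>2\<close>, one logarithm below
              \<open>L2\<close>.\<close>
            define e where "e t = (\<kappa> * t / (ln t)\<^sup>2) / L2 t + (1 / (L2 t / U2 t) - 1)" for t
            have "((\<lambda>t. (\<kappa> * t / (ln t)\<^sup>2) / L2 t) \<longlongrightarrow> 0) at_top"
              unfolding L2_def using V by real_asymp
            then have "(e \<longlongrightarrow> 0 + (1 / 1 - 1)) at_top"
              unfolding e_def[abs_def] by (intro tendsto_intros L2U2) auto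
            then have eps: "e \<in> o(\<lambda>_::real. 1::real)"
              by (intro smalloI_tendsto) auto
            have "\<forall>\<^sub>F t in at_top. neg_log_undetected M lam X \<zeta> r g t \<le> (1 + e t) * V0 N \<xi> r t"
              using eventually_sausage_volume_le_2d[OF bm d r] U2pos L2pos eventually_gt_at_top[of 1]
            proof eventually_elim
              case (elim t)
              have t: "0 \<le> t" "0 < ln t" using elim(4) by auto
              define W where "W = \<kappa> * t / (ln t)\<^sup>2 + U2 t"
              have W: "0 \<le> W" using elim(2) \<kappa> t by (simp add: W_def)
              have "L2 t \<le> V0 N \<xi> r t"
                unfolding L2_def V_def using elim by (intro N.expected_sausage_volume_ge_2d d c0 r0) auto
              then have "W / L2 t * L2 t \<le> W / L2 t * V0 N \<xi> r t"
                using W elim by (intro mult_left_mono) auto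
              moreover have "1 + e t = W / L2 t"
                using elim by (simp add: e_def W_def add_divide_distrib)
              moreover have "neg_log_undetected M lam X \<zeta> r g t \<le> W"
                using le[OF t] elim(1) by (simp add: W_def U2_def)
              ultimately show ?case using elim by simp
            qed
            with eps show ?thesis by (intro bexI[where x=e])
          qed
        next
          assume d: "3 \<le> DIM('a)"
          have "\<forall>\<^sub>F t in at_top. neg_log_undetected M lam X \<zeta> r g t \<le> (1 + 0) * ((\<kappa> + C) / c) * V0 N \<xi> r t"
            using eventually_ge_at_top[of 1]
          proof eventually_elim
            case (elim t)
            then have t: "0 \<le> t" by simp
            have "neg_log_undetected M lam X \<zeta> r g t \<le> \<kappa> * t + C * t"
              using le[OF t, of 1] C(2)[OF elim] by simp
            also have "\<dots> = (\<kappa> + C) / c * (c * t)" using c by (simp add: field_simps)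
            also have "\<dots> \<le> (\<kappa> + C) / c * V0 N \<xi> r t"
              using c(1) c(2)[OF d t] C \<kappa> by (intro mult_left_mono) auto
            finally show ?case by simp
          qed
          then show "\<exists>\<epsilon> \<in> o(\<lambda>_::real. 1::real).
             \<forall>\<^sub>F t in at_top. neg_log_undetected M lam X \<zeta> r g t \<le> (1 + \<epsilon> t) * ((\<kappa> + C) / c) * V0 N \<xi> r t"
            by (intro bexI[of _ "\<lambda>_. 0"]) auto
        }
      qed
    qed
  qed
qed

end
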